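(* Let $\mathcal G$ be an étale groupoid with unit space $X$. Every irreducible finite-dimensional representation of $C^*(\mathcal G)$ is, up to unitary equivalence, of the form $\pi_{F,\rho,\mathbf z,\overrightarrow{\gamma}}$ for some finite orbit $F=\{x_1,\dots,x_n\}\subset X$ (with $n=|F|$), some representation $\rho$ of the isotropy group $\mathcal G_{x_1}^{x_1}$ on a finite-dimensional Hilbert space $\mathsf H_1$, and some collections $\mathbf z=(z_i)_{i=1}^n$ of unitaries and $\overrightarrow{\gamma}=(\gamma_1,\dots,\gamma_n)$ of elements of $\mathcal G$, where $\pi_{F,\rho,\mathbf z,\overrightarrow{\gamma}}$ is the representation defined in the context.
   Context: All topological groupoids are assumed locally compact, étale, Hausdorff and second-countable. $C^*(\mathcal G)$ is the full groupoid C*-algebra, the completion of the convolution algebra $C_c(\mathcal G)$. For $x,y\in X=\mathcal G^{(0)}$ let $\mathcal G_x^y=\{\gamma\in\mathcal G: s(\gamma)=x,\ r(\gamma)=y\}$; $\mathcal G_x^x$ is the isotropy subgroup at $x$. Write $x\approx y$ if $\mathcal G_x^y\ne\emptyset$; equivalence classes are called orbits. Construction of $\pi_{F,\rho,\mathbf z,\overrightarrow{\gamma}}$: let $F=\{x_1,\dots,x_n\}\subset X$ be a finite orbit with $n=|F|$. Write $\mathcal G_j^i:=\mathcal G_{x_j}^{x_i}$ for $i,j=1,\dots,n$. Let $\gamma_1$ be the unit element of the group $\mathcal G_1^1$ and, for $i=2,\dots,n$, let $\gamma_i\in\mathcal G_1^i$; set $\overrightarrow{\gamma}=(\gamma_1,\dots,\gamma_n)$.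 Let $\rho:\mathcal G_1^1\to B(\mathsf H_1)$ be a unitary representation on a Hilbert space $\mathsf H_1$. Put $\mathsf H_2=\cdots=\mathsf H_n=\mathsf H_1$ and let $\mathbf z=(z_i)_{i=1}^n$ be unitaries $z_i:\mathsf H_1\to\mathsf H_i$ with $z_1=1_{\mathsf H_1}$. On $\mathcal H=\bigoplus_{i=1}^n\mathsf H_i$ define, for $f\in C_c(\mathcal G)$, the operator with block-matrix entries $$\big(\pi_{F,\rho,\mathbf z,\overrightarrow{\gamma}}(f)\big)_{i,j}=\sum_{g\in\mathcal G_j^i} f(g)\, z_i\,\rho(\gamma_i^{-1}g\gamma_j)\,z_j^*,\qquad i,j=1,\dots,n.$$ This defines a representation of $C^*(\mathcal G)$ on $\mathcal H$. *)

theory Defs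
  imports
    "HOL-Analysis.Analysis"
    "Jordan_Normal_Form.Schur_Decomposition"
begin

text \<open>
  Both HOL-Analysis and Jordan_Normal_Form provide matrices.  Operators between finite-dimensional
  Hilbert spaces are Jordan_Normal_Form matrices throughout, so that dimensions are natural
  numbers; the Hilbert space of dimension \<open>n\<close> is \<open>carrier_vec n\<close> over \<open>complex\<close>.
\<close>

section \<open>Etale groupoids\<close>

text \<open>
  All elements of the type \<open>'g\<close> are arrows, and units are identified with their identity arrows,
  so \<open>src\<close> and \<open>tgt\<close> (the range map \<open>r\<close>) take values in \<open>'g\<close>.
  The product \<open>mul G a b\<close> is meaningful only if \<open>src G a = tgt G b\<close>.
\<close>

record 'g groupoid =
  src :: "'g \<Rightarrow> 'g"
  tgt :: "'g \<Rightarrow> 'g"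
  mul :: "'g \<Rightarrow> 'g \<Rightarrow> 'g"
  ginv :: "'g \<Rightarrow> 'g"

definition units :: "'g groupoid \<Rightarrow> 'g set" where
  "units G = {x. src G x = x \<and> tgt G x = x}"

definition is_groupoid :: "'g groupoid \<Rightarrow> bool" where
  "is_groupoid G \<longleftrightarrow>
     (\<forall>a. src G a \<in> units G \<and> tgt G a \<in> units G) \<and>
     (\<forall>a b. src G a = tgt G b \<longrightarrow> src G (mul G a b) = src G b \<and> tgt G (mul G a b) = tgt G a) \<and>
     (\<forall>a b c. src G a = tgt G b \<and> src G b = tgt G c \<longrightarrow>
        mul G (mul G a b) c = mul G a (mul G b c)) \<and>
     (\<forall>a. mul G (tgt G a) a = a \<and> mul G a (src G a) = a) \<and>
     (\<forall>a. src G (ginv G a) = tgt G a \<and> tgt G (ginv G a) = src G a) \<and>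
     (\<forall>a. mul G a (ginv G a) = tgt G a \<and> mul G (ginv G a) a = src G a)"

text \<open>
  Continuity of \<open>src\<close> and \<open>tgt\<close>, and the fact that \<open>tgt\<close> is a local homeomorphism as
  well, follow from the conditions listed here.
\<close>

definition etale_groupoid :: "'g::{t2_space, second_countable_topology} groupoid \<Rightarrow> bool" where
  "etale_groupoid G \<longleftrightarrow>
     is_groupoid G \<and>
     locally compact (UNIV :: 'g set) \<and>
     continuous_on {(a, b). src G a = tgt G b} (\<lambda>(a, b). mul G a b) \<and>
     continuous_on UNIV (ginv G) \<and>
     (\<forall>a. \<exists>U h. open U \<and> a \<in> U \<and> openin (top_of_set (units G)) (src G ` U) \<and>
                homeomorphism U (src G ` U) (src G) h)"

text \<open>\<open>arrows G x y\<close> is $\mathcal{G}_x^y$.\<close>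

definition arrows :: "'g groupoid \<Rightarrow> 'g \<Rightarrow> 'g \<Rightarrow> 'g set" where
  "arrows G x y = {a. src G a = x \<and> tgt G a = y}"

definition orbits :: "'g groupoid \<Rightarrow> 'g set set" where
  "orbits G = {{y \<in> units G. arrows G x y \<noteq> {}} | x. x \<in> units G}"


section \<open>The convolution algebra\<close>

definition Cc :: "'g::topological_space groupoid \<Rightarrow> ('g \<Rightarrow> complex) set" where
  "Cc G = {f. continuous_on UNIV f \<and> compact (closure {a. f a \<noteq> 0})}"

text \<open>For functions in \<open>Cc G\<close> the sum below has only finitely many nonzero terms.\<close>

definition conv :: "'g groupoid \<Rightarrow> ('g \<Rightarrow> complex) \<Rightarrow> ('g \<Rightarrow> complex) \<Rightarrow> 'g \<Rightarrow> complex" where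
  "conv G f1 f2 = (\<lambda>a. \<Sum>\<^sub>\<infinity>b\<in>{b. tgt G b = tgt G a}. f1 b * f2 (mul G (ginv G b) a))"

definition star :: "'g groupoid \<Rightarrow> ('g \<Rightarrow> complex) \<Rightarrow> 'g \<Rightarrow> complex" where
  "star G f = (\<lambda>a. cnj (f (ginv G a)))"


section \<open>The full groupoid C*-algebra\<close>

definition cstar_seminorm :: "'g::topological_space groupoid \<Rightarrow> (('g \<Rightarrow> complex) \<Rightarrow> real) \<Rightarrow> bool" where
  "cstar_seminorm G p \<longleftrightarrow>
     (\<forall>f\<in>Cc G. 0 \<le> p f) \<and>
     (\<forall>f\<in>Cc G. \<forall>c. p (\<lambda>a. c * f a) = cmod c * p f) \<and>
     (\<forall>f1\<in>Cc G. \<forall>f2\<in>Cc G. p (\<lambda>a. f1 a + f2 a) \<le> p f1 + p f2) \<and>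
     (\<forall>f1\<in>Cc G. \<forall>f2\<in>Cc G. p (conv G f1 f2) \<le> p f1 * p f2) \<and>
     (\<forall>f\<in>Cc G. p (conv G (star G f) f) = (p f)\<^sup>2)"

text \<open>
  The C*-seminorms on \<open>Cc G\<close> are exactly the functions \<open>f \<mapsto> \<parallel>\<pi> f\<parallel>\<close> for *-representations
  \<open>\<pi>\<close> of \<open>Cc G\<close> on Hilbert spaces (of any dimension), by Gelfand--Naimark.  For an etale
  groupoid the supremum is finite, since every C*-seminorm is dominated by the I-norm.
\<close>

definition full_norm :: "'g::topological_space groupoid \<Rightarrow> ('g \<Rightarrow> complex) \<Rightarrow> real" where
  "full_norm G f = (SUP p\<in>{p. cstar_seminorm G p}. p f)"

text \<open>
  The completion of \<open>Cc G\<close> in \<open>full_norm\<close>: its elements are Cauchy sequences modulo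
  sequences tending to \<open>0\<close>, with the algebraic operations induced from \<open>Cc G\<close>.
\<close>

type_synonym 'g cstar_elem = "(nat \<Rightarrow> 'g \<Rightarrow> complex) set"

definition cauchy_seqs :: "'g::topological_space groupoid \<Rightarrow> (nat \<Rightarrow> 'g \<Rightarrow> complex) set" where
  "cauchy_seqs G = {u. (\<forall>m. u m \<in> Cc G) \<and>
     (\<forall>e>0. \<exists>M. \<forall>m\<ge>M. \<forall>k\<ge>M. full_norm G (\<lambda>a. u m a - u k a) < e)}"

definition cauchy_rel ::
    "'g::topological_space groupoid \<Rightarrow> ((nat \<Rightarrow> 'g \<Rightarrow> complex) \<times> (nat \<Rightarrow> 'g \<Rightarrow> complex)) set" where
  "cauchy_rel G = {(u, v). u \<in> cauchy_seqs G \<and> v \<in> cauchy_seqs G \<and>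
     (\<lambda>m. full_norm G (\<lambda>a. u m a - v m a)) \<longlonglongrightarrow> 0}"

definition Cstar :: "'g::topological_space groupoid \<Rightarrow> 'g cstar_elem set" where
  "Cstar G = cauchy_seqs G // cauchy_rel G"

definition cstar_add ::
    "'g::topological_space groupoid \<Rightarrow> 'g cstar_elem \<Rightarrow> 'g cstar_elem \<Rightarrow> 'g cstar_elem" where
  "cstar_add G A B = (\<Union>u\<in>A. \<Union>v\<in>B. cauchy_rel G `` {\<lambda>m a. u m a + v m a})"

definition cstar_scale ::
    "'g::topological_space groupoid \<Rightarrow> complex \<Rightarrow> 'g cstar_elem \<Rightarrow> 'g cstar_elem" where
  "cstar_scale G c A = (\<Union>u\<in>A. cauchy_rel G `` {\<lambda>m a. c * u m a})"

definition cstar_mult ::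
    "'g::topological_space groupoid \<Rightarrow> 'g cstar_elem \<Rightarrow> 'g cstar_elem \<Rightarrow> 'g cstar_elem" where
  "cstar_mult G A B = (\<Union>u\<in>A. \<Union>v\<in>B. cauchy_rel G `` {\<lambda>m. conv G (u m) (v m)})"

definition cstar_star :: "'g::topological_space groupoid \<Rightarrow> 'g cstar_elem \<Rightarrow> 'g cstar_elem" where
  "cstar_star G A = (\<Union>u\<in>A. cauchy_rel G `` {\<lambda>m. star G (u m)})"


section \<open>Finite-dimensional representations\<close>

definition unitary_op :: "nat \<Rightarrow> nat \<Rightarrow> complex mat \<Rightarrow> bool" where
  "unitary_op m n U \<longleftrightarrow> U \<in> carrier_mat n m \<and>
     mat_adjoint U * U = 1\<^sub>m m \<and> U * mat_adjoint U = 1\<^sub>m n"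

definition cstar_rep ::
    "'g::topological_space groupoid \<Rightarrow> nat \<Rightarrow> ('g cstar_elem \<Rightarrow> complex mat) \<Rightarrow> bool" where
  "cstar_rep G N \<pi> \<longleftrightarrow>
     (\<forall>A\<in>Cstar G. \<pi> A \<in> carrier_mat N N) \<and>
     (\<forall>A\<in>Cstar G. \<forall>B\<in>Cstar G. \<pi> (cstar_add G A B) = \<pi> A + \<pi> B) \<and>
     (\<forall>A\<in>Cstar G. \<forall>c. \<pi> (cstar_scale G c A) = c \<cdot>\<^sub>m \<pi> A) \<and>
     (\<forall>A\<in>Cstar G. \<forall>B\<in>Cstar G. \<pi> (cstar_mult G A B) = \<pi> A * \<pi> B) \<and>
     (\<forall>A\<in>Cstar G. \<pi> (cstar_star G A) = mat_adjoint (\<pi> A))"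

text \<open>
  Following the usual convention, the zero representation on a one-dimensional space is not
  irreducible.  Subspaces of \<open>carrier_vec N\<close> are automatically closed.
\<close>

definition irreducible_rep ::
    "'g::topological_space groupoid \<Rightarrow> nat \<Rightarrow> ('g cstar_elem \<Rightarrow> complex mat) \<Rightarrow> bool" where
  "irreducible_rep G N \<pi> \<longleftrightarrow>
     (\<exists>A\<in>Cstar G. \<pi> A \<noteq> 0\<^sub>m N N) \<and>
     (\<forall>W. VectorSpace.subspace class_ring W (module_vec TYPE(complex) N) \<longrightarrow>
          (\<forall>A\<in>Cstar G. \<forall>w\<in>W. \<pi> A *\<^sub>v w \<in> W) \<longrightarrow>
          W = {0\<^sub>v N} \<or> W = carrier_vec N)"

definition unitarily_equivalent ::
    "'g::topological_space groupoid \<Rightarrow> nat \<Rightarrow> ('g cstar_elem \<Rightarrow> complex mat) \<Rightarrow>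
     nat \<Rightarrow> ('g cstar_elem \<Rightarrow> complex mat) \<Rightarrow> bool" where
  "unitarily_equivalent G N \<pi> M \<sigma> \<longleftrightarrow>
     (\<exists>U. unitary_op M N U \<and> (\<forall>A\<in>Cstar G. \<pi> A = U * \<sigma> A * mat_adjoint U))"


section \<open>Representations attached to finite orbits\<close>

definition isotropy_rep :: "'g groupoid \<Rightarrow> 'g \<Rightarrow> nat \<Rightarrow> ('g \<Rightarrow> complex mat) \<Rightarrow> bool" where
  "isotropy_rep G x d \<rho> \<longleftrightarrow>
     (\<forall>a\<in>arrows G x x. unitary_op d d (\<rho> a)) \<and>
     (\<forall>a\<in>arrows G x x. \<forall>b\<in>arrows G x x. \<rho> (mul G a b) = \<rho> a * \<rho> b)"

text \<open>
  Indices run through \<open>0, \<dots>, n - 1\<close> rather than \<open>1, \<dots>, n\<close>; thus \<open>x 0\<close>, \<open>z 0\<close> and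
  \<open>\<gamma> 0\<close> are the distinguished base point, $z_1$ and $\gamma_1$.
\<close>

definition orbit_data ::
    "'g groupoid \<Rightarrow> 'g set \<Rightarrow> nat \<Rightarrow> (nat \<Rightarrow> 'g) \<Rightarrow> nat \<Rightarrow> ('g \<Rightarrow> complex mat) \<Rightarrow>
     (nat \<Rightarrow> complex mat) \<Rightarrow> (nat \<Rightarrow> 'g) \<Rightarrow> bool" where
  "orbit_data G F n x d \<rho> z \<gamma> \<longleftrightarrow>
     F \<in> orbits G \<and> finite F \<and> card F = n \<and> bij_betw x {..<n} F \<and>
     isotropy_rep G (x 0) d \<rho> \<and>
     (\<forall>i<n. unitary_op d d (z i)) \<and> z 0 = 1\<^sub>m d \<and>
     (\<forall>i<n. \<gamma> i \<in> arrows G (x 0) (x i)) \<and> \<gamma> 0 = x 0"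

text \<open>
  The block matrix with \<open>n \<times> n\<close> blocks of size \<open>d \<times> d\<close>: the entry in row \<open>i * d + k\<close> and
  column \<open>j * d + l\<close> is the \<open>(k, l)\<close> entry of block \<open>(i, j)\<close>.  For \<open>f\<close> in \<open>Cc G\<close> only
  finitely many terms of the sum are nonzero.
\<close>

definition orbit_rep_Cc ::
    "'g groupoid \<Rightarrow> nat \<Rightarrow> (nat \<Rightarrow> 'g) \<Rightarrow> nat \<Rightarrow> ('g \<Rightarrow> complex mat) \<Rightarrow>
     (nat \<Rightarrow> complex mat) \<Rightarrow> (nat \<Rightarrow> 'g) \<Rightarrow> ('g \<Rightarrow> complex) \<Rightarrow> complex mat" where
  "orbit_rep_Cc G n x d \<rho> z \<gamma> f =
     Matrix.mat (n * d) (n * d) (\<lambda>(p, q).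
       let i = p div d; k = p mod d; j = q div d; l = q mod d in
       \<Sum>\<^sub>\<infinity>g\<in>arrows G (x j) (x i).
         f g * (z i * \<rho> (mul G (mul G (ginv G (\<gamma> i)) g) (\<gamma> j)) * mat_adjoint (z j)) $$ (k, l))"

text \<open>
  The extension of a map on \<open>Cc G\<close> to the completion by continuity: \<open>extend_rep N \<phi> A\<close> is the
  entrywise limit of \<open>\<phi> (u m)\<close> along any Cauchy sequence \<open>u\<close> representing \<open>A\<close>.
\<close>

definition extend_rep ::
    "nat \<Rightarrow> (('g \<Rightarrow> complex) \<Rightarrow> complex mat) \<Rightarrow> 'g cstar_elem \<Rightarrow> complex mat" where
  "extend_rep N \<phi> A = Matrix.mat N N (\<lambda>(p, q).
     THE c. \<forall>u\<in>A. (\<lambda>m. \<phi> (u m) $$ (p, q)) \<longlonglongrightarrow> c)"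

definition orbit_rep ::
    "'g groupoid \<Rightarrow> nat \<Rightarrow> (nat \<Rightarrow> 'g) \<Rightarrow> nat \<Rightarrow> ('g \<Rightarrow> complex mat) \<Rightarrow>
     (nat \<Rightarrow> complex mat) \<Rightarrow> (nat \<Rightarrow> 'g) \<Rightarrow> 'g cstar_elem \<Rightarrow> complex mat" where
  "orbit_rep G n x d \<rho> z \<gamma> = extend_rep (n * d) (orbit_rep_Cc G n x d \<rho> z \<gamma>)"

end

theory Submission
  imports Defs "Jordan_Normal_Form.Spectral_Radius"
begin

text \<open>
  Let \<open>\<pi>\<close> be an irreducible representation on \<open>\<complex>^N\<close>. Restricted to the compactly supported
  functions on the unit space it is a commuting family of normal operators, so there is a common
  eigenvector, and its character is evaluation at a unit \<open>x0\<close> (\<open>point_exists\<close>). For each unit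
  \<open>x\<close> let \<open>fibre x\<close> be the space of joint eigenvectors with character evaluation at \<open>x\<close>; fibres
  over different units are orthogonal. For a vector \<open>v\<close> in \<open>fibre x\<close> the vector \<open>\<pi> f v\<close> depends
  only on the values of \<open>f\<close> on the arrows with source \<open>x\<close> (\<open>act_vanish\<close>): after cutting \<open>f\<close> into
  pieces supported in bisections, the square of the norm of \<open>\<pi> f v\<close> is governed by \<open>f* f\<close>, which is a
  function on the unit space. Hence every arrow \<open>g\<close> acts as a unitary from the fibre over its
  source to the fibre over its range, and \<open>\<pi> f\<close> is the sum of \<open>f g\<close> times these unitaries
  (\<open>act_formula\<close>).

  The fibres over the orbit of \<open>x0\<close> are nonzero, mutually orthogonal and of the same dimension,
  so the orbit has at most \<open>N\<close> points. Choosing one arrow from \<open>x0\<close> to each point of the orbit and an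
  orthonormal basis of \<open>fibre x0\<close> gives an isometry \<open>U\<close> that intertwines \<open>\<pi>\<close> with the
  orbit representation built from the action of the isotropy group on \<open>fibre x0\<close>
  (\<open>intertwining_isometry\<close>). Its range is invariant, so \<open>U\<close> is unitary by irreducibility.

  Two analytic facts connect \<open>\<pi>\<close>, which is given on the completion, with its values on
  \<open>Cc G\<close>. First, the full norm is finite: a C*-seminorm is at most the sup norm on functions
  supported in a bisection. For functions on the unit space this follows from the C*-identity
  alone, since a real function bounded by \<open>e\<close> is an average of two functions with modulus
  \<open>e\<close> (\<open>seminorm_mono\<close>). Second, \<open>\<pi>\<close> is continuous (\<open>pi_entry_le\<close>): by the Neumann series in the
  completion, an eigenvalue of the image of an element is less than one in modulus if the element has
  norm less than one, and this applies to \<open>b* b\<close>.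
\<close>

section \<open>Etale groupoids and their bisections\<close>

text \<open>
  A locally compact Hausdorff space is completely regular, so a point can be separated from the
  complement of a relatively compact neighbourhood.
\<close>

lemma bump_function:
  fixes g :: "'g::t2_space"
  assumes loc_compact: "locally compact (UNIV :: 'g set)" and U: "open U" "g \<in> U"
  obtains \<phi> :: "'g \<Rightarrow> real" where "continuous_on UNIV \<phi>" "\<And>a. 0 \<le> \<phi> a" "\<phi> g = 1"
    "compact (closure {a. \<phi> a \<noteq> 0})" "closure {a. \<phi> a \<noteq> 0} \<subseteq> U"
proof -
  obtain W K where W: "open W" "compact K" "g \<in> W" "W \<subseteq> K" "K \<subseteq> U"
    using loc_compact U unfolding locally_def by (metis UNIV_I openin_subtopology_self open_openin subtopology_UNIV top_greatest)
  have "locally_compact_space (euclidean :: 'g topology)"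
    unfolding locally_compact_space_def
    by (metis UNIV_I compactin_euclidean_iff loc_compact locally_def open_UNIV open_openin subtopology_UNIV topspace_euclidean)
  moreover have "Hausdorff_space (euclidean :: 'g topology)"
    unfolding Hausdorff_space_def using hausdorff by (auto simp: disjnt_def)
  ultimately have "completely_regular_space (euclidean :: 'g topology)"
    by (simp add: locally_compact_regular_imp_completely_regular_space)
  then obtain f :: "'g \<Rightarrow> real" where f: "continuous_map euclidean (top_of_set {0..1}) f" "f g = 0" "f ` (- W) \<subseteq> {1}"
    unfolding completely_regular_space_def using W by (metis Compl_iff UNIV_I closed_Compl closed_closedin topspace_euclidean Diff_iff)
  define \<phi> where "\<phi> a = 1 - f a" for a
  have fc: "continuous_on UNIV f" "\<And>a. f a \<in> {0..1}"
    using f(1) by (auto simp: continuous_map_in_subtopology)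
  have sub: "{a. \<phi> a \<noteq> 0} \<subseteq> W" using f(3) by (auto simp: \<phi>_def)
  have cclass: "closure {a. \<phi> a \<noteq> 0} \<subseteq> K"
    using sub W by (meson closure_minimal compact_imp_closed order_trans)
  show ?thesis
  proof (rule that[of \<phi>])
    show "continuous_on UNIV \<phi>" unfolding \<phi>_def using fc by (intro continuous_intros)
    show "0 \<le> \<phi> a" for a using fc(2)[of a] by (auto simp: \<phi>_def)
    show "\<phi> g = 1" using f(2) by (simp add: \<phi>_def)
    show "compact (closure {a. \<phi> a \<noteq> 0})"
      using cclass W(2) by (metis closed_closure compact_Int_closed inf.absorb_iff2)
    show "closure {a. \<phi> a \<noteq> 0} \<subseteq> U" using cclass W by blast
  qed
qed

locale etale_gpd =
  fixes G :: "'g::{t2_space, second_countable_topology} groupoid"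
  assumes etale: "etale_groupoid G"
begin

lemma groupoid: "is_groupoid G" and loc_compact: "locally compact (UNIV :: 'g set)"
  and mul_cont: "continuous_on {(a, b). src G a = tgt G b} (\<lambda>(a, b). mul G a b)"
  and ginv_cont: "continuous_on UNIV (ginv G)"
  using etale unfolding etale_groupoid_def by auto

lemma src_unit [simp]: "src G a \<in> units G" and tgt_unit [simp]: "tgt G a \<in> units G"
  using groupoid unfolding is_groupoid_def by auto

lemma unitsD [simp]: "x \<in> units G \<Longrightarrow> src G x = x" "x \<in> units G \<Longrightarrow> tgt G x = x"
  by (auto simp: units_def)

lemma src_src [simp]: "src G (src G a) = src G a" "tgt G (src G a) = src G a"
  "src G (tgt G a) = tgt G a" "tgt G (tgt G a) = tgt G a"
  using src_unit[of a] tgt_unit[of a] unfolding units_def by auto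

lemma src_mul [simp]: "src G a = tgt G b \<Longrightarrow> src G (mul G a b) = src G b"
  and tgt_mul [simp]: "src G a = tgt G b \<Longrightarrow> tgt G (mul G a b) = tgt G a"
  using groupoid unfolding is_groupoid_def by auto

lemma mul_assoc: "src G a = tgt G b \<Longrightarrow> src G b = tgt G c \<Longrightarrow>
    mul G (mul G a b) c = mul G a (mul G b c)"
  using groupoid unfolding is_groupoid_def by auto

lemma mul_unit [simp]: "mul G (tgt G a) a = a" "mul G a (src G a) = a"
  using groupoid unfolding is_groupoid_def by auto

lemma src_ginv [simp]: "src G (ginv G a) = tgt G a" "tgt G (ginv G a) = src G a"
  using groupoid unfolding is_groupoid_def by auto

lemma mul_ginv [simp]: "mul G a (ginv G a) = tgt G a" "mul G (ginv G a) a = src G a"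
  using groupoid unfolding is_groupoid_def by auto

lemma mul_ginv_cancel [simp]:
  "tgt G a = tgt G b \<Longrightarrow> mul G a (mul G (ginv G a) b) = b"
  "src G a = tgt G b \<Longrightarrow> mul G (ginv G a) (mul G a b) = b"
  "src G a = tgt G b \<Longrightarrow> mul G (mul G a b) (ginv G b) = a"
  "src G a = src G b \<Longrightarrow> mul G (mul G a (ginv G b)) b = a"
proof -
  show "tgt G a = tgt G b \<Longrightarrow> mul G a (mul G (ginv G a) b) = b"
    using mul_assoc[of a "ginv G a" b] by simp
  show "src G a = tgt G b \<Longrightarrow> mul G (ginv G a) (mul G a b) = b"
    using mul_assoc[of "ginv G a" a b] by simp
  show "src G a = tgt G b \<Longrightarrow> mul G (mul G a b) (ginv G b) = a"
    using mul_assoc[of a b "ginv G b"] mul_unit(2)[of a] by simp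
  show "src G a = src G b \<Longrightarrow> mul G (mul G a (ginv G b)) b = a"
    using mul_assoc[of a "ginv G b" b] mul_unit(2)[of a] by simp
qed

lemma ginv_unique: "src G a = tgt G b \<Longrightarrow> mul G a b = tgt G a \<Longrightarrow> ginv G a = b"
  by (metis mul_ginv_cancel(2) mul_unit(2) src_ginv(1))

lemma ginv_ginv [simp]: "ginv G (ginv G a) = a"
  by (rule ginv_unique) simp_all

lemma ginv_of_unit [simp]: "x \<in> units G \<Longrightarrow> ginv G x = x"
  using ginv_unique[of x x] mul_unit(1)[of x] by simp

lemma mul_of_unit [simp]: "x \<in> units G \<Longrightarrow> x = tgt G a \<Longrightarrow> mul G x a = a"
  "x \<in> units G \<Longrightarrow> src G a = x \<Longrightarrow> mul G a x = a"
  by auto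

text \<open>
  The local homeomorphism of the definition, with its inverse written as \<open>inv_into\<close>
  so that no name for it has to be carried along.
\<close>

lemma src_bisection:
  obtains U where "open U" "a \<in> U" "inj_on (src G) U" "continuous_on U (src G)"
    "continuous_on (src G ` U) (inv_into U (src G))" "openin (top_of_set (units G)) (src G ` U)"
proof -
  obtain U h where U: "open U" "a \<in> U" "openin (top_of_set (units G)) (src G ` U)"
    "homeomorphism U (src G ` U) (src G) h"
    using etale unfolding etale_groupoid_def by metis
  have i: "inj_on (src G) U" by (rule inj_on_inverseI) (rule homeomorphism_apply1[OF U(4)])
  have "continuous_on (src G ` U) h" using U(4) by (simp add: homeomorphism_def)
  moreover have "h x = inv_into U (src G) x" if "x \<in> src G ` U" for x
  proof -
    obtain u where u: "u \<in> U" "x = src G u" using \<open>x \<in> src G ` U\<close> by blast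
    have "h x = u" unfolding u(2) by (rule homeomorphism_apply1[OF U(4) u(1)])
    then show ?thesis unfolding u(2) inv_into_f_f[OF i u(1)] .
  qed
  ultimately have "continuous_on (src G ` U) (inv_into U (src G))"
    by (rule continuous_on_eq)
  then show ?thesis using that[OF U(1,2) i _ _ U(3)] U(4) by (simp add: homeomorphism_def)
qed

lemma src_cont: "continuous_on UNIV (src G)"
proof -
  have "isCont (src G) a" for a
  proof -
    obtain U where "open U" "a \<in> U" "continuous_on U (src G)" using src_bisection[of a] by metis
    then show ?thesis using continuous_on_eq_continuous_at by blast
  qed
  then show ?thesis by (simp add: continuous_at_imp_continuous_on)
qed

lemma tgt_cont: "continuous_on UNIV (tgt G)"
proof -
  have "continuous_on UNIV (\<lambda>a. src G (ginv G a))"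
    by (rule continuous_on_compose2[OF src_cont ginv_cont subset_UNIV])
  then show ?thesis by (simp only: src_ginv)
qed

lemma units_eq: "units G = {a. src G a = a}"
proof (rule Set.set_eqI, rule iffI)
  fix a assume "a \<in> {a. src G a = a}"
  then have "src G a = a" by (rule CollectD)
  then show "a \<in> units G" using src_unit[of a] by argo
next
  fix a assume "a \<in> units G"
  then show "a \<in> {a. src G a = a}" unfolding units_def by blast
qed

lemma closed_units: "closed (units G)"
  unfolding units_eq by (intro closed_Collect_eq src_cont continuous_on_id)

text \<open>
  This is where etaleness enters: near a unit \<open>x\<close> the arrow \<open>a\<close> and its
  source both lie in a set on which \<open>src\<close> is injective, and they have the same
  source.
\<close>

lemma open_units: "open (units G)"
proof (subst open_subopen, intro ballI)
  fix x assume x: "x \<in> units G"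
  obtain U where U: "open U" "x \<in> U" "inj_on (src G) U" using src_bisection[of x] by metis
  have "open (src G -` U)" using U(1) src_cont by (simp add: open_vimage)
  moreover have "U \<inter> src G -` U \<subseteq> units G"
  proof
    fix g assume "g \<in> U \<inter> src G -` U"
    then have g: "g \<in> U" "src G g \<in> U" by blast+
    have e: "src G g = g" by (rule inj_onD[OF U(3) src_src(1) g(2,1)])
    show "g \<in> units G" by (rule src_unit[of g, unfolded e])
  qed
  ultimately show "\<exists>T. open T \<and> x \<in> T \<and> T \<subseteq> units G"
    using U x by (intro exI[of _ "U \<inter> src G -` U"]) auto
qed

text \<open>
  Besides injectivity of \<open>src\<close> and \<open>tgt\<close>, continuity of the inverse of
  \<open>tgt\<close> is recorded, since the convolution is computed by looking up the unique arrow
  with a given range.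
\<close>

definition bisection :: "'g set \<Rightarrow> bool" where
  "bisection U \<longleftrightarrow> open U \<and> inj_on (src G) U \<and> inj_on (tgt G) U \<and>
     open (tgt G ` U) \<and> continuous_on (tgt G ` U) (inv_into U (tgt G))"

lemma bisection_at:
  obtains U where "bisection U" "a \<in> U"
proof -
  obtain U where U: "open U" "a \<in> U" "inj_on (src G) U" using src_bisection[of a] by metis
  obtain V where V: "open V" "ginv G a \<in> V" "inj_on (src G) V"
    "continuous_on (src G ` V) (inv_into V (src G))" "openin (top_of_set (units G)) (src G ` V)"
    using src_bisection[of "ginv G a"] by metis
  have oV: "open (src G ` V)" using V(5) open_units openin_open_eq by blast
  define W where "W = U \<inter> ginv G -` V"
  have oW: "open W" unfolding W_def using U V ginv_cont by (simp add: open_vimage open_Int)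
  have inj: "inj_on (tgt G) W"
  proof (rule inj_onI)
    fix w w' assume "w \<in> W" "w' \<in> W" "tgt G w = tgt G w'"
    then have "ginv G w = ginv G w'" using inj_onD[OF V(3), of "ginv G w" "ginv G w'"] by (simp add: W_def)
    then show "w = w'" by (metis ginv_ginv)
  qed
  have inv: "inv_into W (tgt G) y = ginv G (inv_into V (src G) y)" if "y \<in> tgt G ` W" for y
  proof -
    obtain w where w: "w \<in> W" "y = tgt G w" using \<open>y \<in> tgt G ` W\<close> by blast
    have "inv_into V (src G) y = ginv G w"
      using w V(3) by (intro inv_into_f_eq) (auto simp: W_def)
    moreover have "inv_into W (tgt G) y = w" using w inj by simp
    ultimately show ?thesis by simp
  qed
  have sub: "tgt G ` W \<subseteq> src G ` V"
  proof
    fix y assume "y \<in> tgt G ` W"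
    then obtain w where "w \<in> W" "y = tgt G w" by blast
    then have "ginv G w \<in> V" "y = src G (ginv G w)" by (auto simp: W_def)
    then show "y \<in> src G ` V" by blast
  qed
  have eq: "tgt G ` W = src G ` V \<inter> inv_into V (src G) -` (ginv G -` U)"
  proof
    show "tgt G ` W \<subseteq> src G ` V \<inter> inv_into V (src G) -` (ginv G -` U)"
    proof
      fix y assume y: "y \<in> tgt G ` W"
      then obtain w where w: "w \<in> W" "y = tgt G w" by blast
      have "inv_into W (tgt G) y = w" using w inj by simp
      then have "ginv G (inv_into V (src G) y) = w" using inv[OF y] by simp
      then show "y \<in> src G ` V \<inter> inv_into V (src G) -` (ginv G -` U)"
        using sub y w by (auto simp: W_def)
    qed
    show "src G ` V \<inter> inv_into V (src G) -` (ginv G -` U) \<subseteq> tgt G ` W"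
    proof
      fix y assume "y \<in> src G ` V \<inter> inv_into V (src G) -` (ginv G -` U)"
      then obtain v where v: "v \<in> V" "y = src G v" "ginv G v \<in> U" using V(3) by auto
      then have "ginv G v \<in> W" "tgt G (ginv G v) = y" by (auto simp: W_def)
      then show "y \<in> tgt G ` W" by blast
    qed
  qed
  have "open (ginv G -` U)" using U ginv_cont by (simp add: open_vimage)
  then have oW2: "open (tgt G ` W)"
    unfolding eq by (rule continuous_open_preimage[OF V(4) oV])
  have "continuous_on (tgt G ` W) (\<lambda>y. ginv G (inv_into V (src G) y))"
    by (rule continuous_on_compose2[OF ginv_cont continuous_on_subset[OF V(4) sub]]) (rule subset_UNIV)
  then have "continuous_on (tgt G ` W) (inv_into W (tgt G))"
    by (rule continuous_on_eq) (simp add: inv[symmetric])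
  moreover have "inj_on (src G) W" using U(3) by (rule inj_on_subset) (simp add: W_def)
  ultimately have "bisection W" unfolding bisection_def using oW oW2 inj by blast
  moreover have "a \<in> W" using U V by (simp add: W_def)
  ultimately show ?thesis using that by blast
qed

end

section \<open>The convolution algebra\<close>

lemma CcI:
  fixes f :: "'g::t2_space \<Rightarrow> complex"
  assumes "continuous_on UNIV f" "compact K" "\<And>a. f a \<noteq> 0 \<Longrightarrow> a \<in> K"
  shows "f \<in> Cc G"
proof -
  have "closure {a. f a \<noteq> 0} \<subseteq> K"
    using assms compact_imp_closed by (intro closure_minimal) auto
  then have "compact (closure {a. f a \<noteq> 0})"
    using assms(2) by (metis closed_closure compact_Int_closed inf.absorb_iff2)
  then show ?thesis using assms by (simp add: Cc_def)
qed

lemma CcD: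
  assumes "f \<in> Cc G"
  shows "continuous_on UNIV f" "compact (closure {a. f a \<noteq> 0})"
    "f a \<noteq> 0 \<Longrightarrow> a \<in> closure {a. f a \<noteq> 0}"
  using assms subsetD[OF closure_subset, of a "{a. f a \<noteq> 0}"] unfolding Cc_def by auto

lemma Cc_bounded:
  assumes "f \<in> Cc G"
  obtains B where "B \<ge> 0" "\<And>a. cmod (f a) \<le> B"
proof -
  note c = CcD[OF assms]
  have "compact (f ` closure {a. f a \<noteq> 0})"
    using c by (intro compact_continuous_image) (auto intro: continuous_on_subset)
  then obtain B where B: "\<forall>z \<in> f ` closure {a. f a \<noteq> 0}. cmod z \<le> B"
    using compact_imp_bounded bounded_iff by metis
  have "cmod (f a) \<le> max B 0" for a
    using B c(3)[of a] by (cases "f a = 0") (auto simp: le_max_iff_disj)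
  then show ?thesis using that[of "max B 0"] by auto
qed

lemma Cc_zero: "(\<lambda>a. 0) \<in> Cc G"
  by (simp add: Cc_def)

lemma Cc_add:
  fixes f g :: "'g::t2_space \<Rightarrow> complex"
  assumes "f \<in> Cc G" "g \<in> Cc G"
  shows "(\<lambda>a. f a + g a) \<in> Cc G"
proof (rule CcI)
  show "continuous_on UNIV (\<lambda>a. f a + g a)" using assms CcD(1) by (intro continuous_on_add) auto
  show "compact (closure {a. f a \<noteq> 0} \<union> closure {a. g a \<noteq> 0})"
    using assms CcD(2) by (intro compact_Un) auto
  show "a \<in> closure {a. f a \<noteq> 0} \<union> closure {a. g a \<noteq> 0}" if "f a + g a \<noteq> 0" for a
    using that CcD(3)[OF assms(1), of a] CcD(3)[OF assms(2), of a] by (cases "f a = 0") auto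
qed

lemma Cc_cmult:
  fixes f :: "'g::t2_space \<Rightarrow> complex"
  assumes "f \<in> Cc G" "continuous_on UNIV h"
  shows "(\<lambda>a. h a * f a) \<in> Cc G"
proof (rule CcI)
  show "continuous_on UNIV (\<lambda>a. h a * f a)" using assms CcD(1) by (intro continuous_on_mult) auto
  show "compact (closure {a. f a \<noteq> 0})" using assms CcD(2) by auto
  show "a \<in> closure {a. f a \<noteq> 0}" if "h a * f a \<noteq> 0" for a
    using that CcD(3)[OF assms(1), of a] by auto
qed

lemma Cc_scale:
  fixes f :: "'g::t2_space \<Rightarrow> complex"
  assumes "f \<in> Cc G"
  shows "(\<lambda>a. c * f a) \<in> Cc G"
  by (rule Cc_cmult[OF assms]) (rule continuous_on_const)

lemma Cc_diff:
  fixes f g :: "'g::t2_space \<Rightarrow> complex"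
  assumes "f \<in> Cc G" "g \<in> Cc G"
  shows "(\<lambda>a. f a - g a) \<in> Cc G"
  using Cc_add[OF assms(1) Cc_scale[OF assms(2), of "-1"]] by simp

lemma Cc_sum:
  fixes F :: "'i \<Rightarrow> 'g::t2_space \<Rightarrow> complex"
  assumes "\<And>i. i \<in> I \<Longrightarrow> F i \<in> Cc G"
  shows "(\<lambda>a. \<Sum>i\<in>I. F i a) \<in> Cc G"
  using assms by (induction I rule: infinite_finite_induct) (auto intro: Cc_zero Cc_add)

text \<open>
  A partition of unity on the support of \<open>f\<close>. Dividing by the sum of the bump
  functions is harmless: it is positive on the support of \<open>f\<close>, and the quotient
  vanishes off that support.
\<close>

lemma Cc_decompose:
  fixes f :: "'g::t2_space \<Rightarrow> complex"
  assumes loc_compact: "locally compact (UNIV :: 'g set)" and f: "f \<in> Cc G"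
    and cover: "\<And>a. \<exists>U. open U \<and> a \<in> U \<and> P U"
  obtains I :: "'g set" and F where "finite I" "\<And>a. f a = (\<Sum>i\<in>I. F i a)"
    "\<And>i. i \<in> I \<Longrightarrow> F i \<in> Cc G" "\<And>i a. i \<in> I \<Longrightarrow> f a = 0 \<Longrightarrow> F i a = 0"
    "\<And>i. i \<in> I \<Longrightarrow> \<exists>U. P U \<and> closure {a. F i a \<noteq> 0} \<subseteq> U"
proof -
  have "\<exists>\<phi> :: 'g \<Rightarrow> real. continuous_on UNIV \<phi> \<and> (\<forall>b. 0 \<le> \<phi> b) \<and> \<phi> a = 1 \<and>
      (\<exists>U. P U \<and> closure {b. \<phi> b \<noteq> 0} \<subseteq> U)" for a
  proof -
    obtain U where U: "open U" "a \<in> U" "P U" using cover by blast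
    from bump_function[OF loc_compact U(1,2)] show ?thesis using U(3) by metis
  qed
  then obtain \<phi> :: "'g \<Rightarrow> 'g \<Rightarrow> real" where \<phi>: "\<And>a. continuous_on UNIV (\<phi> a)" "\<And>a b. 0 \<le> \<phi> a b" "\<And>a. \<phi> a a = 1"
    "\<And>a. \<exists>U. P U \<and> closure {b. \<phi> a b \<noteq> 0} \<subseteq> U" by metis
  let ?K = "closure {a. f a \<noteq> 0}"
  have op: "open {b. \<phi> a b > 0}" for a
    using \<phi>(1) by (intro open_Collect_less continuous_on_const)
  have "?K \<subseteq> (\<Union>a\<in>?K. {b. \<phi> a b > 0})"
  proof
    fix a assume "a \<in> ?K"
    moreover have "a \<in> {b. \<phi> a b > 0}" by (simp add: \<phi>(3))
    ultimately show "a \<in> (\<Union>a\<in>?K. {b. \<phi> a b > 0})" by (rule UN_I)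
  qed
  then obtain I where I: "I \<subseteq> ?K" "finite I" "?K \<subseteq> (\<Union>a\<in>I. {b. \<phi> a b > 0})"
    using compactE_image[OF CcD(2)[OF f], of ?K "\<lambda>a. {b. \<phi> a b > 0}"] op by metis
  define S where "S b = (\<Sum>a\<in>I. \<phi> a b)" for b
  have Sc: "continuous_on UNIV S" unfolding S_def using \<phi>(1) by (intro continuous_on_sum) auto
  have Spos: "S b > 0" if "b \<in> ?K" for b
  proof -
    obtain a where "a \<in> I" "\<phi> a b > 0" using I(3) \<open>b \<in> ?K\<close> by blast
    then show ?thesis unfolding S_def using I(2) \<phi>(2) by (intro sum_pos2) auto
  qed
  define F where "F i a = of_real (\<phi> i a / S a) * f a" for i a
  have Fc: "continuous_on UNIV (F i)" for i
  proof -
    have "continuous_on {b. S b > 0} (F i)" unfolding F_def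
      using Sc \<phi>(1)[of i] CcD(1)[OF f]
      by (intro continuous_on_mult continuous_on_of_real continuous_on_divide) (auto intro: continuous_on_subset)
    moreover have "continuous_on (- ?K) (F i)"
    proof (rule continuous_on_eq)
      show "continuous_on (- ?K) (\<lambda>a. 0 :: complex)" by simp
      show "0 = F i a" if "a \<in> - ?K" for a
      proof -
        have "f a = 0" using that closure_subset[of "{a. f a \<noteq> 0}"] by blast
        then show ?thesis by (simp add: F_def)
      qed
    qed
    moreover have "open {b. S b > 0}" using Sc by (intro open_Collect_less continuous_on_const)
    ultimately have "continuous_on ({b. S b > 0} \<union> - ?K) (F i)"
      by (intro continuous_on_open_Un) auto
    moreover have "{b. S b > 0} \<union> - ?K = UNIV" using Spos by blast
    ultimately show ?thesis by simp
  qed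
  show ?thesis
  proof (rule that[of I F])
    show "finite I" by fact
    show "f a = (\<Sum>i\<in>I. F i a)" for a
    proof (cases "f a = 0")
      case False
      then have "S a > 0" using Spos CcD(3)[OF f] by blast
      have "(\<Sum>i\<in>I. F i a) = of_real (\<Sum>i\<in>I. \<phi> i a / S a) * f a"
        by (simp add: F_def sum_distrib_right)
      also have "(\<Sum>i\<in>I. \<phi> i a / S a) = 1"
        unfolding sum_divide_distrib[symmetric] S_def[symmetric] using \<open>S a > 0\<close> by simp
      finally show ?thesis by simp
    qed (simp add: F_def)
    show "F i \<in> Cc G" for i
      using Fc CcD(2)[OF f] CcD(3)[OF f] by (rule CcI) (auto simp: F_def)
    show "f a = 0 \<Longrightarrow> F i a = 0" for i a by (simp add: F_def)
    show "\<exists>U. P U \<and> closure {a. F i a \<noteq> 0} \<subseteq> U" for i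
    proof -
      have "{a. F i a \<noteq> 0} \<subseteq> {a. \<phi> i a \<noteq> 0}" by (auto simp: F_def)
      then show ?thesis using \<phi>(4)[of i] closure_mono by (metis (no_types, lifting) order_trans)
    qed
  qed
qed

context etale_gpd
begin

definition Cc_bisection :: "('g \<Rightarrow> complex) set" where
  "Cc_bisection = {f \<in> Cc G. \<exists>U. bisection U \<and> closure {a. f a \<noteq> 0} \<subseteq> U}"

lemma Cc_bisection_Cc: "f \<in> Cc_bisection \<Longrightarrow> f \<in> Cc G" by (simp add: Cc_bisection_def)

lemma Cc_bisection_supp:
  assumes "f \<in> Cc_bisection"
  obtains U where "bisection U" "closure {a. f a \<noteq> 0} \<subseteq> U" "\<And>a. f a \<noteq> 0 \<Longrightarrow> a \<in> U"
proof -
  obtain U where U: "bisection U" "closure {a. f a \<noteq> 0} \<subseteq> U" using assms unfolding Cc_bisection_def by blast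
  have "a \<in> U" if "f a \<noteq> 0" for a
    using subsetD[OF closure_subset, of a "{a. f a \<noteq> 0}"] U(2) that by blast
  then show ?thesis by (rule that[OF U])
qed

text \<open>
  Sums of functions supported in bisections exhaust \<open>Cc G\<close>. The pieces vanish
  wherever \<open>f\<close> does, which is what makes the kernel computation on a fibre possible
  later.
\<close>

lemma bisection_decompose:
  assumes "f \<in> Cc G"
  obtains I :: "'g set" and F where "finite I" "f = (\<lambda>a. \<Sum>i\<in>I. F i a)" "\<And>i. i \<in> I \<Longrightarrow> F i \<in> Cc_bisection"
    "\<And>i a. i \<in> I \<Longrightarrow> f a = 0 \<Longrightarrow> F i a = 0"
proof -
  have "\<exists>U. open U \<and> a \<in> U \<and> bisection U" for a
  proof -
    obtain U where "bisection U" "a \<in> U" by (rule bisection_at)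
    then show ?thesis unfolding bisection_def by blast
  qed
  from Cc_decompose[OF loc_compact assms, of bisection, OF this]
  obtain I :: "'g set" and F where F: "finite I" "\<And>a. f a = (\<Sum>i\<in>I. F i a)"
    "\<And>i. i \<in> I \<Longrightarrow> F i \<in> Cc G" "\<And>i a. i \<in> I \<Longrightarrow> f a = 0 \<Longrightarrow> F i a = 0"
    "\<And>i. i \<in> I \<Longrightarrow> \<exists>U. bisection U \<and> closure {a. F i a \<noteq> 0} \<subseteq> U" by blast
  have 1: "F i \<in> Cc_bisection" if "i \<in> I" for i unfolding Cc_bisection_def using F(3)[OF that] F(5)[OF that] by blast
  have 2: "f = (\<lambda>a. \<Sum>i\<in>I. F i a)" using F(2) by (rule ext)
  show ?thesis by (rule that[OF F(1) 2 1 F(4)])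
qed

text \<open>
  A bisection meets each range or source fibre in at most one arrow.
\<close>

lemma finite_fibre:
  assumes "f \<in> Cc G"
  shows "finite {b. tgt G b = y \<and> f b \<noteq> 0}" "finite {b. src G b = y \<and> f b \<noteq> 0}"
proof -
  obtain I :: "'g set" and F where F: "finite I" "f = (\<lambda>a. \<Sum>i\<in>I. F i a)" "\<And>i. i \<in> I \<Longrightarrow> F i \<in> Cc_bisection"
    using bisection_decompose[OF assms] by metis
  have inc: "{b. p b = y \<and> f b \<noteq> 0} \<subseteq> (\<Union>i\<in>I. {b. p b = y \<and> F i b \<noteq> 0})" for p :: "'g \<Rightarrow> 'g"
  proof
    fix b assume b: "b \<in> {b. p b = y \<and> f b \<noteq> 0}"
    then have "f b \<noteq> 0" by blast
    then have "(\<Sum>i\<in>I. F i b) \<noteq> 0" by (simp only: F(2) simp_thms)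
    then obtain i where "i \<in> I" "F i b \<noteq> 0" by (rule sum.not_neutral_contains_not_neutral)
    then show "b \<in> (\<Union>i\<in>I. {b. p b = y \<and> F i b \<noteq> 0})" using b by blast
  qed
  have one: "finite {b. p b = y \<and> F i b \<noteq> 0}" if i: "i \<in> I" and p: "p = tgt G \<or> p = src G" for i p
  proof -
    obtain U where U: "bisection U" "\<And>a. F i a \<noteq> 0 \<Longrightarrow> a \<in> U"
      by (rule Cc_bisection_supp[OF F(3)[OF i]]) blast
    then have "inj_on p U" using p unfolding bisection_def by blast
    then have "finite (p -` {y} \<inter> U)" by (intro finite_vimage_IntI) simp_all
    moreover have "{b. p b = y \<and> F i b \<noteq> 0} \<subseteq> p -` {y} \<inter> U" using U(2) by blast
    ultimately show ?thesis by (rule finite_subset[rotated])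
  qed
  have "finite (\<Union>i\<in>I. {b. p b = y \<and> F i b \<noteq> 0})" if "p = tgt G \<or> p = src G" for p
    using F(1) one[OF _ that] by blast
  from finite_subset[OF inc this]
  show "finite {b. tgt G b = y \<and> f b \<noteq> 0}" "finite {b. src G b = y \<and> f b \<noteq> 0}" by blast+
qed

text \<open>
  Any finite set carrying the nonzero terms will do as index set, so that several convolutions can
  be expanded over a common one.
\<close>

lemma conv_eq_sum:
  assumes "finite S" "S \<subseteq> {b. tgt G b = tgt G a}"
    "\<And>b. tgt G b = tgt G a \<Longrightarrow> f b * g (mul G (ginv G b) a) \<noteq> 0 \<Longrightarrow> b \<in> S"
  shows "conv G f g a = (\<Sum>b\<in>S. f b * g (mul G (ginv G b) a))"
proof -
  have "conv G f g a = infsum (\<lambda>b. f b * g (mul G (ginv G b) a)) S"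
    unfolding conv_def
  proof (rule infsum_cong_neutral)
    fix b
    show "f b * g (mul G (ginv G b) a) = 0" if "b \<in> S - {b. tgt G b = tgt G a}"
      using that assms(2) by blast
    show "f b * g (mul G (ginv G b) a) = 0" if b: "b \<in> {b. tgt G b = tgt G a} - S"
    proof (rule ccontr)
      assume "f b * g (mul G (ginv G b) a) \<noteq> 0"
      moreover have "tgt G b = tgt G a" using b by blast
      ultimately have "b \<in> S" using assms(3) by blast
      then show False using b by blast
    qed
  qed (rule refl)
  also have "\<dots> = (\<Sum>b\<in>S. f b * g (mul G (ginv G b) a))" by (rule infsum_finite[OF assms(1)])
  finally show ?thesis .
qed

lemma conv_eq:
  assumes "f \<in> Cc G"
  shows "conv G f g a = (\<Sum>b | tgt G b = tgt G a \<and> f b \<noteq> 0. f b * g (mul G (ginv G b) a))"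
  by (rule conv_eq_sum[OF finite_fibre(1)[OF assms]]) auto

lemma conv_add_left:
  assumes "f1 \<in> Cc G" "f2 \<in> Cc G"
  shows "conv G (\<lambda>a. f1 a + f2 a) g = (\<lambda>a. conv G f1 g a + conv G f2 g a)"
proof
  fix a
  let ?S = "{b. tgt G b = tgt G a \<and> f1 b \<noteq> 0} \<union> {b. tgt G b = tgt G a \<and> f2 b \<noteq> 0}"
  have fin: "finite ?S" by (rule finite_UnI[OF finite_fibre(1)[OF assms(1)] finite_fibre(1)[OF assms(2)]])
  have 1: "conv G (\<lambda>a. f1 a + f2 a) g a = (\<Sum>b\<in>?S. (f1 b + f2 b) * g (mul G (ginv G b) a))"
    by (rule conv_eq_sum[OF fin]) auto
  have 2: "conv G f1 g a = (\<Sum>b\<in>?S. f1 b * g (mul G (ginv G b) a))"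
    by (rule conv_eq_sum[OF fin]) auto
  have 3: "conv G f2 g a = (\<Sum>b\<in>?S. f2 b * g (mul G (ginv G b) a))"
    by (rule conv_eq_sum[OF fin]) auto
  show "conv G (\<lambda>a. f1 a + f2 a) g a = conv G f1 g a + conv G f2 g a"
    unfolding 1 2 3 by (simp add: sum.distrib algebra_simps)
qed

lemma conv_add_right:
  assumes "f \<in> Cc G"
  shows "conv G f (\<lambda>a. g1 a + g2 a) = (\<lambda>a. conv G f g1 a + conv G f g2 a)"
  by (rule ext) (simp add: conv_eq[OF assms] sum.distrib algebra_simps)

lemma conv_scale_left: "conv G (\<lambda>a. c * f a) g = (\<lambda>a. c * conv G f g a)"
  unfolding conv_def infsum_cmult_right'[symmetric] mult.assoc ..

lemma conv_scale_right: "conv G f (\<lambda>a. c * g a) = (\<lambda>a. c * conv G f g a)"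
  unfolding conv_def infsum_cmult_right'[symmetric] mult.left_commute[of _ c] ..

lemma conv_diff_left:
  assumes "f1 \<in> Cc G" "f2 \<in> Cc G"
  shows "conv G (\<lambda>a. f1 a - f2 a) g = (\<lambda>a. conv G f1 g a - conv G f2 g a)"
  using conv_add_left[OF assms(1) Cc_scale[OF assms(2), of "-1"], of g] conv_scale_left[of "-1" f2 g] by simp

lemma conv_diff_right:
  assumes "f \<in> Cc G"
  shows "conv G f (\<lambda>a. g1 a - g2 a) = (\<lambda>a. conv G f g1 a - conv G f g2 a)"
  using conv_add_right[OF assms, of g1 "\<lambda>a. (-1) * g2 a"] conv_scale_right[of f "-1" g2] by simp

lemma conv_sum_left:
  assumes "finite I" "\<And>i. i \<in> I \<Longrightarrow> F i \<in> Cc G"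
  shows "conv G (\<lambda>a. \<Sum>i\<in>I. F i a) g = (\<lambda>a. \<Sum>i\<in>I. conv G (F i) g a)"
  using assms
proof (induction I rule: finite_induct)
  case empty
  show ?case by (simp add: conv_def)
next
  case (insert i I)
  then show ?case using conv_add_left[of "F i" "\<lambda>a. \<Sum>i\<in>I. F i a" g] Cc_sum[of I F G] by simp
qed

lemma conv_bisection:
  assumes U: "inj_on (tgt G) U" "\<And>b. f b \<noteq> 0 \<Longrightarrow> b \<in> U" and b: "b \<in> U" "tgt G b = tgt G a"
  shows "conv G f g a = f b * g (mul G (ginv G b) a)"
proof -
  have "c \<in> {b}" if "tgt G c = tgt G a" "f c * g (mul G (ginv G c) a) \<noteq> 0" for c
  proof -
    have "c \<in> U" using U(2)[of c] that(2) by auto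
    then have "c = b" using inj_onD[OF U(1) _ _ b(1), of c] that(1) b(2) by simp
    then show ?thesis by simp
  qed
  then have "conv G f g a = (\<Sum>b\<in>{b}. f b * g (mul G (ginv G b) a))"
    by (rule conv_eq_sum[rotated 2]) (use b(2) in simp_all)
  then show ?thesis by simp
qed

lemma conv_nonzero:
  assumes "conv G f g a \<noteq> 0"
  obtains b where "tgt G b = tgt G a" "f b \<noteq> 0" "g (mul G (ginv G b) a) \<noteq> 0"
proof -
  have "\<exists>b. tgt G b = tgt G a \<and> f b \<noteq> 0 \<and> g (mul G (ginv G b) a) \<noteq> 0"
  proof (rule ccontr)
    assume *: "\<not> ?thesis"
    have "conv G f g a = (\<Sum>b\<in>{}. f b * g (mul G (ginv G b) a))"
      by (rule conv_eq_sum) (use * in auto)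
    then show False using assms by simp
  qed
  then show ?thesis using that by blast
qed

text \<open>
  The support of a product lies in the image, under multiplication, of the composable pairs in a
  product of two compact sets; these pairs form a closed set.
\<close>

lemma conv_support_compact:
  assumes "f \<in> Cc G" "g \<in> Cc G"
  obtains K where "compact K" "\<And>a. conv G f g a \<noteq> 0 \<Longrightarrow> a \<in> K"
proof -
  let ?A = "closure {a. f a \<noteq> 0}" and ?B = "closure {a. g a \<noteq> 0}"
  let ?D = "{(a, b). src G a = tgt G b}"
  have "closed ?D"
  proof -
    have "?D = {p. src G (fst p) = tgt G (snd p)}" by auto
    moreover have "closed {p. src G (fst p) = tgt G (snd p)}"
      by (rule closed_Collect_eq)
        (rule continuous_on_compose2[OF src_cont continuous_on_fst[OF continuous_on_id] subset_UNIV]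
          continuous_on_compose2[OF tgt_cont continuous_on_snd[OF continuous_on_id] subset_UNIV])+
    ultimately show ?thesis by simp
  qed
  moreover have "compact (?A \<times> ?B)" using assms CcD(2) by (intro compact_Times) auto
  ultimately have c: "compact ((?A \<times> ?B) \<inter> ?D)" by (rule compact_Int_closed[rotated])
  have "compact ((\<lambda>(a, b). mul G a b) ` ((?A \<times> ?B) \<inter> ?D))"
    by (rule compact_continuous_image[OF continuous_on_subset[OF mul_cont] c]) blast
  moreover have "a \<in> (\<lambda>(a, b). mul G a b) ` ((?A \<times> ?B) \<inter> ?D)" if a: "conv G f g a \<noteq> 0" for a
  proof -
    obtain b where b: "tgt G b = tgt G a" "f b \<noteq> 0" "g (mul G (ginv G b) a) \<noteq> 0"
      by (rule conv_nonzero[OF a])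
    have "(b, mul G (ginv G b) a) \<in> (?A \<times> ?B) \<inter> ?D"
      using CcD(3)[OF assms(1) b(2)] CcD(3)[OF assms(2) b(3)] b(1) by simp
    moreover have "a = (\<lambda>(a, b). mul G a b) (b, mul G (ginv G b) a)" using b(1) by simp
    ultimately show ?thesis by (rule rev_image_eqI)
  qed
  ultimately show ?thesis by (rule that)
qed

text \<open>
  If the support of \<open>f\<close> lies in a bisection \<open>U\<close>, the sum has at most one
  term. Over the open set of arrows whose range is in \<open>tgt G ` U\<close> that term depends
  continuously on the arrow; over the open set of arrows whose range misses the compact set
  \<open>tgt G ` ?K\<close> the convolution is zero. These two sets cover the groupoid.
\<close>

lemma conv_Cc_bisection_continuous:
  assumes f: "f \<in> Cc_bisection" and g: "g \<in> Cc G"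
  shows "continuous_on UNIV (conv G f g)"
proof -
  obtain U where U: "bisection U" "closure {a. f a \<noteq> 0} \<subseteq> U" "\<And>a. f a \<noteq> 0 \<Longrightarrow> a \<in> U"
    by (rule Cc_bisection_supp[OF f]) blast
  let ?K = "closure {a. f a \<noteq> 0}" and ?i = "inv_into U (tgt G)"
  let ?A = "tgt G -` (tgt G ` U)" and ?B = "tgt G -` (- (tgt G ` ?K))"
  have iU: "inj_on (tgt G) U" and oU: "open (tgt G ` U)" and cU: "continuous_on (tgt G ` U) ?i"
    using U(1) by (auto simp: bisection_def)
  have fc: "continuous_on UNIV f" and gc: "continuous_on UNIV g"
    using CcD(1) Cc_bisection_Cc[OF f] g by auto
  have oA: "open ?A" by (rule open_vimage[OF oU tgt_cont])
  have "compact (tgt G ` ?K)"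
    using CcD(2)[OF Cc_bisection_Cc[OF f]] tgt_cont by (intro compact_continuous_image) (auto intro: continuous_on_subset)
  then have oB: "open ?B" by (intro open_vimage[OF _ tgt_cont]) (simp add: compact_imp_closed open_Compl)
  have ci: "continuous_on ?A (\<lambda>a. ?i (tgt G a))"
    by (rule continuous_on_compose2[OF cU continuous_on_subset[OF tgt_cont]]) auto
  have ti: "tgt G (?i (tgt G a)) = tgt G a" "?i (tgt G a) \<in> U" if "a \<in> ?A" for a
    using that f_inv_into_f[of "tgt G a" "tgt G" U] inv_into_into[of "tgt G a" "tgt G" U] by auto
  have cm: "continuous_on ?A (\<lambda>a. (\<lambda>(a, b). mul G a b) (ginv G (?i (tgt G a)), a))"
  proof (rule continuous_on_compose2[OF mul_cont])
    show "continuous_on ?A (\<lambda>a. (ginv G (?i (tgt G a)), a))"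
      by (intro continuous_on_Pair continuous_on_id continuous_on_compose2[OF ginv_cont ci subset_UNIV])
    show "(\<lambda>a. (ginv G (?i (tgt G a)), a)) ` ?A \<subseteq> {(a, b). src G a = tgt G b}"
      using ti(1) by auto
  qed
  have "continuous_on ?A (\<lambda>a. f (?i (tgt G a)) * g ((\<lambda>(a, b). mul G a b) (ginv G (?i (tgt G a)), a)))"
    by (intro continuous_on_mult continuous_on_compose2[OF fc ci subset_UNIV]
        continuous_on_compose2[OF gc cm subset_UNIV])
  then have "continuous_on ?A (conv G f g)"
  proof (rule continuous_on_eq)
    fix a assume a: "a \<in> ?A"
    show "f (?i (tgt G a)) * g ((\<lambda>(a, b). mul G a b) (ginv G (?i (tgt G a)), a)) = conv G f g a"
      using conv_bisection[OF iU U(3) ti(2)[OF a] ti(1)[OF a]] by simp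
  qed
  moreover have "continuous_on ?B (conv G f g)"
  proof (rule continuous_on_eq)
    show "continuous_on ?B (\<lambda>a. 0 :: complex)" by (rule continuous_on_const)
    show "0 = conv G f g a" if a: "a \<in> ?B" for a
    proof (rule ccontr)
      assume "0 \<noteq> conv G f g a"
      then obtain b where b: "tgt G b = tgt G a" "f b \<noteq> 0" by (metis conv_nonzero)
      then have "b \<in> ?K" using CcD(3)[OF Cc_bisection_Cc[OF f]] by blast
      then show False using a b(1) by (metis ComplD image_eqI vimageD)
    qed
  qed
  ultimately have "continuous_on (?A \<union> ?B) (conv G f g)" by (rule continuous_on_open_Un[OF oA oB])
  moreover have "?A \<union> ?B = UNIV" using U(2) by blast
  ultimately show ?thesis by simp
qed

lemma Cc_conv:
  assumes f: "f \<in> Cc G" and g: "g \<in> Cc G"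
  shows "conv G f g \<in> Cc G"
proof -
  obtain I :: "'g set" and F where F: "finite I" "f = (\<lambda>a. \<Sum>i\<in>I. F i a)" "\<And>i. i \<in> I \<Longrightarrow> F i \<in> Cc_bisection"
    by (rule bisection_decompose[OF f]) blast
  have "conv G f g = (\<lambda>a. \<Sum>i\<in>I. conv G (F i) g a)"
    unfolding F(2) by (rule conv_sum_left[OF F(1) Cc_bisection_Cc[OF F(3)]])
  moreover have "continuous_on UNIV (\<lambda>a. \<Sum>i\<in>I. conv G (F i) g a)"
    by (intro continuous_on_sum conv_Cc_bisection_continuous F(3) g)
  ultimately have "continuous_on UNIV (conv G f g)" by simp
  moreover obtain K where "compact K" "\<And>a. conv G f g a \<noteq> 0 \<Longrightarrow> a \<in> K"
    by (rule conv_support_compact[OF f g]) blast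
  ultimately show ?thesis by (rule CcI)
qed

lemma Cc_star:
  assumes f: "f \<in> Cc G"
  shows "star G f \<in> Cc G"
proof (rule CcI)
  show "continuous_on UNIV (star G f)" unfolding star_def
    by (intro continuous_on_cnj continuous_on_compose2[OF CcD(1)[OF f] ginv_cont subset_UNIV])
  show "compact (ginv G ` closure {a. f a \<noteq> 0})"
    by (rule compact_continuous_image[OF continuous_on_subset[OF ginv_cont subset_UNIV] CcD(2)[OF f]])
  show "a \<in> ginv G ` closure {a. f a \<noteq> 0}" if "star G f a \<noteq> 0" for a
  proof (rule image_eqI[of _ _ "ginv G a"])
    show "ginv G a \<in> closure {a. f a \<noteq> 0}" using that by (intro CcD(3)[OF f]) (simp add: star_def)
  qed simp
qed

lemma star_star: "star G (star G f) = f"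
  by (simp add: star_def)

lemma star_Cc_ops:
  "star G (\<lambda>a. f a + g a) = (\<lambda>a. star G f a + star G g a)"
  "star G (\<lambda>a. f a - g a) = (\<lambda>a. star G f a - star G g a)"
  "star G (\<lambda>a. c * f a) = (\<lambda>a. cnj c * star G f a)"
  by (simp_all add: star_def)

text \<open>
  The units form a clopen set, so these functions are a copy of the commutative algebra of
  compactly supported continuous functions on the unit space.
\<close>

definition Cc_units :: "('g \<Rightarrow> complex) set" where
  "Cc_units = {h \<in> Cc G. \<forall>a. h a \<noteq> 0 \<longrightarrow> a \<in> units G}"

lemma Cc_units_Cc: "h \<in> Cc_units \<Longrightarrow> h \<in> Cc G" by (simp add: Cc_units_def)

lemma Cc_unitsD: "h \<in> Cc_units \<Longrightarrow> a \<notin> units G \<Longrightarrow> h a = 0" by (auto simp: Cc_units_def)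

lemma Cc_unitsI: "h \<in> Cc G \<Longrightarrow> (\<And>a. a \<notin> units G \<Longrightarrow> h a = 0) \<Longrightarrow> h \<in> Cc_units" by (auto simp: Cc_units_def)

lemma conv_Cc_units_left:
  assumes "h \<in> Cc_units"
  shows "conv G h f = (\<lambda>a. h (tgt G a) * f a)"
proof
  fix a
  have "inj_on (tgt G) (units G)" by (auto simp: inj_on_def)
  moreover have "\<And>b. h b \<noteq> 0 \<Longrightarrow> b \<in> units G" using assms by (auto simp: Cc_units_def)
  ultimately have "conv G h f a = h (tgt G a) * f (mul G (ginv G (tgt G a)) a)"
    by (rule conv_bisection) simp_all
  then show "conv G h f a = h (tgt G a) * f a" by simp
qed

lemma conv_Cc_units_Cc_units: "h \<in> Cc_units \<Longrightarrow> k \<in> Cc_units \<Longrightarrow> conv G h k = (\<lambda>a. h a * k a)"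
  by (rule ext) (metis Cc_unitsD conv_Cc_units_left mult_zero_right unitsD(2))

lemma star_Cc_units: "h \<in> Cc_units \<Longrightarrow> star G h = (\<lambda>a. cnj (h a))"
proof
  fix a assume "h \<in> Cc_units"
  show "star G h a = cnj (h a)"
  proof (cases "a \<in> units G")
    case False
    then have "ginv G a \<notin> units G" by (metis ginv_ginv ginv_of_unit)
    then show ?thesis using Cc_unitsD[OF \<open>h \<in> Cc_units\<close>] False by (simp add: star_def)
  qed (simp add: star_def)
qed

text \<open>
  For a bisection-supported \<open>f\<close> the product of \<open>star G f\<close> with
  \<open>f\<close> lives on the unit space: two arrows of a bisection with the same range
  coincide. Its value at \<open>x\<close> is the squared modulus of \<open>f\<close> at the only
  arrow of the bisection with source \<open>x\<close>. Norm estimates for \<open>f\<close> thereby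
  become statements about a commutative algebra.
\<close>

lemma star_conv_Cc_bisection:
  assumes f: "f \<in> Cc_bisection"
  shows "conv G (star G f) f \<in> Cc_units"
    and "x \<in> units G \<Longrightarrow> conv G (star G f) f x = (\<Sum>c | src G c = x \<and> f c \<noteq> 0. (cmod (f c))\<^sup>2)"
    and "conv G (star G f) f x = 0 \<or> (\<exists>c. src G c = x \<and> conv G (star G f) f x = (cmod (f c))\<^sup>2)"
proof -
  obtain U where U: "bisection U" "closure {a. f a \<noteq> 0} \<subseteq> U" "\<And>a. f a \<noteq> 0 \<Longrightarrow> a \<in> U"
    by (rule Cc_bisection_supp[OF f]) blast
  have iU: "inj_on (tgt G) U" "inj_on (src G) U" using U(1) by (auto simp: bisection_def)
  show Cc_units: "conv G (star G f) f \<in> Cc_units"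
  proof (rule Cc_unitsI[OF Cc_conv[OF Cc_star[OF Cc_bisection_Cc[OF f]] Cc_bisection_Cc[OF f]]], rule ccontr)
    fix a assume a: "a \<notin> units G" "conv G (star G f) f a \<noteq> 0"
    obtain b where b: "tgt G b = tgt G a" "star G f b \<noteq> 0" "f (mul G (ginv G b) a) \<noteq> 0"
      by (rule conv_nonzero[OF a(2)])
    have "ginv G b \<in> U" "mul G (ginv G b) a \<in> U" using U(3) b by (auto simp: star_def)
    then have e: "mul G (ginv G b) a = ginv G b" using inj_onD[OF iU(1)] b(1) by simp
    have "a = mul G b (mul G (ginv G b) a)" using b(1) by simp
    also have "\<dots> = tgt G b" unfolding e by simp
    finally show False using a(1) by simp
  qed
  show sum: "conv G (star G f) f x = (\<Sum>c | src G c = x \<and> f c \<noteq> 0. (cmod (f c))\<^sup>2)" if x: "x \<in> units G" for x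
  proof -
    let ?S = "{c. src G c = x \<and> f c \<noteq> 0}"
    have "conv G (star G f) f x = (\<Sum>b\<in>ginv G ` ?S. star G f b * f (mul G (ginv G b) x))"
    proof (rule conv_eq_sum)
      show "finite (ginv G ` ?S)" by (rule finite_imageI[OF finite_fibre(2)[OF Cc_bisection_Cc[OF f]]])
      show "ginv G ` ?S \<subseteq> {b. tgt G b = tgt G x}" using x by auto
      fix b assume b: "tgt G b = tgt G x" "star G f b * f (mul G (ginv G b) x) \<noteq> 0"
      then have "ginv G b \<in> ?S" using x by (simp add: star_def)
      then show "b \<in> ginv G ` ?S" by (rule rev_image_eqI) simp
    qed
    also have "\<dots> = (\<Sum>c\<in>?S. star G f (ginv G c) * f (mul G (ginv G (ginv G c)) x))"
    proof (rule sum.reindex[unfolded comp_def])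
      show "inj_on (ginv G) ?S" by (rule inj_on_inverseI) (rule ginv_ginv)
    qed
    also have "\<dots> = (\<Sum>c\<in>?S. of_real ((cmod (f c))\<^sup>2))"
    proof (rule sum.cong[OF refl])
      fix c assume c: "c \<in> ?S"
      then have "mul G c x = c" using x by simp
      then show "star G f (ginv G c) * f (mul G (ginv G (ginv G c)) x) = of_real ((cmod (f c))\<^sup>2)"
        by (simp add: star_def complex_norm_square mult.commute del: of_real_power)
    qed
    finally show ?thesis by simp
  qed
  show "conv G (star G f) f x = 0 \<or> (\<exists>c. src G c = x \<and> conv G (star G f) f x = (cmod (f c))\<^sup>2)"
  proof (cases "conv G (star G f) f x = 0")
    case False
    then have x: "x \<in> units G" using Cc_unitsD[OF Cc_units] by blast
    have "{c. src G c = x \<and> f c \<noteq> 0} \<noteq> {}" using False sum[OF x] by (metis of_real_0 sum.empty)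
    then obtain c where c: "src G c = x" "f c \<noteq> 0" by blast
    have "{c. src G c = x \<and> f c \<noteq> 0} = {c}"
    proof (rule subset_antisym; rule subsetI)
      fix c' assume "c' \<in> {c. src G c = x \<and> f c \<noteq> 0}"
      then show "c' \<in> {c}" using inj_onD[OF iU(2), of c' c] U(3) c by auto
    qed (use c in simp)
    then show ?thesis using sum[OF x] c by auto
  qed simp
qed

end

section \<open>Boundedness of C*-seminorms\<close>

context etale_gpd
begin

lemma Cc_units_compose:
  assumes "h \<in> Cc_units" "continuous_on UNIV k" "\<And>a. h a = 0 \<Longrightarrow> k a = 0"
  shows "k \<in> Cc_units"
proof (rule Cc_unitsI)
  show "k \<in> Cc G" by (rule CcI[OF assms(2) CcD(2)[OF Cc_units_Cc[OF assms(1)]]])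
      (use assms(3) CcD(3)[OF Cc_units_Cc[OF assms(1)]] in blast)
  show "k a = 0" if "a \<notin> units G" for a using Cc_unitsD[OF assms(1) that] assms(3) by blast
qed

context
  fixes p assumes p: "cstar_seminorm G p"
begin

lemma seminorm_laws:
  shows seminorm_nonneg: "f \<in> Cc G \<Longrightarrow> 0 \<le> p f"
    and seminorm_scale: "f \<in> Cc G \<Longrightarrow> p (\<lambda>a. c * f a) = cmod c * p f"
    and seminorm_add: "f \<in> Cc G \<Longrightarrow> g \<in> Cc G \<Longrightarrow> p (\<lambda>a. f a + g a) \<le> p f + p g"
    and seminorm_mult: "f \<in> Cc G \<Longrightarrow> g \<in> Cc G \<Longrightarrow> p (conv G f g) \<le> p f * p g"
    and seminorm_cstar: "f \<in> Cc G \<Longrightarrow> p (conv G (star G f) f) = (p f)\<^sup>2"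
  using p unfolding cstar_seminorm_def by blast+

text \<open>
  From the C*-identity and submultiplicativity, cancelling one factor.
\<close>

lemma seminorm_star:
  assumes "f \<in> Cc G" shows "p (star G f) \<le> p f"
proof -
  have s: "star G f \<in> Cc G" by (rule Cc_star[OF assms])
  have "(p (star G f))\<^sup>2 = p (conv G f (star G f))" using seminorm_cstar[OF s] by (simp add: star_star)
  also have "\<dots> \<le> p f * p (star G f)" by (rule seminorm_mult[OF assms s])
  finally show ?thesis using seminorm_nonneg[OF s] seminorm_nonneg[OF assms]
    by (cases "p (star G f) = 0") (auto simp: power2_eq_square)
qed

text \<open>
  Let \<open>u\<close> be the function \<open>h + i sqrt (e^2 - h^2)\<close>. Then \<open>u* u =
  e^2 = e* e\<close>, so \<open>u\<close> and \<open>e\<close> have the same seminorm by the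
  C*-identity, and \<open>h\<close> is the average of \<open>u\<close> and \<open>u*\<close>.
\<close>

lemma seminorm_mono:
  assumes h: "(\<lambda>a. of_real (h a)) \<in> Cc_units" and e: "(\<lambda>a. of_real (e a)) \<in> Cc_units"
    and le: "\<And>a. \<bar>h a\<bar> \<le> e a"
  shows "p (\<lambda>a. of_real (h a)) \<le> p (\<lambda>a. of_real (e a))"
proof -
  (* The square root is real because abs (h a) is at most e a. *)
  define u where "u a = Complex (h a) (sqrt ((e a)\<^sup>2 - (h a)\<^sup>2))" for a
  have le2: "(h a)\<^sup>2 \<le> (e a)\<^sup>2" for a using le[of a] by (metis abs_ge_zero abs_le_square_iff abs_of_nonneg order_trans)
  have hc: "continuous_on UNIV h" "continuous_on UNIV e"
    using continuous_on_Re[OF CcD(1)[OF Cc_units_Cc[OF h]]] continuous_on_Re[OF CcD(1)[OF Cc_units_Cc[OF e]]] by simp_all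
  have uc: "continuous_on UNIV u" unfolding u_def Complex_eq using hc
    by (intro continuous_on_add continuous_on_mult continuous_on_of_real continuous_on_const
        continuous_on_real_sqrt continuous_on_diff continuous_on_power)
  have uC: "u \<in> Cc_units"
  proof (rule Cc_units_compose[OF e uc])
    fix a assume "of_real (e a) = (0::complex)"
    then have "e a = 0" "h a = 0" using le[of a] by auto
    then show "u a = 0" by (simp add: u_def complex_eq_iff)
  qed
  have su: "star G u = (\<lambda>a. cnj (u a))" by (rule star_Cc_units[OF uC])
  have sC: "star G u \<in> Cc_units"
    unfolding su by (rule Cc_units_compose[OF uC]) (use uc in \<open>auto intro: continuous_on_cnj\<close>)
  have uu: "cnj (u a) * u a = of_real (e a) * of_real (e a)" for a
    using le2[of a] by (simp add: u_def complex_eq_iff power2_eq_square[symmetric])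
  have se: "star G (\<lambda>a. of_real (e a)) = (\<lambda>a. of_real (e a))" using star_Cc_units[OF e] by simp
  have ee: "conv G (star G u) u = conv G (star G (\<lambda>a. of_real (e a))) (\<lambda>a. of_real (e a))"
    unfolding se conv_Cc_units_Cc_units[OF e e] conv_Cc_units_Cc_units[OF sC uC] unfolding su by (simp add: uu)
  have "(p u)\<^sup>2 = (p (\<lambda>a. of_real (e a)))\<^sup>2"
    using seminorm_cstar[OF Cc_units_Cc[OF uC]] seminorm_cstar[OF Cc_units_Cc[OF e]] ee by simp
  then have pu: "p u = p (\<lambda>a. of_real (e a))"
    using seminorm_nonneg[OF Cc_units_Cc[OF uC]] seminorm_nonneg[OF Cc_units_Cc[OF e]] by (simp add: power2_eq_iff_nonneg)
  have "(\<lambda>a. of_real (h a)) = (\<lambda>a. (1/2) * (u a + star G u a))"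
    unfolding su by (rule ext) (simp add: u_def complex_eq_iff)
  then have "p (\<lambda>a. of_real (h a)) = 1/2 * p (\<lambda>a. u a + star G u a)"
    using seminorm_scale[OF Cc_add[OF Cc_units_Cc[OF uC] Cc_units_Cc[OF sC]], of "1/2"] by (simp add: norm_divide)
  also have "\<dots> \<le> 1/2 * (p u + p (star G u))"
    using seminorm_add[OF Cc_units_Cc[OF uC] Cc_units_Cc[OF sC]] by simp
  also have "\<dots> \<le> p u" using seminorm_star[OF Cc_units_Cc[OF uC]] by simp
  finally show ?thesis using pu by simp
qed

text \<open>
  Since \<open>e^2 \<le> e\<close>, monotonicity and the C*-identity give \<open>(p e)^2 = p (e^2)
  \<le> p e\<close>.
\<close>

lemma seminorm_le_one:
  assumes e: "(\<lambda>a. of_real (e a)) \<in> Cc_units" and e01: "\<And>a. 0 \<le> e a" "\<And>a. e a \<le> 1"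
  shows "p (\<lambda>a. of_real (e a)) \<le> 1"
proof -
  let ?e = "\<lambda>a. complex_of_real (e a)"
  have se: "star G ?e = ?e" using star_Cc_units[OF e] by simp
  have sq: "conv G (star G ?e) ?e = (\<lambda>a. of_real ((e a)\<^sup>2))"
    unfolding se conv_Cc_units_Cc_units[OF e e] by (simp add: power2_eq_square)
  have e2: "(\<lambda>a. complex_of_real ((e a)\<^sup>2)) \<in> Cc_units"
  proof (rule Cc_units_compose[OF e])
    have "continuous_on UNIV e" using continuous_on_Re[OF CcD(1)[OF Cc_units_Cc[OF e]]] by simp
    then show "continuous_on UNIV (\<lambda>a. complex_of_real ((e a)\<^sup>2))"
      by (intro continuous_on_of_real continuous_on_power)
  qed simp
  have "(p ?e)\<^sup>2 = p (\<lambda>a. of_real ((e a)\<^sup>2))" using seminorm_cstar[OF Cc_units_Cc[OF e]] sq by simp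
  also have "\<dots> \<le> p ?e"
  proof (rule seminorm_mono[OF e2 e])
    show "\<bar>(e a)\<^sup>2\<bar> \<le> e a" for a
      using e01[of a] by (simp add: power2_eq_square mult_left_le)
  qed
  finally show ?thesis
    using seminorm_nonneg[OF Cc_units_Cc[OF e]] by (cases "p ?e = 0") (auto simp: power2_eq_square)
qed

lemma seminorm_Cc_units_le:
  assumes h: "h \<in> Cc_units" and B: "0 \<le> B" "\<And>a. cmod (h a) \<le> B"
  shows "p h \<le> B"
proof (cases "B = 0")
  case True
  then have "h = (\<lambda>a. 0 * h a)" using B by (intro ext) simp
  then show ?thesis using seminorm_scale[OF Cc_units_Cc[OF h], of 0] B by simp
next
  case False
  (* Rescaling the squared modulus of h to values in [0,1]. *)
  define e where "e a = (cmod (h a))\<^sup>2 / B\<^sup>2" for a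
  have hc: "continuous_on UNIV h" using CcD(1)[OF Cc_units_Cc[OF h]] .
  have e: "(\<lambda>a. of_real (e a)) \<in> Cc_units"
  proof (rule Cc_units_compose[OF h])
    show "continuous_on UNIV (\<lambda>a. complex_of_real (e a))" unfolding e_def using hc False
      by (intro continuous_on_of_real continuous_on_divide continuous_on_power continuous_on_norm continuous_on_const) auto
  qed (simp add: e_def)
  have "star G h \<in> Cc_units"
    unfolding star_Cc_units[OF h] by (rule Cc_units_compose[OF h]) (use hc in \<open>auto intro: continuous_on_cnj\<close>)
  then have "conv G (star G h) h = (\<lambda>a. of_real (B\<^sup>2) * of_real (e a))"
    using False by (simp add: conv_Cc_units_Cc_units h star_Cc_units e_def complex_norm_square mult.commute del: of_real_power)
  then have "(p h)\<^sup>2 = B\<^sup>2 * p (\<lambda>a. of_real (e a))"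
    using seminorm_cstar[OF Cc_units_Cc[OF h]] seminorm_scale[OF Cc_units_Cc[OF e], of "of_real (B\<^sup>2)"]
    by (simp add: norm_power)
  also have "\<dots> \<le> B\<^sup>2 * 1"
  proof (intro mult_left_mono seminorm_le_one[OF e])
    show "0 \<le> e a" for a by (simp add: e_def)
    show "e a \<le> 1" for a using B False by (simp add: e_def power_mono)
  qed simp
  finally show ?thesis using B(1) by (simp add: power2_le_iff_abs_le)
qed

text \<open>
  The C*-identity reduces the estimate to \<open>star G f\<close> times \<open>f\<close>, a
  function on the unit space.
\<close>

lemma seminorm_Cc_bisection_le:
  assumes f: "f \<in> Cc_bisection" and B: "0 \<le> B" "\<And>a. cmod (f a) \<le> B"
  shows "p f \<le> B"
proof -
  have "(p f)\<^sup>2 = p (conv G (star G f) f)" using seminorm_cstar[OF Cc_bisection_Cc[OF f]] by simp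
  also have "\<dots> \<le> B\<^sup>2"
  proof (rule seminorm_Cc_units_le[OF star_conv_Cc_bisection(1)[OF f]])
    fix a
    consider "conv G (star G f) f a = 0" | c where "conv G (star G f) f a = (cmod (f c))\<^sup>2"
      using star_conv_Cc_bisection(3)[OF f, of a] by blast
    then show "cmod (conv G (star G f) f a) \<le> B\<^sup>2"
    proof cases
      case (2 c)
      then have "cmod (conv G (star G f) f a) = (cmod (f c))\<^sup>2" by (simp add: norm_power)
      then show ?thesis using B(2)[of c] by (simp add: power_mono)
    qed simp
  qed simp
  finally show ?thesis using B(1) by (simp add: power2_le_iff_abs_le)
qed

lemma seminorm_zero: "p (\<lambda>a. 0) = 0"
  using seminorm_scale[OF Cc_zero, of 0] by simp

lemma seminorm_sum:
  assumes "finite I" "\<And>i. i \<in> I \<Longrightarrow> F i \<in> Cc G"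
  shows "p (\<lambda>a. \<Sum>i\<in>I. F i a) \<le> (\<Sum>i\<in>I. p (F i))"
  using assms
proof (induction I rule: finite_induct)
  case empty
  show ?case by (simp add: seminorm_zero)
next
  case (insert i I)
  then have "p (\<lambda>a. F i a + (\<Sum>i\<in>I. F i a)) \<le> p (F i) + p (\<lambda>a. \<Sum>i\<in>I. F i a)"
    by (intro seminorm_add Cc_sum) auto
  then show ?case using insert by simp
qed

end

text \<open>
  The bound comes from the sup norms of the bisection-supported pieces, which do not mention
  \<open>p\<close>. Hence the supremum defining \<open>full_norm\<close> is that of a bounded set.
\<close>

lemma seminorm_bounded:
  assumes "f \<in> Cc G"
  obtains B where "\<And>p. cstar_seminorm G p \<Longrightarrow> p f \<le> B"
proof -
  obtain I :: "'g set" and F where F: "finite I" "f = (\<lambda>a. \<Sum>i\<in>I. F i a)" "\<And>i. i \<in> I \<Longrightarrow> F i \<in> Cc_bisection"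
    by (rule bisection_decompose[OF assms]) blast
  have "\<exists>B. 0 \<le> B \<and> (\<forall>a. cmod (F i a) \<le> B)" if "i \<in> I" for i
    by (rule Cc_bounded[OF Cc_bisection_Cc[OF F(3)[OF that]]]) blast
  then obtain B where B: "\<And>i. i \<in> I \<Longrightarrow> 0 \<le> B i" "\<And>i a. i \<in> I \<Longrightarrow> cmod (F i a) \<le> B i" by metis
  show ?thesis
  proof (rule that)
    fix p assume p: "cstar_seminorm G p"
    have "p f \<le> (\<Sum>i\<in>I. p (F i))" unfolding F(2) by (rule seminorm_sum[OF p F(1) Cc_bisection_Cc[OF F(3)]])
    also have "\<dots> \<le> (\<Sum>i\<in>I. B i)" by (intro sum_mono seminorm_Cc_bisection_le[OF p F(3)] B)
    finally show "p f \<le> (\<Sum>i\<in>I. B i)" .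
  qed
qed

abbreviation fnorm :: "('g \<Rightarrow> complex) \<Rightarrow> real" where "fnorm \<equiv> full_norm G"

lemma zero_seminorm: "cstar_seminorm G (\<lambda>f. 0)"
  by (simp add: cstar_seminorm_def)

lemma fnorm_upper:
  assumes "f \<in> Cc G" "cstar_seminorm G p"
  shows "p f \<le> fnorm f"
proof -
  obtain B where B: "\<And>p. cstar_seminorm G p \<Longrightarrow> p f \<le> B" by (rule seminorm_bounded[OF assms(1)]) blast
  have "bdd_above ((\<lambda>p. p f) ` {p. cstar_seminorm G p})" by (rule bdd_aboveI2[of _ _ B]) (simp add: B)
  then show ?thesis unfolding full_norm_def using assms(2) by (intro cSUP_upper) auto
qed

lemma fnorm_least:
  assumes "\<And>p. cstar_seminorm G p \<Longrightarrow> p f \<le> B"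
  shows "fnorm f \<le> B"
  unfolding full_norm_def by (rule cSUP_least) (use zero_seminorm assms in auto)

lemma fnorm_nonneg: "f \<in> Cc G \<Longrightarrow> 0 \<le> fnorm f"
  using fnorm_upper[OF _ zero_seminorm] by simp

lemma fnorm_add: "f \<in> Cc G \<Longrightarrow> g \<in> Cc G \<Longrightarrow> fnorm (\<lambda>a. f a + g a) \<le> fnorm f + fnorm g"
  by (rule fnorm_least, rule order_trans[OF seminorm_add add_mono[OF fnorm_upper fnorm_upper]])

lemma fnorm_mult:
  assumes "f \<in> Cc G" "g \<in> Cc G" shows "fnorm (conv G f g) \<le> fnorm f * fnorm g"
proof (rule fnorm_least)
  fix p assume p: "cstar_seminorm G p"
  have "p (conv G f g) \<le> p f * p g" by (rule seminorm_mult[OF p assms])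
  also have "\<dots> \<le> fnorm f * fnorm g"
    by (intro mult_mono fnorm_upper p assms fnorm_nonneg seminorm_nonneg[OF p])
  finally show "p (conv G f g) \<le> fnorm f * fnorm g" .
qed

lemma fnorm_scale:
  assumes "f \<in> Cc G" shows "fnorm (\<lambda>a. c * f a) \<le> cmod c * fnorm f"
  by (rule fnorm_least) (simp add: seminorm_scale[OF _ assms] fnorm_upper[OF assms] mult_left_mono)

lemma fnorm_star: "f \<in> Cc G \<Longrightarrow> fnorm (star G f) \<le> fnorm f"
  by (rule fnorm_least) (meson fnorm_upper order_trans seminorm_star)

lemma fnorm_zero: "fnorm (\<lambda>a. 0) = 0"
  using fnorm_scale[OF Cc_zero, of 0] fnorm_nonneg[OF Cc_zero] by simp

lemma fnorm_minus_commute: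
  assumes "f \<in> Cc G" "g \<in> Cc G" shows "fnorm (\<lambda>a. f a - g a) = fnorm (\<lambda>a. g a - f a)"
proof -
  have "fnorm (\<lambda>a. f a - g a) \<le> fnorm (\<lambda>a. g a - f a)" if "f \<in> Cc G" "g \<in> Cc G" for f g
    using fnorm_scale[OF Cc_diff[OF that(2,1)], of "-1"] by simp
  then show ?thesis using assms by (meson antisym)
qed

lemma fnorm_triangle:
  assumes "f \<in> Cc G" "g \<in> Cc G" "h \<in> Cc G"
  shows "fnorm (\<lambda>a. f a - h a) \<le> fnorm (\<lambda>a. f a - g a) + fnorm (\<lambda>a. g a - h a)"
  using fnorm_add[OF Cc_diff[OF assms(1,2)] Cc_diff[OF assms(2,3)]] by simp

section \<open>The completion\<close>

lemma cauchyI: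
  assumes "\<And>m. u m \<in> Cc G" "\<And>e. e > 0 \<Longrightarrow> \<exists>M. \<forall>m\<ge>M. \<forall>k\<ge>M. fnorm (\<lambda>a. u m a - u k a) < e"
  shows "u \<in> cauchy_seqs G"
  using assms unfolding cauchy_seqs_def by blast

lemma cauchyD:
  assumes "u \<in> cauchy_seqs G"
  shows "u m \<in> Cc G" "e > 0 \<Longrightarrow> \<exists>M. \<forall>m\<ge>M. \<forall>k\<ge>M. fnorm (\<lambda>a. u m a - u k a) < e"
  using assms unfolding cauchy_seqs_def by blast+

lemma cauchy_bounded:
  assumes u: "u \<in> cauchy_seqs G"
  obtains B where "B > 0" "\<And>m. fnorm (u m) \<le> B"
proof -
  obtain M where M: "\<forall>m\<ge>M. \<forall>k\<ge>M. fnorm (\<lambda>a. u m a - u k a) < 1" using cauchyD(2)[OF u, of 1] by auto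
  define B where "B = (\<Sum>m\<le>M. fnorm (u m)) + 1"
  have le: "fnorm (u m) \<le> (\<Sum>m\<le>M. fnorm (u m))" if "m \<le> M" for m
    using that fnorm_nonneg[OF cauchyD(1)[OF u]] by (intro member_le_sum) auto
  have "fnorm (u m) \<le> B" for m
  proof (cases "m \<le> M")
    case True
    then show ?thesis using le[of m] by (simp add: B_def)
  next
    case False
    have "fnorm (u m) = fnorm (\<lambda>a. (u m a - u M a) + u M a)" by simp
    also have "\<dots> \<le> fnorm (\<lambda>a. u m a - u M a) + fnorm (u M)"
      using cauchyD(1)[OF u] by (intro fnorm_add Cc_diff)
    also have "fnorm (\<lambda>a. u m a - u M a) \<le> 1" using M False by (intro less_imp_le) auto
    finally show ?thesis using le[of M] by (simp add: B_def)
  qed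
  moreover have "B > 0" unfolding B_def using fnorm_nonneg[OF cauchyD(1)[OF u]] by (intro add_nonneg_pos sum_nonneg) auto
  ultimately show ?thesis using that by blast
qed

lemma cauchy_const: "f \<in> Cc G \<Longrightarrow> (\<lambda>m. f) \<in> cauchy_seqs G"
  by (rule cauchyI) (auto simp: fnorm_zero)

text \<open>
  The closure of Cauchy sequences under each algebraic operation is an instance of this criterion.
\<close>

lemma cauchy_dominated:
  assumes w: "\<And>m. w m \<in> Cc G" and u: "u \<in> cauchy_seqs G" and v: "v \<in> cauchy_seqs G" and C: "0 < C"
    and le: "\<And>m k. fnorm (\<lambda>a. w m a - w k a) \<le> C * (fnorm (\<lambda>a. u m a - u k a) + fnorm (\<lambda>a. v m a - v k a))"
  shows "w \<in> cauchy_seqs G"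
proof (rule cauchyI[OF w])
  fix e :: real assume e: "e > 0"
  obtain M1 where M1: "\<forall>m\<ge>M1. \<forall>k\<ge>M1. fnorm (\<lambda>a. u m a - u k a) < e / (2 * C)"
    using cauchyD(2)[OF u, of "e / (2 * C)"] e C by auto
  obtain M2 where M2: "\<forall>m\<ge>M2. \<forall>k\<ge>M2. fnorm (\<lambda>a. v m a - v k a) < e / (2 * C)"
    using cauchyD(2)[OF v, of "e / (2 * C)"] e C by auto
  have "fnorm (\<lambda>a. w m a - w k a) < e" if "m \<ge> max M1 M2" "k \<ge> max M1 M2" for m k
  proof -
    have "fnorm (\<lambda>a. u m a - u k a) + fnorm (\<lambda>a. v m a - v k a) < e / (2 * C) + e / (2 * C)"
      using M1 M2 that by (intro add_strict_mono) auto
    then have "C * (fnorm (\<lambda>a. u m a - u k a) + fnorm (\<lambda>a. v m a - v k a)) < C * (e / (2 * C) + e / (2 * C))"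
      using C by (rule mult_strict_left_mono)
    also have "\<dots> = e" using C by (simp add: field_simps)
    finally show ?thesis using le[of m k] by linarith
  qed
  then show "\<exists>M. \<forall>m\<ge>M. \<forall>k\<ge>M. fnorm (\<lambda>a. w m a - w k a) < e" by blast
qed

lemma relI:
  "u \<in> cauchy_seqs G \<Longrightarrow> v \<in> cauchy_seqs G \<Longrightarrow> (\<lambda>m. fnorm (\<lambda>a. u m a - v m a)) \<longlonglongrightarrow> 0 \<Longrightarrow> (u, v) \<in> cauchy_rel G"
  by (simp add: cauchy_rel_def)

lemma relD:
  assumes "(u, v) \<in> cauchy_rel G"
  shows "u \<in> cauchy_seqs G" "v \<in> cauchy_seqs G" "(\<lambda>m. fnorm (\<lambda>a. u m a - v m a)) \<longlonglongrightarrow> 0"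
  using assms by (simp_all add: cauchy_rel_def)

lemma tendsto_zero_dominated:
  fixes x :: "nat \<Rightarrow> real"
  assumes "\<And>m. 0 \<le> x m" "\<And>m. x m \<le> y m" "y \<longlonglongrightarrow> 0"
  shows "x \<longlonglongrightarrow> 0"
  by (rule tendsto_sandwich[OF _ _ tendsto_const assms(3)]) (use assms in auto)

lemma equiv_rel: "equiv (cauchy_seqs G) (cauchy_rel G)"
proof (rule equivI)
  show "cauchy_rel G \<subseteq> cauchy_seqs G \<times> cauchy_seqs G" by (auto simp: cauchy_rel_def)
  show "refl_on (cauchy_seqs G) (cauchy_rel G)"
    by (rule refl_onI) (auto simp: cauchy_rel_def fnorm_zero)
  show "sym (cauchy_rel G)"
  proof (rule symI)
    fix u v assume r: "(u, v) \<in> cauchy_rel G"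
    have "(\<lambda>m. fnorm (\<lambda>a. v m a - u m a)) = (\<lambda>m. fnorm (\<lambda>a. u m a - v m a))"
      using fnorm_minus_commute[OF cauchyD(1)[OF relD(2)[OF r]] cauchyD(1)[OF relD(1)[OF r]]] by (rule ext)
    then show "(v, u) \<in> cauchy_rel G" using relD[OF r] by (simp add: cauchy_rel_def)
  qed
  show "trans (cauchy_rel G)"
  proof (rule transI)
    fix u v w assume r: "(u, v) \<in> cauchy_rel G" "(v, w) \<in> cauchy_rel G"
    note C = cauchyD(1)[OF relD(1)[OF r(1)]] cauchyD(1)[OF relD(2)[OF r(1)]] cauchyD(1)[OF relD(2)[OF r(2)]]
    show "(u, w) \<in> cauchy_rel G"
    proof (rule relI[OF relD(1)[OF r(1)] relD(2)[OF r(2)] tendsto_zero_dominated])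
      show "(\<lambda>m. fnorm (\<lambda>a. u m a - v m a) + fnorm (\<lambda>a. v m a - w m a)) \<longlonglongrightarrow> 0"
        using tendsto_add[OF relD(3)[OF r(1)] relD(3)[OF r(2)]] by simp
      show "0 \<le> fnorm (\<lambda>a. u m a - w m a)" for m by (intro fnorm_nonneg Cc_diff C)
      show "fnorm (\<lambda>a. u m a - w m a) \<le> fnorm (\<lambda>a. u m a - v m a) + fnorm (\<lambda>a. v m a - w m a)" for m
        by (intro fnorm_triangle C)
    qed
  qed
qed

definition cclass :: "(nat \<Rightarrow> 'g \<Rightarrow> complex) \<Rightarrow> 'g cstar_elem" where
  "cclass u = cauchy_rel G `` {u}"

lemma cclass_Cstar: "u \<in> cauchy_seqs G \<Longrightarrow> cclass u \<in> Cstar G"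
  unfolding cclass_def Cstar_def by (rule quotientI)

lemma Cstar_cclass:
  assumes "A \<in> Cstar G" obtains u where "u \<in> cauchy_seqs G" "A = cclass u"
  using assms unfolding cclass_def Cstar_def by (rule quotientE)

lemma cclass_self: "u \<in> cauchy_seqs G \<Longrightarrow> u \<in> cclass u"
  unfolding cclass_def by (rule equiv_class_self[OF equiv_rel])

lemma cclass_mem:
  assumes "v \<in> cclass u" shows "v \<in> cauchy_seqs G" "cclass v = cclass u" "(\<lambda>m. fnorm (\<lambda>a. u m a - v m a)) \<longlonglongrightarrow> 0"
proof -
  have r: "(u, v) \<in> cauchy_rel G" using assms by (simp add: cclass_def)
  show "v \<in> cauchy_seqs G" by (rule relD(2)[OF r])
  show "(\<lambda>m. fnorm (\<lambda>a. u m a - v m a)) \<longlonglongrightarrow> 0" by (rule relD(3)[OF r])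
  show "cclass v = cclass u" unfolding cclass_def by (rule equiv_class_eq[OF equiv_rel r, symmetric])
qed

lemma cclass_eqI:
  assumes "u \<in> cauchy_seqs G" "v \<in> cauchy_seqs G" "(\<lambda>m. fnorm (\<lambda>a. u m a - v m a)) \<longlonglongrightarrow> 0"
  shows "cclass u = cclass v"
  unfolding cclass_def by (rule equiv_class_eq[OF equiv_rel relI[OF assms]])

text \<open>
  The usual product estimate \<open>f g - f' g' = (f - f') g + f' (g - g')\<close>; only the norms
  of \<open>f'\<close> and \<open>g\<close> have to be bounded.
\<close>

lemma fnorm_conv_diff:
  assumes "f \<in> Cc G" "f' \<in> Cc G" "g \<in> Cc G" "g' \<in> Cc G"
  shows "fnorm (\<lambda>a. conv G f g a - conv G f' g' a) \<le>
    fnorm (\<lambda>a. f a - f' a) * fnorm g + fnorm f' * fnorm (\<lambda>a. g a - g' a)"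
proof -
  have "fnorm (\<lambda>a. conv G f g a - conv G f' g' a) =
      fnorm (\<lambda>a. conv G (\<lambda>a. f a - f' a) g a + conv G f' (\<lambda>a. g a - g' a) a)"
    by (simp add: conv_diff_left assms conv_diff_right)
  also have "\<dots> \<le> fnorm (conv G (\<lambda>a. f a - f' a) g) + fnorm (conv G f' (\<lambda>a. g a - g' a))"
    by (intro fnorm_add Cc_conv Cc_diff assms)
  also have "\<dots> \<le> fnorm (\<lambda>a. f a - f' a) * fnorm g + fnorm f' * fnorm (\<lambda>a. g a - g' a)"
    by (intro add_mono fnorm_mult Cc_diff assms)
  finally show ?thesis .
qed

text \<open>
  Addition, scaling, involution and convolution are all Lipschitz on bounded sets. This one
  property makes each of them preserve Cauchy sequences and descend to classes; unary operations
  ignore their second argument.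
\<close>

definition lipschitz_op :: "(('g \<Rightarrow> complex) \<Rightarrow> ('g \<Rightarrow> complex) \<Rightarrow> 'g \<Rightarrow> complex) \<Rightarrow> bool" where
  "lipschitz_op p \<longleftrightarrow> (\<forall>f\<in>Cc G. \<forall>g\<in>Cc G. p f g \<in> Cc G) \<and>
     (\<forall>B>0. \<exists>C>0. \<forall>f\<in>Cc G. \<forall>f'\<in>Cc G. \<forall>g\<in>Cc G. \<forall>g'\<in>Cc G. fnorm f' \<le> B \<longrightarrow> fnorm g \<le> B \<longrightarrow>
        fnorm (\<lambda>a. p f g a - p f' g' a) \<le> C * (fnorm (\<lambda>a. f a - f' a) + fnorm (\<lambda>a. g a - g' a)))"

lemma lipschitz_opI:
  assumes "\<And>f g. f \<in> Cc G \<Longrightarrow> g \<in> Cc G \<Longrightarrow> p f g \<in> Cc G"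
    and "\<And>B. 0 < B \<Longrightarrow> 0 < C B"
    and "\<And>B f f' g g'. 0 < B \<Longrightarrow> f \<in> Cc G \<Longrightarrow> f' \<in> Cc G \<Longrightarrow> g \<in> Cc G \<Longrightarrow> g' \<in> Cc G \<Longrightarrow> fnorm f' \<le> B \<Longrightarrow> fnorm g \<le> B \<Longrightarrow>
      fnorm (\<lambda>a. p f g a - p f' g' a) \<le> C B * (fnorm (\<lambda>a. f a - f' a) + fnorm (\<lambda>a. g a - g' a))"
  shows "lipschitz_op p"
  unfolding lipschitz_op_def
proof (intro conjI ballI allI impI exI)
  fix B :: real assume "0 < B"
  show "0 < C B" by (rule assms(2)) fact
qed (rule assms; assumption)+

text \<open>
  Cauchy sequences are bounded, so one Lipschitz constant serves for all their members.
\<close>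

lemma lipschitz_op_bound:
  assumes p: "lipschitz_op p" and u: "u \<in> cauchy_seqs G" and v: "v \<in> cauchy_seqs G"
  obtains C where "0 < C" "\<And>i j f g. f \<in> Cc G \<Longrightarrow> g \<in> Cc G \<Longrightarrow>
    fnorm (\<lambda>a. p f (v j) a - p (u i) g a) \<le> C * (fnorm (\<lambda>a. f a - u i a) + fnorm (\<lambda>a. v j a - g a))"
proof -
  obtain B where B: "B > 0" "\<And>m. fnorm (u m) \<le> B" by (rule cauchy_bounded[OF u]) blast
  obtain B' where B': "B' > 0" "\<And>m. fnorm (v m) \<le> B'" by (rule cauchy_bounded[OF v]) blast
  have "0 < max B B'" using B(1) by simp
  from mp[OF spec[OF conjunct2[OF p[unfolded lipschitz_op_def]]] this]
  obtain C where C: "C > 0" "\<forall>f\<in>Cc G. \<forall>f'\<in>Cc G. \<forall>g\<in>Cc G. \<forall>g'\<in>Cc G. fnorm f' \<le> max B B' \<longrightarrow> fnorm g \<le> max B B' \<longrightarrow>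
      fnorm (\<lambda>a. p f g a - p f' g' a) \<le> C * (fnorm (\<lambda>a. f a - f' a) + fnorm (\<lambda>a. g a - g' a))"
    by (elim exE conjE)
  show ?thesis
  proof (rule that[OF C(1)])
    fix i j f g assume fg: "f \<in> Cc G" "g \<in> Cc G"
    show "fnorm (\<lambda>a. p f (v j) a - p (u i) g a) \<le> C * (fnorm (\<lambda>a. f a - u i a) + fnorm (\<lambda>a. v j a - g a))"
      by (rule C(2)[rule_format, OF fg(1) cauchyD(1)[OF u] cauchyD(1)[OF v] fg(2)])
        (use B(2)[of i] B'(2)[of j] in auto)
  qed
qed

lemma lipschitz_op_cauchy:
  assumes p: "lipschitz_op p" and u: "u \<in> cauchy_seqs G" and v: "v \<in> cauchy_seqs G"
  shows "(\<lambda>m. p (u m) (v m)) \<in> cauchy_seqs G"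
proof -
  note C = cauchyD(1)[OF u] cauchyD(1)[OF v]
  obtain K where K: "0 < K" "\<And>i j f g. f \<in> Cc G \<Longrightarrow> g \<in> Cc G \<Longrightarrow>
    fnorm (\<lambda>a. p f (v j) a - p (u i) g a) \<le> K * (fnorm (\<lambda>a. f a - u i a) + fnorm (\<lambda>a. v j a - g a))"
    by (rule lipschitz_op_bound[OF p u v]) blast
  have "p (u m) (v m) \<in> Cc G" for m using p C unfolding lipschitz_op_def by blast
  then show ?thesis by (rule cauchy_dominated[OF _ u v K(1) K(2)[OF C]])
qed

lemma lipschitz_op_class:
  assumes p: "lipschitz_op p" and u: "u \<in> cauchy_seqs G" and v: "v \<in> cauchy_seqs G"
    and m: "u' \<in> cclass u" "v' \<in> cclass v"
  shows "cclass (\<lambda>m. p (u' m) (v' m)) = cclass (\<lambda>m. p (u m) (v m))"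
proof -
  note u' = cclass_mem(1)[OF m(1)] and v' = cclass_mem(1)[OF m(2)]
  obtain K where K: "0 < K" "\<And>i j f g. f \<in> Cc G \<Longrightarrow> g \<in> Cc G \<Longrightarrow>
    fnorm (\<lambda>a. p f (v j) a - p (u' i) g a) \<le> K * (fnorm (\<lambda>a. f a - u' i a) + fnorm (\<lambda>a. v j a - g a))"
    by (rule lipschitz_op_bound[OF p u' v]) blast
  have P: "p f g \<in> Cc G" if "f \<in> Cc G" "g \<in> Cc G" for f g using p that unfolding lipschitz_op_def by blast
  show ?thesis
  proof (rule cclass_eqI[symmetric, OF lipschitz_op_cauchy[OF p u v] lipschitz_op_cauchy[OF p u' v'] tendsto_zero_dominated])
    show "(\<lambda>m. K * (fnorm (\<lambda>a. u m a - u' m a) + fnorm (\<lambda>a. v m a - v' m a))) \<longlonglongrightarrow> 0"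
      using tendsto_mult_right_zero[OF tendsto_add_zero[OF cclass_mem(3)[OF m(1)] cclass_mem(3)[OF m(2)]]] .
    fix i
    show "0 \<le> fnorm (\<lambda>a. p (u i) (v i) a - p (u' i) (v' i) a)"
      by (intro fnorm_nonneg Cc_diff P cauchyD(1)[OF u] cauchyD(1)[OF v] cauchyD(1)[OF u'] cauchyD(1)[OF v'])
    show "fnorm (\<lambda>a. p (u i) (v i) a - p (u' i) (v' i) a) \<le> K * (fnorm (\<lambda>a. u i a - u' i a) + fnorm (\<lambda>a. v i a - v' i a))"
      by (rule K(2)[OF cauchyD(1)[OF u] cauchyD(1)[OF v']])
  qed
qed

text \<open>
  The operations on classes are defined as unions over representatives; once all members of the
  union agree, it is that common value.
\<close>

lemma UN_const: "u \<in> A \<Longrightarrow> (\<And>x. x \<in> A \<Longrightarrow> f x = c) \<Longrightarrow> (\<Union>x\<in>A. f x) = c"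
  by blast

lemma lipschitz_add: "lipschitz_op (\<lambda>f g a. f a + g a)"
proof (rule lipschitz_opI[where C = "\<lambda>_. 1"])
  fix f f' g g' assume C: "f \<in> Cc G" "f' \<in> Cc G" "g \<in> Cc G" "g' \<in> Cc G"
  show "fnorm (\<lambda>a. f a + g a - (f' a + g' a)) \<le> 1 * (fnorm (\<lambda>a. f a - f' a) + fnorm (\<lambda>a. g a - g' a))"
    using fnorm_add[OF Cc_diff[OF C(1,2)] Cc_diff[OF C(3,4)]] by (simp add: algebra_simps)
qed (simp_all add: Cc_add)

lemma lipschitz_scale: "lipschitz_op (\<lambda>f g a. c * f a)"
proof (rule lipschitz_opI[where C = "\<lambda>_. cmod c + 1"])
  fix f f' g g' assume C: "f \<in> Cc G" "f' \<in> Cc G" "g \<in> Cc G" "g' \<in> Cc G"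
  have "fnorm (\<lambda>a. c * f a - c * f' a) \<le> cmod c * fnorm (\<lambda>a. f a - f' a)"
    using fnorm_scale[OF Cc_diff[OF C(1,2)], of c] by (simp add: algebra_simps)
  also have "\<dots> \<le> (cmod c + 1) * (fnorm (\<lambda>a. f a - f' a) + fnorm (\<lambda>a. g a - g' a))"
    using fnorm_nonneg[OF Cc_diff[OF C(1,2)]] fnorm_nonneg[OF Cc_diff[OF C(3,4)]] by (intro mult_mono) auto
  finally show "fnorm (\<lambda>a. c * f a - c * f' a) \<le> (cmod c + 1) * (fnorm (\<lambda>a. f a - f' a) + fnorm (\<lambda>a. g a - g' a))" .
qed (simp_all add: Cc_scale add_nonneg_pos)

lemma lipschitz_star: "lipschitz_op (\<lambda>f g. star G f)"
proof (rule lipschitz_opI[where C = "\<lambda>_. 1"])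
  fix f f' g g' assume C: "f \<in> Cc G" "f' \<in> Cc G" "g \<in> Cc G" "g' \<in> Cc G"
  show "fnorm (\<lambda>a. star G f a - star G f' a) \<le> 1 * (fnorm (\<lambda>a. f a - f' a) + fnorm (\<lambda>a. g a - g' a))"
    using fnorm_star[OF Cc_diff[OF C(1,2)]] fnorm_nonneg[OF Cc_diff[OF C(3,4)]] by (simp add: star_Cc_ops)
qed (simp_all add: Cc_star)

lemma lipschitz_conv: "lipschitz_op (conv G)"
proof (rule lipschitz_opI[where C = "\<lambda>B. B"])
  fix B f f' g g' assume C: "f \<in> Cc G" "f' \<in> Cc G" "g \<in> Cc G" "g' \<in> Cc G" and B: "fnorm f' \<le> B" "fnorm g \<le> B"
  let ?d = "fnorm (\<lambda>a. f a - f' a)" and ?d' = "fnorm (\<lambda>a. g a - g' a)"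
  have "fnorm (\<lambda>a. conv G f g a - conv G f' g' a) \<le> ?d * fnorm g + fnorm f' * ?d'" by (rule fnorm_conv_diff[OF C])
  also have "\<dots> \<le> ?d * B + B * ?d'" by (intro add_mono mult_left_mono mult_right_mono B fnorm_nonneg Cc_diff C)
  finally show "fnorm (\<lambda>a. conv G f g a - conv G f' g' a) \<le> B * (?d + ?d')" by (simp add: algebra_simps)
qed (simp_all add: Cc_conv)

lemma cauchy_ops:
  assumes u: "u \<in> cauchy_seqs G"
  shows cauchy_add: "v \<in> cauchy_seqs G \<Longrightarrow> (\<lambda>m a. u m a + v m a) \<in> cauchy_seqs G"
    and cauchy_scale: "(\<lambda>m a. c * u m a) \<in> cauchy_seqs G"
    and cauchy_mult: "v \<in> cauchy_seqs G \<Longrightarrow> (\<lambda>m. conv G (u m) (v m)) \<in> cauchy_seqs G"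
    and cauchy_star: "(\<lambda>m. star G (u m)) \<in> cauchy_seqs G"
  using lipschitz_op_cauchy[OF lipschitz_add u] lipschitz_op_cauchy[OF lipschitz_scale u u]
    lipschitz_op_cauchy[OF lipschitz_conv u] lipschitz_op_cauchy[OF lipschitz_star u u] by blast+

lemma cstar_ops_cclass:
  assumes u: "u \<in> cauchy_seqs G"
  shows cstar_add_cclass: "v \<in> cauchy_seqs G \<Longrightarrow> cstar_add G (cclass u) (cclass v) = cclass (\<lambda>m a. u m a + v m a)"
    and cstar_scale_cclass: "cstar_scale G c (cclass u) = cclass (\<lambda>m a. c * u m a)"
    and cstar_mult_cclass: "v \<in> cauchy_seqs G \<Longrightarrow> cstar_mult G (cclass u) (cclass v) = cclass (\<lambda>m. conv G (u m) (v m))"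
    and cstar_star_cclass: "cstar_star G (cclass u) = cclass (\<lambda>m. star G (u m))"
  unfolding cstar_add_def cstar_scale_def cstar_mult_def cstar_star_def cclass_def[symmetric]
  by (rule UN_const[OF cclass_self] UN_const[OF cclass_self[OF u]] lipschitz_op_class[OF lipschitz_add u]
      lipschitz_op_class[OF lipschitz_scale u u] lipschitz_op_class[OF lipschitz_conv u]
      lipschitz_op_class[OF lipschitz_star u u] | assumption)+

end

section \<open>Finite-dimensional linear algebra\<close>

lemma mat_adjoint_dim [simp]: "dim_row (mat_adjoint A) = dim_col A" "dim_col (mat_adjoint A) = dim_row A"
  by (simp_all add: mat_adjoint_def)

lemma mat_adjoint_carrier [simp]: "A \<in> carrier_mat m n \<Longrightarrow> mat_adjoint A \<in> carrier_mat n m"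
  by (metis carrier_matD carrier_matI mat_adjoint_dim)

lemma mat_adjoint_index [simp]:
  fixes A :: "complex mat"
  assumes "i < dim_col A" "j < dim_row A"
  shows "mat_adjoint A $$ (i, j) = cnj (A $$ (j, i))"
  using assms by (simp add: mat_adjoint_def mat_of_rows_def)

lemma mult_mat_index:
  assumes "A \<in> carrier_mat m n" "B \<in> carrier_mat n k" "i < m" "j < k"
  shows "(A * B) $$ (i, j) = (\<Sum>l<n. A $$ (i, l) * B $$ (l, j))"
  using assms by (simp add: scalar_prod_def atLeast0LessThan)

lemma mult_mat_vec_index:
  assumes "A \<in> carrier_mat m n" "v \<in> carrier_vec n" "i < m"
  shows "vec_index (A *\<^sub>v v) i = (\<Sum>l<n. A $$ (i, l) * vec_index v l)"
  using assms by (simp add: scalar_prod_def atLeast0LessThan)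

lemma mult_unit_vec_index:
  fixes A :: "complex mat"
  assumes "A \<in> carrier_mat m n" "i < m" "j < n"
  shows "vec_index (A *\<^sub>v unit_vec n j) i = A $$ (i, j)"
  using assms by simp

lemma mult_zero_vec:
  fixes A :: "complex mat"
  assumes "A \<in> carrier_mat m n"
  shows "A *\<^sub>v 0\<^sub>v n = 0\<^sub>v m"
  using assms by (intro eq_vecI) (auto simp: scalar_prod_def)

lemma mat_adjoint_adjoint [simp]: "mat_adjoint (mat_adjoint (A :: complex mat)) = A"
  by (rule eq_matI) simp_all

lemma mat_adjoint_mult:
  fixes A B :: "complex mat"
  assumes A: "A \<in> carrier_mat m n" and B: "B \<in> carrier_mat n k"
  shows "mat_adjoint (A * B) = mat_adjoint B * mat_adjoint A"
proof (rule eq_matI)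
  fix i j assume "i < dim_row (mat_adjoint B * mat_adjoint A)" "j < dim_col (mat_adjoint B * mat_adjoint A)"
  then have ij: "i < k" "j < m" using A B by auto
  have "mat_adjoint (A * B) $$ (i, j) = cnj ((A * B) $$ (j, i))" using A B ij by (intro mat_adjoint_index) auto
  also have "\<dots> = (\<Sum>l<n. cnj (A $$ (j, l)) * cnj (B $$ (l, i)))"
    unfolding mult_mat_index[OF A B ij(2,1)] by simp
  also have "\<dots> = (\<Sum>l<n. mat_adjoint B $$ (i, l) * mat_adjoint A $$ (l, j))"
    using A B ij by (intro sum.cong) auto
  also have "\<dots> = (mat_adjoint B * mat_adjoint A) $$ (i, j)"
    by (rule mult_mat_index[symmetric]) (use A B ij in auto)
  finally show "mat_adjoint (A * B) $$ (i, j) = (mat_adjoint B * mat_adjoint A) $$ (i, j)" .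
qed (use A B in auto)

text \<open>
  The summation range is taken from the second argument only; on \<open>carrier_vec n\<close> this
  is the standard inner product, conjugate-linear in the second argument.
\<close>

definition ip :: "complex vec \<Rightarrow> complex vec \<Rightarrow> complex" where
  "ip v w = (\<Sum>i<dim_vec w. vec_index v i * cnj (vec_index w i))"

lemma ip_eq: "w \<in> carrier_vec n \<Longrightarrow> ip v w = (\<Sum>i<n. vec_index v i * cnj (vec_index w i))"
  by (simp add: ip_def carrier_vecD)

lemma ip_smult_left:
  assumes "v \<in> carrier_vec n" "w \<in> carrier_vec n"
  shows "ip (c \<cdot>\<^sub>v v) w = c * ip v w"
  using assms by (simp add: ip_eq sum_distrib_left mult.assoc carrier_vecD)

lemma ip_smult_right:
  assumes "v \<in> carrier_vec n" "w \<in> carrier_vec n"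
  shows "ip v (c \<cdot>\<^sub>v w) = cnj c * ip v w"
  using assms by (simp add: ip_eq[of _ n] sum_distrib_left mult.left_commute carrier_vecD)

lemma ip_self: "v \<in> carrier_vec n \<Longrightarrow> ip v v = of_real (\<Sum>i<n. (cmod (vec_index v i))\<^sup>2)"
  by (simp add: ip_eq complex_norm_square del: of_real_power)

lemma ip_self_zero:
  assumes v: "v \<in> carrier_vec n" and "ip v v = 0"
  shows "v = 0\<^sub>v n"
proof -
  have "(\<Sum>i<n. (cmod (vec_index v i))\<^sup>2) = 0" using assms ip_self[OF v] by (metis of_real_eq_0_iff)
  then have "\<forall>i<n. vec_index v i = 0" by (simp add: sum_nonneg_eq_0_iff)
  then show ?thesis using v by (intro eq_vecI) auto
qed

lemma ip_adjoint:
  assumes A: "A \<in> carrier_mat m n" and v: "v \<in> carrier_vec n" and w: "w \<in> carrier_vec m"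
  shows "ip (A *\<^sub>v v) w = ip v (mat_adjoint A *\<^sub>v w)"
proof -
  have "ip (A *\<^sub>v v) w = (\<Sum>i<m. \<Sum>l<n. A $$ (i, l) * vec_index v l * cnj (vec_index w i))"
    unfolding ip_eq[OF w] by (simp add: mult_mat_vec_index[OF A v] sum_distrib_right)
  also have "\<dots> = (\<Sum>l<n. \<Sum>i<m. A $$ (i, l) * vec_index v l * cnj (vec_index w i))" by (rule sum.swap)
  also have "\<dots> = (\<Sum>l<n. vec_index v l * cnj (\<Sum>i<m. mat_adjoint A $$ (l, i) * vec_index w i))"
    using A by (intro sum.cong refl) (auto simp: sum_distrib_left mult_ac)
  also have "\<dots> = ip v (mat_adjoint A *\<^sub>v w)"
  proof -
    have c: "mat_adjoint A \<in> carrier_mat n m" using A by simp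
    then have "mat_adjoint A *\<^sub>v w \<in> carrier_vec n" using w by simp
    then show ?thesis by (simp add: ip_eq mult_mat_vec_index[OF c w])
  qed
  finally show ?thesis .
qed

definition isometry :: "nat \<Rightarrow> nat \<Rightarrow> complex mat \<Rightarrow> bool" where
  "isometry n k E \<longleftrightarrow> E \<in> carrier_mat n k \<and> mat_adjoint E * E = 1\<^sub>m k"

text \<open>
  Padding with zero rows would turn an isometry with \<open>k > n\<close> into a square one; a
  square isometry is unitary, which a zero row forbids.
\<close>

lemma isometry_le:
  assumes "isometry n k E"
  shows "k \<le> n"
proof (rule ccontr)
  assume "\<not> k \<le> n"
  then have nk: "n < k" by simp
  have E: "E \<in> carrier_mat n k" "mat_adjoint E * E = 1\<^sub>m k" using assms by (auto simp: isometry_def)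
  define P where "P = Matrix.mat k k (\<lambda>(i, j). if i < n then E $$ (i, j) else 0)"
  have P: "P \<in> carrier_mat k k" by (simp add: P_def)
  have "mat_adjoint P * P = 1\<^sub>m k"
  proof (rule eq_matI)
    fix i j assume "i < dim_row (1\<^sub>m k :: complex mat)" "j < dim_col (1\<^sub>m k :: complex mat)"
    then have ij: "i < k" "j < k" by auto
    have "(mat_adjoint P * P) $$ (i, j) = (\<Sum>l<k. mat_adjoint P $$ (i, l) * P $$ (l, j))"
      by (rule mult_mat_index) (use P ij in auto)
    also have "\<dots> = (\<Sum>l<k. if l < n then cnj (E $$ (l, i)) * E $$ (l, j) else 0)"
      using P ij by (intro sum.cong refl) (auto simp: P_def)
    also have "\<dots> = (\<Sum>l<n. cnj (E $$ (l, i)) * E $$ (l, j))"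
      using nk by (intro sum.mono_neutral_cong_right) auto
    also have "\<dots> = (\<Sum>l<n. mat_adjoint E $$ (i, l) * E $$ (l, j))"
      using E ij by (intro sum.cong refl) auto
    also have "\<dots> = (mat_adjoint E * E) $$ (i, j)"
      by (rule mult_mat_index[symmetric]) (use E ij in auto)
    finally show "(mat_adjoint P * P) $$ (i, j) = 1\<^sub>m k $$ (i, j)" using E by simp
  qed (use P in auto)
  then have "P * mat_adjoint P = 1\<^sub>m k"
    by (rule mat_mult_left_right_inverse[rotated 2]) (use P in auto)
  moreover have "(P * mat_adjoint P) $$ (n, n) = (\<Sum>l<k. P $$ (n, l) * mat_adjoint P $$ (l, n))"
    by (rule mult_mat_index) (use P nk in auto)
  (* Row n of the padded matrix P is zero. *)
  moreover have "\<dots> = 0" using nk by (intro sum.neutral) (auto simp: P_def)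
  ultimately show False using nk by simp
qed

definition is_subspace :: "nat \<Rightarrow> complex vec set \<Rightarrow> bool" where
  "is_subspace n W \<longleftrightarrow> W \<subseteq> carrier_vec n \<and> 0\<^sub>v n \<in> W \<and> (\<forall>v\<in>W. \<forall>w\<in>W. v + w \<in> W) \<and> (\<forall>c. \<forall>v\<in>W. c \<cdot>\<^sub>v v \<in> W)"

lemma is_subspaceD:
  assumes "is_subspace n W"
  shows "v \<in> W \<Longrightarrow> v \<in> carrier_vec n" "0\<^sub>v n \<in> W" "v \<in> W \<Longrightarrow> w \<in> W \<Longrightarrow> v + w \<in> W" "v \<in> W \<Longrightarrow> c \<cdot>\<^sub>v v \<in> W"
  using assms unfolding is_subspace_def by auto

lemma joint_eigenspace:
  assumes A: "\<And>h. h \<in> S \<Longrightarrow> A h \<in> carrier_mat n n"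
  shows "is_subspace n {v \<in> carrier_vec n. \<forall>h\<in>S. A h *\<^sub>v v = c h \<cdot>\<^sub>v v}"
  unfolding is_subspace_def
proof (intro conjI ballI allI CollectI)
  let ?W = "{v \<in> carrier_vec n. \<forall>h\<in>S. A h *\<^sub>v v = c h \<cdot>\<^sub>v v}"
  show "?W \<subseteq> carrier_vec n" by blast
  show "A h *\<^sub>v 0\<^sub>v n = c h \<cdot>\<^sub>v 0\<^sub>v n" if "h \<in> S" for h
    unfolding mult_zero_vec[OF A[OF that]] by (intro eq_vecI) auto
  show "A h *\<^sub>v (v + w) = c h \<cdot>\<^sub>v (v + w)" if "v \<in> ?W" "w \<in> ?W" "h \<in> S" for h v w
    using that mult_add_distrib_mat_vec[OF A[OF that(3)], of v w] smult_add_distrib_vec[of v n w "c h"] by simp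
  show "A h *\<^sub>v (k \<cdot>\<^sub>v v) = c h \<cdot>\<^sub>v (k \<cdot>\<^sub>v v)" if "v \<in> ?W" "h \<in> S" for h k v
    using that mult_mat_vec[OF A[OF that(2)], of v k] by (simp add: smult_smult_assoc mult.commute)
qed auto

text \<open>
  A unit vector orthogonal to the columns can be appended to them. The values of the new isometry
  are spelled out so that they can be seen to stay in a given subspace.
\<close>

lemma isometry_extend:
  assumes E: "isometry n k E" and r: "r \<in> carrier_vec n" "ip r r = 1" "mat_adjoint E *\<^sub>v r = 0\<^sub>v k"
  obtains E' where "isometry n (Suc k) E'"
    "\<And>x. x \<in> carrier_vec (Suc k) \<Longrightarrow> \<exists>y c. y \<in> carrier_vec k \<and> E' *\<^sub>v x = E *\<^sub>v y + c \<cdot>\<^sub>v r"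
proof -
  have Ec: "E \<in> carrier_mat n k" and EE: "mat_adjoint E * E = 1\<^sub>m k" using E by (auto simp: isometry_def)
  define E' where "E' = Matrix.mat n (Suc k) (\<lambda>(i, j). if j < k then E $$ (i, j) else vec_index r i)"
  have E'c: "E' \<in> carrier_mat n (Suc k)" by (simp add: E'_def)
  have Er: "(\<Sum>l<n. cnj (E $$ (l, i)) * vec_index r l) = 0" if "i < k" for i
  proof -
    have "(\<Sum>l<n. cnj (E $$ (l, i)) * vec_index r l) = (\<Sum>l<n. mat_adjoint E $$ (i, l) * vec_index r l)"
      using Ec that by (intro sum.cong refl) auto
    also have "\<dots> = vec_index (mat_adjoint E *\<^sub>v r) i"
      by (rule mult_mat_vec_index[symmetric]) (use Ec r that in auto)
    finally show ?thesis using r that by simp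
  qed
  have EEi: "(\<Sum>l<n. cnj (E $$ (l, i)) * E $$ (l, j)) = (if i = j then 1 else 0)" if "i < k" "j < k" for i j
  proof -
    have "(\<Sum>l<n. cnj (E $$ (l, i)) * E $$ (l, j)) = (\<Sum>l<n. mat_adjoint E $$ (i, l) * E $$ (l, j))"
      using Ec that by (intro sum.cong refl) auto
    also have "\<dots> = (mat_adjoint E * E) $$ (i, j)"
      by (rule mult_mat_index[symmetric]) (use Ec that in auto)
    finally show ?thesis using EE that by simp
  qed
  have rr: "(\<Sum>l<n. cnj (vec_index r l) * vec_index r l) = 1"
    using r(2) unfolding ip_eq[OF r(1)] by (simp add: mult.commute)
  have "mat_adjoint E' * E' = 1\<^sub>m (Suc k)"
  proof (rule eq_matI)
    fix i j assume "i < dim_row (1\<^sub>m (Suc k) :: complex mat)" "j < dim_col (1\<^sub>m (Suc k) :: complex mat)"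
    then have ij: "i < Suc k" "j < Suc k" by auto
    have "(mat_adjoint E' * E') $$ (i, j) = (\<Sum>l<n. mat_adjoint E' $$ (i, l) * E' $$ (l, j))"
      by (rule mult_mat_index) (use E'c ij in auto)
    also have "\<dots> = (\<Sum>l<n. cnj (if i < k then E $$ (l, i) else vec_index r l) * (if j < k then E $$ (l, j) else vec_index r l))"
      using E'c ij by (intro sum.cong refl) (auto simp: E'_def)
    also have "\<dots> = (if i = j then 1 else 0)"
    proof -
      have "(\<Sum>l<n. cnj (vec_index r l) * E $$ (l, j)) = cnj (\<Sum>l<n. cnj (E $$ (l, j)) * vec_index r l)"
        by (simp add: mult.commute)
      then show ?thesis using Er[of i] Er[of j] EEi[of i j] rr ij by (cases "i < k"; cases "j < k") simp_all
    qed
    finally show "(mat_adjoint E' * E') $$ (i, j) = 1\<^sub>m (Suc k) $$ (i, j)" using ij by simp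
  qed (use E'c in auto)
  then have iso: "isometry n (Suc k) E'" using E'c by (simp add: isometry_def)
  show ?thesis
  proof (rule that[OF iso])
    fix x :: "complex vec" assume x: "x \<in> carrier_vec (Suc k)"
    define y where "y = Matrix.vec k (vec_index x)"
    have y: "y \<in> carrier_vec k" by (simp add: y_def)
    have "E' *\<^sub>v x = E *\<^sub>v y + vec_index x k \<cdot>\<^sub>v r"
    proof (rule eq_vecI)
      fix i assume "i < dim_vec (E *\<^sub>v y + vec_index x k \<cdot>\<^sub>v r)"
      then have i: "i < n" using r by simp
      have "vec_index (E' *\<^sub>v x) i = (\<Sum>l<Suc k. E' $$ (i, l) * vec_index x l)"
        by (rule mult_mat_vec_index[OF E'c x i])
      also have "\<dots> = (\<Sum>l<k. E $$ (i, l) * vec_index y l) + vec_index x k * vec_index r i"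
        using i by (simp add: E'_def y_def)
      also have "\<dots> = vec_index (E *\<^sub>v y) i + vec_index x k * vec_index r i"
        by (simp add: mult_mat_vec_index[OF Ec y i])
      finally show "vec_index (E' *\<^sub>v x) i = vec_index (E *\<^sub>v y + vec_index x k \<cdot>\<^sub>v r) i"
        using i r Ec by simp
    qed (use r Ec E'c in auto)
    then show "\<exists>y c. y \<in> carrier_vec k \<and> E' *\<^sub>v x = E *\<^sub>v y + c \<cdot>\<^sub>v r" using y by blast
  qed
qed

text \<open>
  The columns of \<open>E\<close> are an orthonormal basis of \<open>W\<close>. Take
  \<open>k\<close> maximal, which is possible since \<open>k \<le> n\<close>: if the projection
  onto the column space moved some \<open>w\<close> in \<open>W\<close>, the normalized difference
  would give one more column.
\<close>

lemma onb_exists: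
  assumes W: "is_subspace n W"
  obtains k E where "isometry n k E" "\<And>x. x \<in> carrier_vec k \<Longrightarrow> E *\<^sub>v x \<in> W"
    "\<And>w. w \<in> W \<Longrightarrow> E *\<^sub>v (mat_adjoint E *\<^sub>v w) = w"
proof -
  let ?P = "\<lambda>k. \<exists>E. isometry n k E \<and> (\<forall>x\<in>carrier_vec k. E *\<^sub>v x \<in> W)"
  have "?P 0"
  proof (intro exI conjI ballI)
    show "isometry n 0 (0\<^sub>m n 0)" unfolding isometry_def by (auto intro!: eq_matI)
    show "0\<^sub>m n 0 *\<^sub>v x \<in> W" if "x \<in> carrier_vec 0" for x
    proof -
      have "0\<^sub>m n 0 *\<^sub>v x = 0\<^sub>v n" using that by (intro eq_vecI) (auto simp: scalar_prod_def)
      then show ?thesis using is_subspaceD(2)[OF W] by simp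
    qed
  qed
  moreover have "\<forall>k. ?P k \<longrightarrow> k < Suc n" using isometry_le le_imp_less_Suc by blast
  ultimately obtain k where k: "?P k" "\<And>j. ?P j \<Longrightarrow> j \<le> k"
    using ex_has_greatest_nat[of ?P 0 "\<lambda>k. k" "Suc n"] by blast
  obtain E where E: "isometry n k E" "\<And>x. x \<in> carrier_vec k \<Longrightarrow> E *\<^sub>v x \<in> W" using k(1) by blast
  have Ec: "E \<in> carrier_mat n k" and EE: "mat_adjoint E * E = 1\<^sub>m k" using E(1) by (auto simp: isometry_def)
  have Ac: "mat_adjoint E \<in> carrier_mat k n" using Ec by simp
  have onto: "E *\<^sub>v (mat_adjoint E *\<^sub>v w) = w" if w: "w \<in> W" for w
  proof (rule ccontr)
    assume ne: "E *\<^sub>v (mat_adjoint E *\<^sub>v w) \<noteq> w"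
    have wc: "w \<in> carrier_vec n" by (rule is_subspaceD(1)[OF W w])
    define q where "q = mat_adjoint E *\<^sub>v w"
    have q: "q \<in> carrier_vec k" unfolding q_def using Ac wc by simp
    have Eq: "E *\<^sub>v q \<in> carrier_vec n" using Ec q by simp
    define s where "s = w - E *\<^sub>v q"
    have s: "s \<in> carrier_vec n" unfolding s_def using wc Eq by simp
    have "s = w + (-1) \<cdot>\<^sub>v (E *\<^sub>v q)" unfolding s_def using wc Eq Ec by (intro eq_vecI) auto
    then have sW: "s \<in> W" using is_subspaceD(3,4)[OF W] w E(2)[OF q] by simp
    have s0: "s \<noteq> 0\<^sub>v n"
    proof
      assume "s = 0\<^sub>v n"
      have "w = s + E *\<^sub>v q" unfolding s_def using wc Eq Ec by (intro eq_vecI) auto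
      then show False using ne Eq \<open>s = 0\<^sub>v n\<close> by (simp add: q_def)
    qed
    have As: "mat_adjoint E *\<^sub>v s = 0\<^sub>v k"
    proof -
      have "mat_adjoint E *\<^sub>v (E *\<^sub>v q) = (mat_adjoint E * E) *\<^sub>v q"
        by (rule assoc_mult_mat_vec[symmetric, OF Ac Ec q])
      also have "\<dots> = q" using EE q by simp
      finally show ?thesis
        unfolding s_def mult_minus_distrib_mat_vec[OF Ac wc Eq] q_def[symmetric] using q by simp
    qed
    define t where "t = (\<Sum>i<n. (cmod (vec_index s i))\<^sup>2)"
    have ss: "ip s s = of_real t" unfolding t_def by (rule ip_self[OF s])
    have t0: "t > 0"
    proof -
      have "t \<noteq> 0" using ip_self_zero[OF s] ss s0 by auto
      moreover have "t \<ge> 0" unfolding t_def by (intro sum_nonneg) simp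
      ultimately show ?thesis by simp
    qed
    define r where "r = of_real (1 / sqrt t) \<cdot>\<^sub>v s"
    have r: "r \<in> carrier_vec n" unfolding r_def using s by simp
    have rr: "ip r r = 1"
    proof -
      have "ip r r = of_real (1 / sqrt t) * (cnj (of_real (1 / sqrt t)) * of_real t)"
        unfolding r_def ip_smult_left[OF s smult_carrier_vec[THEN iffD2, OF s]] ip_smult_right[OF s s] ss ..
      also have "\<dots> = of_real (1 / sqrt t * (1 / sqrt t) * t)"
        by (simp only: complex_cnj_complex_of_real of_real_mult mult.assoc)
      also have "1 / sqrt t * (1 / sqrt t) * t = 1" using t0 by (simp add: field_simps)
      finally show ?thesis by simp
    qed
    have Ar: "mat_adjoint E *\<^sub>v r = 0\<^sub>v k" unfolding r_def mult_mat_vec[OF Ac s] As by auto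
    obtain E' where E': "isometry n (Suc k) E'"
      "\<And>x. x \<in> carrier_vec (Suc k) \<Longrightarrow> \<exists>y c. y \<in> carrier_vec k \<and> E' *\<^sub>v x = E *\<^sub>v y + c \<cdot>\<^sub>v r"
      by (rule isometry_extend[OF E(1) r rr Ar]) blast
    have "E' *\<^sub>v x \<in> W" if x: "x \<in> carrier_vec (Suc k)" for x
    proof -
      obtain y c where y: "y \<in> carrier_vec k" "E' *\<^sub>v x = E *\<^sub>v y + c \<cdot>\<^sub>v r" using E'(2)[OF x] by blast
      have "r \<in> W" unfolding r_def by (rule is_subspaceD(4)[OF W sW])
      then show ?thesis unfolding y(2) by (intro is_subspaceD(3,4)[OF W] E(2)[OF y(1)])
    qed
    then have "?P (Suc k)" using E'(1) by blast
    then show False using k(2)[of "Suc k"] by simp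
  qed
  show ?thesis by (rule that[OF E onto])
qed

lemma mult_mat_vec_assoc:
  "A \<in> carrier_mat m n \<Longrightarrow> B \<in> carrier_mat n k \<Longrightarrow> v \<in> carrier_vec k \<Longrightarrow> (A * B) *\<^sub>v v = A *\<^sub>v (B *\<^sub>v v)"
  by (rule assoc_mult_mat_vec)

text \<open>
  On a nonzero invariant subspace of least dimension every operator of the family is a scalar,
  because its eigenspaces in that subspace are again invariant.
\<close>

lemma common_eigenvector:
  fixes S :: "complex mat set"
  assumes n: "0 < n" and S: "S \<subseteq> carrier_mat n n"
    and comm: "\<And>A B. A \<in> S \<Longrightarrow> B \<in> S \<Longrightarrow> A * B = B * A"
  obtains v where "v \<in> carrier_vec n" "v \<noteq> 0\<^sub>v n" "\<forall>A\<in>S. \<exists>c. A *\<^sub>v v = c \<cdot>\<^sub>v v"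
proof -
  let ?inv = "\<lambda>W. is_subspace n W \<and> (\<exists>w\<in>W. w \<noteq> 0\<^sub>v n) \<and> (\<forall>A\<in>S. \<forall>w\<in>W. A *\<^sub>v w \<in> W)"
  let ?bas = "\<lambda>W k E. isometry n k E \<and> (\<forall>x\<in>carrier_vec k. E *\<^sub>v x \<in> W) \<and> (\<forall>w\<in>W. E *\<^sub>v (mat_adjoint E *\<^sub>v w) = w)"
  let ?P = "\<lambda>k. \<exists>W E. ?inv W \<and> ?bas W k E"
  have bas: "\<exists>k E. ?bas W k E" if W: "is_subspace n W" for W
    by (rule onb_exists[OF W]) blast
  have top: "?inv (carrier_vec n)"
  proof (intro conjI ballI)
    show "is_subspace n (carrier_vec n)" by (auto simp: is_subspace_def)
    show "\<exists>w\<in>carrier_vec n. (w :: complex vec) \<noteq> 0\<^sub>v n"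
    proof
      show "unit_vec n 0 \<in> carrier_vec n" by simp
      have "vec_index (unit_vec n 0) 0 \<noteq> vec_index (0\<^sub>v n :: complex vec) 0" using n by simp
      then show "unit_vec n 0 \<noteq> (0\<^sub>v n :: complex vec)" by metis
    qed
    show "A *\<^sub>v w \<in> carrier_vec n" if "A \<in> S" "w \<in> carrier_vec n" for A w
      using S that by auto
  qed
  then have "\<exists>k. ?P k" using bas[of "carrier_vec n"] by blast
  then obtain k where k: "?P k" and least: "\<forall>j<k. \<not> ?P j" using exists_least_iff[of ?P] by blast
  obtain W E where W: "?inv W" and E: "?bas W k E" using k(1) by blast
  have sW: "is_subspace n W" and iE: "isometry n k E" using W E by blast+
  have Ec: "E \<in> carrier_mat n k" and EE: "mat_adjoint E * E = 1\<^sub>m k" using iE by (auto simp: isometry_def)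
  have Ac: "mat_adjoint E \<in> carrier_mat k n" using Ec by simp
  obtain w0 where w0: "w0 \<in> W" "w0 \<noteq> 0\<^sub>v n" using W by blast
  note Wc = is_subspaceD(1)[OF sW]
  have k0: "0 < k"
  proof (rule ccontr)
    assume "\<not> 0 < k"
    then have "mat_adjoint E *\<^sub>v w0 \<in> carrier_vec 0" using Ac Wc[OF w0(1)] by simp
    then have "E *\<^sub>v (mat_adjoint E *\<^sub>v w0) = 0\<^sub>v n" using Ec \<open>\<not> 0 < k\<close>
      by (intro eq_vecI) (auto simp: scalar_prod_def)
    then show False using E w0 by auto
  qed
  (* An orthonormal basis of W' has at least k members by minimality and, expressed in the basis of
     W, at most k; so the change of basis F is unitary. *)
  have min: "W' = W" if W': "?inv W'" "W' \<subseteq> W" for W'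
  proof -
    obtain k' E' where E': "?bas W' k' E'" using bas W'(1) by blast
    have iE': "isometry n k' E'" using E' by blast
    have E'c: "E' \<in> carrier_mat n k'" and E'E': "mat_adjoint E' * E' = 1\<^sub>m k'" using iE' by (auto simp: isometry_def)
    define F where "F = mat_adjoint E * E'"
    have Fc: "F \<in> carrier_mat k k'" unfolding F_def using Ac E'c by simp
    have EF: "E *\<^sub>v (F *\<^sub>v x) = E' *\<^sub>v x" if x: "x \<in> carrier_vec k'" for x
    proof -
      have "E' *\<^sub>v x \<in> W" using E' W'(2) x by blast
      then have "E *\<^sub>v (mat_adjoint E *\<^sub>v (E' *\<^sub>v x)) = E' *\<^sub>v x" using E by blast
      then show ?thesis unfolding F_def mult_mat_vec_assoc[OF Ac E'c x] .
    qed
    have "E * F = E'"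
    proof (rule eq_matI)
      fix i j assume "i < dim_row E'" "j < dim_col E'"
      then have ij: "i < n" "j < k'" using E'c by auto
      have "E *\<^sub>v (F *\<^sub>v unit_vec k' j) = E' *\<^sub>v unit_vec k' j" by (rule EF) simp
      then have "(E * F) *\<^sub>v unit_vec k' j = E' *\<^sub>v unit_vec k' j"
        by (simp add: mult_mat_vec_assoc[OF Ec Fc])
      moreover have "E * F \<in> carrier_mat n k'" using Ec Fc by (rule mult_carrier_mat)
      ultimately show "(E * F) $$ (i, j) = E' $$ (i, j)"
        using mult_unit_vec_index[of "E * F" n k' i j] mult_unit_vec_index[OF E'c ij] ij(1,2) by simp
    qed (use Ec Fc E'c in auto)
    then have "mat_adjoint F * F = 1\<^sub>m k'"
    proof -
      have "mat_adjoint F * F = (mat_adjoint E' * E) * (mat_adjoint E * E')"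
        unfolding F_def by (simp add: mat_adjoint_mult[OF Ac E'c])
      also have "\<dots> = mat_adjoint E' * (E * (mat_adjoint E * E'))"
        by (rule assoc_mult_mat[where n\<^sub>1=k' and n\<^sub>2=n and n\<^sub>3=k and n\<^sub>4=k']) (use Ec E'c in auto)
      also have "E * (mat_adjoint E * E') = E'" using \<open>E * F = E'\<close> by (simp add: F_def)
      finally show ?thesis using E'E' by simp
    qed
    then have iF: "isometry k k' F" using Fc by (simp add: isometry_def)
    have "?P k'" using W'(1) E' by blast
    then have "\<not> k' < k" using least by blast
    then have "k' = k" using isometry_le[OF iF] by simp
    then have Fc': "F \<in> carrier_mat k k" "mat_adjoint F * F = 1\<^sub>m k" using iF by (auto simp: isometry_def)
    have FF: "F * mat_adjoint F = 1\<^sub>m k"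
      by (rule mat_mult_left_right_inverse[OF _ Fc'(1,2)]) (use Fc' in simp)
    have "W \<subseteq> W'"
    proof
      fix w assume w: "w \<in> W"
      define y where "y = mat_adjoint E *\<^sub>v w"
      have y: "y \<in> carrier_vec k" unfolding y_def by (rule mult_mat_vec_carrier[OF Ac Wc[OF w]])
      define z where "z = mat_adjoint F *\<^sub>v y"
      have z: "z \<in> carrier_vec k'" unfolding z_def by (rule mult_mat_vec_carrier[OF mat_adjoint_carrier[OF Fc] y])
      have "E' *\<^sub>v z = E *\<^sub>v (F *\<^sub>v z)" using EF[OF z] by simp
      also have "F *\<^sub>v z = (F * mat_adjoint F) *\<^sub>v y"
        unfolding z_def by (rule mult_mat_vec_assoc[symmetric]) (use Fc y in auto)
      also have "\<dots> = y" using FF y by simp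
      also have "E *\<^sub>v y = w" using E w by (simp add: y_def)
      finally have "w = E' *\<^sub>v z" by simp
      then show "w \<in> W'" using E' z by blast
    qed
    then show ?thesis using W'(2) by blast
  qed
  have scalar: "\<exists>c. \<forall>w\<in>W. A *\<^sub>v w = c \<cdot>\<^sub>v w" if A: "A \<in> S" for A
  proof -
    have Aca: "A \<in> carrier_mat n n" using S A by blast
    define B where "B = mat_adjoint E * (A * E)"
    have Cc_bisection: "B \<in> carrier_mat k k" unfolding B_def by (intro mult_carrier_mat[OF Ac] mult_carrier_mat[OF Aca Ec])
    obtain c where "c \<in> spectrum B" using spectrum_non_empty[OF Cc_bisection k0] by blast
    then obtain x where x: "x \<in> carrier_vec k" "x \<noteq> 0\<^sub>v k" "B *\<^sub>v x = c \<cdot>\<^sub>v x"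
      using Cc_bisection by (auto simp: spectrum_def eigenvalue_def eigenvector_def)
    define w where "w = E *\<^sub>v x"
    have w: "w \<in> W" unfolding w_def using E x by blast
    have wc: "w \<in> carrier_vec n" by (rule Wc[OF w])
    have Ew: "mat_adjoint E *\<^sub>v w = x"
      unfolding w_def using mult_mat_vec_assoc[OF Ac Ec x(1)] EE x(1) by simp
    have w0: "w \<noteq> 0\<^sub>v n"
    proof
      assume "w = 0\<^sub>v n"
      then have "x = 0\<^sub>v k" using Ew mult_zero_vec[OF Ac] by simp
      then show False using x by simp
    qed
    have "A *\<^sub>v w \<in> W" using W A w by blast
    then have "A *\<^sub>v w = E *\<^sub>v (mat_adjoint E *\<^sub>v (A *\<^sub>v w))" using E by simp
    also have "mat_adjoint E *\<^sub>v (A *\<^sub>v w) = B *\<^sub>v x"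
      unfolding B_def w_def mult_mat_vec_assoc[OF Ac mult_carrier_mat[OF Aca Ec] x(1)]
        mult_mat_vec_assoc[OF Aca Ec x(1)] ..
    also have "E *\<^sub>v (B *\<^sub>v x) = c \<cdot>\<^sub>v w" unfolding x(3) w_def by (rule mult_mat_vec[OF Ec x(1)])
    finally have Aw: "A *\<^sub>v w = c \<cdot>\<^sub>v w" .
    let ?W' = "{w \<in> W. A *\<^sub>v w = c \<cdot>\<^sub>v w}"
    have "?W' = W"
    proof (rule min)
      show "?W' \<subseteq> W" by blast
      show "?inv ?W'"
      proof (intro conjI ballI)
        show "is_subspace n ?W'" unfolding is_subspace_def
        proof (intro conjI ballI allI)
          show "?W' \<subseteq> carrier_vec n" using Wc by blast
          show "0\<^sub>v n \<in> ?W'" using is_subspaceD(2)[OF sW] Aca by (auto intro!: eq_vecI)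
          show "v + v' \<in> ?W'" if "v \<in> ?W'" "v' \<in> ?W'" for v v'
            using that is_subspaceD(3)[OF sW, of v v'] mult_add_distrib_mat_vec[OF Aca Wc Wc, of v v']
              smult_add_distrib_vec[OF Wc Wc, of v v' c] by simp
          show "d \<cdot>\<^sub>v v \<in> ?W'" if "v \<in> ?W'" for d v
            using that is_subspaceD(4)[OF sW, of v d] mult_mat_vec[OF Aca Wc, of v d]
            by (simp add: smult_smult_assoc mult.commute)
        qed
        show "\<exists>w\<in>?W'. w \<noteq> 0\<^sub>v n" using w Aw w0 by blast
        fix C v assume C: "C \<in> S" and v: "v \<in> ?W'"
        have Cc: "C \<in> carrier_mat n n" using S C by blast
        have vc: "v \<in> carrier_vec n" using v Wc by blast
        have "A *\<^sub>v (C *\<^sub>v v) = (A * C) *\<^sub>v v" by (rule mult_mat_vec_assoc[OF Aca Cc vc, symmetric])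
        also have "\<dots> = C *\<^sub>v (A *\<^sub>v v)" unfolding comm[OF A C] by (rule mult_mat_vec_assoc[OF Cc Aca vc])
        also have "\<dots> = c \<cdot>\<^sub>v (C *\<^sub>v v)" using v mult_mat_vec[OF Cc vc] by simp
        finally show "C *\<^sub>v v \<in> ?W'" using W C v by blast
      qed
    qed
    then show ?thesis by blast
  qed
  show ?thesis
    by (rule that[OF Wc[OF w0(1)] w0(2)]) (use scalar w0(1) in blast)
qed

text \<open>
  For the hermitian matrix \<open>Q = A* A\<close> the square of a diagonal entry is at most the
  same diagonal entry of \<open>Q^2\<close>. Iterating, a diagonal entry above one would make the
  powers \<open>Q^(2^k)\<close> unbounded, although the spectral radius is below one. The diagonal
  entries of \<open>Q\<close> dominate the squared entries of \<open>A\<close>.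
\<close>

lemma entries_le_one:
  fixes A :: "complex mat"
  assumes A: "A \<in> carrier_mat n n"
    and ev: "\<And>c v. v \<in> carrier_vec n \<Longrightarrow> v \<noteq> 0\<^sub>v n \<Longrightarrow> (mat_adjoint A * A) *\<^sub>v v = c \<cdot>\<^sub>v v \<Longrightarrow> cmod c < 1"
    and ij: "i < n" "j < n"
  shows "cmod (A $$ (i, j)) \<le> 1"
proof -
  define Q where "Q = mat_adjoint A * A"
  have Q: "Q \<in> carrier_mat n n" unfolding Q_def by (rule mult_carrier_mat[OF mat_adjoint_carrier[OF A] A])
  have Qa: "mat_adjoint Q = Q" unfolding Q_def mat_adjoint_mult[OF mat_adjoint_carrier[OF A] A] by simp
  have n: "0 < n" using ij by simp
  have "spectral_radius Q < 1"
  proof -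
    obtain c where c: "c \<in> spectrum Q" "spectral_radius Q = cmod c"
      using spectral_radius_mem_max(1)[OF Q n] by auto
    then obtain v where "eigenvector Q v c" by (auto simp: spectrum_def eigenvalue_def)
    then show ?thesis using ev[of v c] c(2) A by (simp add: eigenvector_def Q_def)
  qed
  then obtain b where b: "\<And>k. norm_bound (Q ^\<^sub>m k) b"
    using spectral_radius_jnf_norm_bound_less_1_upper_triangular[OF Q] by blast
  have Pc: "Q ^\<^sub>m k \<in> carrier_mat n n" for k using Q by simp
  have Padd: "Q ^\<^sub>m (k + l) = Q ^\<^sub>m k * Q ^\<^sub>m l" for k l
  proof (induction l)
    case 0
    then show ?case using Pc[of k] Q by simp
  next
    case (Suc l)
    then show ?case using assoc_mult_mat[OF Pc[of k] Pc[of l] Q] by simp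
  qed
  have Padj: "mat_adjoint (Q ^\<^sub>m k) = Q ^\<^sub>m k" for k
  proof (induction k)
    case 0
    show ?case by (rule eq_matI) (use Q in auto)
  next
    case (Suc k)
    have "mat_adjoint (Q ^\<^sub>m Suc k) = Q * Q ^\<^sub>m k"
      using mat_adjoint_mult[OF Pc[of k] Q] Suc Qa by simp
    also have "\<dots> = Q ^\<^sub>m Suc k" using Padd[of 1 k] Q by simp
    finally show ?case .
  qed
  have diag: "cmod ((Q ^\<^sub>m k) $$ (j, j)) ^ 2 \<le> cmod ((Q ^\<^sub>m (k + k)) $$ (j, j))" for k
  proof -
    let ?P = "Q ^\<^sub>m k"
    have "(Q ^\<^sub>m (k + k)) $$ (j, j) = (\<Sum>l<n. ?P $$ (j, l) * ?P $$ (l, j))"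
      unfolding Padd by (rule mult_mat_index[OF Pc Pc ij(2) ij(2)])
    also have "\<dots> = (\<Sum>l<n. of_real ((cmod (?P $$ (l, j)))\<^sup>2))"
    proof (rule sum.cong[OF refl])
      fix l assume l: "l \<in> {..<n}"
      have "?P $$ (j, l) = mat_adjoint ?P $$ (j, l)" using Padj by simp
      also have "\<dots> = cnj (?P $$ (l, j))" using Pc[of k] l ij by (intro mat_adjoint_index) auto
      finally show "?P $$ (j, l) * ?P $$ (l, j) = of_real ((cmod (?P $$ (l, j)))\<^sup>2)"
        by (simp add: complex_norm_square mult.commute del: of_real_power)
    qed
    finally have "(Q ^\<^sub>m (k + k)) $$ (j, j) = of_real (\<Sum>l<n. (cmod (?P $$ (l, j)))\<^sup>2)" by simp
    then have "cmod ((Q ^\<^sub>m (k + k)) $$ (j, j)) = \<bar>\<Sum>l<n. (cmod (?P $$ (l, j)))\<^sup>2\<bar>"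
      by (simp only: norm_of_real)
    also have "\<dots> \<ge> (cmod (?P $$ (j, j)))\<^sup>2"
      using member_le_sum[of j "{..<n}" "\<lambda>l. (cmod (?P $$ (l, j)))\<^sup>2"] ij by auto
    finally show ?thesis .
  qed
  let ?q = "cmod (Q $$ (j, j))"
  have pw: "?q ^ (2 ^ k) \<le> cmod ((Q ^\<^sub>m (2 ^ k)) $$ (j, j))" for k
  proof (induction k)
    case 0
    show ?case using Q by simp
  next
    case (Suc k)
    have "?q ^ (2 ^ Suc k) = (?q ^ (2 ^ k))\<^sup>2" by (simp add: power_mult[symmetric] mult.commute)
    also have "\<dots> \<le> (cmod ((Q ^\<^sub>m (2 ^ k)) $$ (j, j)))\<^sup>2" by (intro power_mono Suc) simp
    also have "\<dots> \<le> cmod ((Q ^\<^sub>m (2 ^ k + 2 ^ k)) $$ (j, j))" by (rule diag)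
    finally show ?case by (simp add: mult_2)
  qed
  have q1: "?q \<le> 1"
  proof (rule ccontr)
    assume "\<not> ?q \<le> 1"
    then obtain k where k: "b < ?q ^ k" using real_arch_pow[of ?q b] by auto
    have "?q ^ k \<le> ?q ^ (2 ^ k)" using \<open>\<not> ?q \<le> 1\<close> by (intro power_increasing) (auto simp: less_imp_le)
    also have "\<dots> \<le> cmod ((Q ^\<^sub>m (2 ^ k)) $$ (j, j))" by (rule pw)
    also have "\<dots> \<le> b" using b[of "2 ^ k"] Q ij by (simp add: norm_bound_def)
    finally show False using k by simp
  qed
  have "Q $$ (j, j) = (\<Sum>l<n. mat_adjoint A $$ (j, l) * A $$ (l, j))"
    unfolding Q_def by (rule mult_mat_index) (use A ij in auto)
  also have "\<dots> = (\<Sum>l<n. of_real ((cmod (A $$ (l, j)))\<^sup>2))"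
    using A ij by (intro sum.cong refl) (simp add: complex_norm_square mult.commute del: of_real_power)
  finally have "Q $$ (j, j) = of_real (\<Sum>l<n. (cmod (A $$ (l, j)))\<^sup>2)" by simp
  then have "?q = \<bar>\<Sum>l<n. (cmod (A $$ (l, j)))\<^sup>2\<bar>" by (simp only: norm_of_real)
  then have "(cmod (A $$ (i, j)))\<^sup>2 \<le> 1"
    using q1 member_le_sum[of i "{..<n}" "\<lambda>l. (cmod (A $$ (l, j)))\<^sup>2"] ij by auto
  then show ?thesis by (simp add: power2_le_iff_abs_le abs_square_le_1)
qed

section \<open>Continuity of finite-dimensional representations\<close>

context etale_gpd
begin

text \<open>
  The partial sums of the series \<open>f + f^2 + f^3 + \<dots>\<close>, in Horner form, so that
  the estimates below follow by induction from bilinearity of the convolution.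
\<close>

primrec neumann :: "('g \<Rightarrow> complex) \<Rightarrow> nat \<Rightarrow> 'g \<Rightarrow> complex" where
  "neumann f 0 = (\<lambda>a. 0)"
| "neumann f (Suc j) = (\<lambda>a. f a + conv G (neumann f j) f a)"

lemma neumann_Cc: "f \<in> Cc G \<Longrightarrow> neumann f j \<in> Cc G"
  by (induction j) (auto intro: Cc_zero Cc_add Cc_conv)

context
  fixes r :: real
  assumes r: "0 \<le> r" "r < 1"
begin

lemma neumann_bound:
  assumes f: "f \<in> Cc G" "fnorm f \<le> r"
  shows "fnorm (neumann f j) \<le> 1 / (1 - r)"
proof (induction j)
  case 0
  show ?case using r by (simp add: fnorm_zero)
next
  case (Suc j)
  have "fnorm (neumann f (Suc j)) \<le> fnorm f + fnorm (conv G (neumann f j) f)"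
    by (simp, intro fnorm_add Cc_conv neumann_Cc f)
  also have "\<dots> \<le> fnorm f + fnorm (neumann f j) * fnorm f" by (intro add_left_mono fnorm_mult neumann_Cc f)
  also have "\<dots> \<le> r + 1 / (1 - r) * r"
    using r by (intro add_mono mult_mono Suc f fnorm_nonneg) auto
  also have "\<dots> \<le> 1 / (1 - r)"
  proof -
    have "r * (1 - r) + r \<le> 1" using zero_le_square[of "1 - r"] by (simp add: algebra_simps)
    then have "(r * (1 - r) + r) / (1 - r) \<le> 1 / (1 - r)" using r by (intro divide_right_mono) auto
    moreover have "(r * (1 - r) + r) / (1 - r) = r + 1 / (1 - r) * r" using r by (simp add: add_divide_distrib)
    ultimately show ?thesis by simp
  qed
  finally show ?case .
qed

lemma neumann_step:
  assumes f: "f \<in> Cc G" "fnorm f \<le> r"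
  shows "fnorm (\<lambda>a. neumann f (j + i) a - neumann f j a) \<le> 1 / (1 - r) * r ^ j"
proof (induction j)
  case 0
  show ?case using neumann_bound[OF f, of i] by simp
next
  case (Suc j)
  have "fnorm (\<lambda>a. neumann f (Suc j + i) a - neumann f (Suc j) a) =
      fnorm (conv G (\<lambda>a. neumann f (j + i) a - neumann f j a) f)"
    by (simp add: conv_diff_left neumann_Cc f)
  also have "\<dots> \<le> fnorm (\<lambda>a. neumann f (j + i) a - neumann f j a) * fnorm f"
    by (intro fnorm_mult Cc_diff neumann_Cc f)
  also have "\<dots> \<le> 1 / (1 - r) * r ^ j * r"
    using r by (intro mult_mono Suc f fnorm_nonneg) auto
  finally show ?case by (simp add: mult_ac)
qed

lemma neumann_lipschitz:
  assumes f: "f \<in> Cc G" "fnorm f \<le> r" and g: "g \<in> Cc G" "fnorm g \<le> r"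
  shows "fnorm (\<lambda>a. neumann f j a - neumann g j a) \<le> (1 + 1 / (1 - r)) / (1 - r) * fnorm (\<lambda>a. f a - g a)"
proof (induction j)
  case 0
  show ?case using r fnorm_nonneg[OF Cc_diff[OF f(1) g(1)]] by (simp add: fnorm_zero)
next
  case (Suc j)
  let ?d = "fnorm (\<lambda>a. f a - g a)" and ?C = "1 / (1 - r)"
  let ?D = "(1 + ?C) / (1 - r)"
  have d0: "0 \<le> ?d" by (rule fnorm_nonneg[OF Cc_diff[OF f(1) g(1)]])
  have "fnorm (\<lambda>a. neumann f (Suc j) a - neumann g (Suc j) a) =
      fnorm (\<lambda>a. (f a - g a) + (conv G (neumann f j) f a - conv G (neumann g j) g a))"
    by (simp add: algebra_simps)
  also have "\<dots> \<le> ?d + fnorm (\<lambda>a. conv G (neumann f j) f a - conv G (neumann g j) g a)"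
    by (intro fnorm_add Cc_diff Cc_conv neumann_Cc f g)
  also have "fnorm (\<lambda>a. conv G (neumann f j) f a - conv G (neumann g j) g a) \<le>
      fnorm (\<lambda>a. neumann f j a - neumann g j a) * fnorm f + fnorm (neumann g j) * ?d"
    by (intro fnorm_conv_diff neumann_Cc f g)
  also have "fnorm (\<lambda>a. neumann f j a - neumann g j a) * fnorm f + fnorm (neumann g j) * ?d \<le> (?D * ?d) * r + ?C * ?d"
    using r d0 by (intro add_mono mult_mono Suc f neumann_bound g fnorm_nonneg Cc_diff) auto
  also have "?d + ((?D * ?d) * r + ?C * ?d) = ?D * ?d"
  proof -
    have "(1 + ?C) + ?D * r = ?D" using r by (simp add: divide_simps) (simp add: algebra_simps)
    then have "((1 + ?C) + ?D * r) * ?d = ?D * ?d" by (rule arg_cong)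
    then show ?thesis by (simp only: algebra_simps)
  qed
  finally show ?case by simp
qed

end

text \<open>
  The diagonal sequence \<open>neumann (u m) m\<close> represents the sum \<open>c\<close> of the
  Neumann series of the class \<open>b\<close> of \<open>u\<close>, so that \<open>c = b + c
  b\<close>.
\<close>

lemma neumann_solution:
  assumes u: "u \<in> cauchy_seqs G" and r: "0 \<le> r" "r < 1" and le: "\<And>m. m \<ge> M \<Longrightarrow> fnorm (u m) \<le> r"
  obtains w where "w \<in> cauchy_seqs G" "cclass w = cclass (\<lambda>m a. u m a + conv G (w m) (u m) a)"
proof -
  define w where "w m = neumann (u m) m" for m
  (* D is the Lipschitz constant of the partial sums on the ball of radius r. *)
  define D where "D = (1 + 1 / (1 - r)) / (1 - r)"
  let ?C = "1 / (1 - r)"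
  note uC = cauchyD(1)[OF u]
  have wC: "w m \<in> Cc G" for m unfolding w_def by (rule neumann_Cc[OF uC])
  have rp: "(\<lambda>m. ?C * r ^ m) \<longlonglongrightarrow> 0"
    using r by (intro tendsto_mult_right_zero LIMSEQ_power_zero) auto
  have cs: "w \<in> cauchy_seqs G"
  proof (rule cauchyI[OF wC])
    fix e :: real assume e: "e > 0"
    have D: "D > 0" unfolding D_def using r by (intro divide_pos_pos add_pos_nonneg) auto
    obtain M1 where M1: "\<forall>m\<ge>M1. \<forall>k\<ge>M1. fnorm (\<lambda>a. u m a - u k a) < e / (2 * D)"
      using cauchyD(2)[OF u, of "e / (2 * D)"] e D by auto
    obtain M2 where M2: "\<forall>m\<ge>M2. ?C * r ^ m < e / 2"
      using order_tendstoD(2)[OF rp, of "e / 2"] e by (auto simp: eventually_sequentially)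
    have lt: "fnorm (\<lambda>a. w m a - w k a) < e" if mk: "m \<ge> max M (max M1 M2)" "k \<ge> m" for m k
    proof -
      have km: "k = m + (k - m)" using mk by simp
      have "fnorm (\<lambda>a. w k a - w m a) \<le> fnorm (\<lambda>a. w k a - neumann (u k) m a) + fnorm (\<lambda>a. neumann (u k) m a - w m a)"
        by (intro fnorm_triangle wC neumann_Cc uC)
      also have "fnorm (\<lambda>a. w k a - neumann (u k) m a) \<le> ?C * r ^ m"
        using neumann_step[OF r uC[of k] le, of m "k - m"] mk km by (simp add: w_def)
      also have "?C * r ^ m < e / 2" using M2 mk by simp
      also have "fnorm (\<lambda>a. neumann (u k) m a - w m a) \<le> D * fnorm (\<lambda>a. u k a - u m a)"
        unfolding w_def D_def by (rule neumann_lipschitz[OF r uC le uC le]) (use mk in auto)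
      also have "D * fnorm (\<lambda>a. u k a - u m a) \<le> D * (e / (2 * D))"
        using M1 mk D by (intro mult_left_mono) (auto intro: less_imp_le)
      also have "D * (e / (2 * D)) = e / 2" using D by simp
      finally have "fnorm (\<lambda>a. w k a - w m a) < e" by simp
      then show ?thesis using fnorm_minus_commute[OF wC wC] by metis
    qed
    have "fnorm (\<lambda>a. w m a - w k a) < e" if "m \<ge> max M (max M1 M2)" "k \<ge> max M (max M1 M2)" for m k
      using lt[OF that(1), of k] lt[OF that(2), of m] fnorm_minus_commute[OF wC[of m] wC[of k]] by (cases "m \<le> k") auto
    then show "\<exists>M. \<forall>m\<ge>M. \<forall>k\<ge>M. fnorm (\<lambda>a. w m a - w k a) < e" by blast
  qed
  have "cclass w = cclass (\<lambda>m a. u m a + conv G (w m) (u m) a)"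
  proof (rule cclass_eqI[OF cs cauchy_add[OF u cauchy_mult[OF cs u]]])
    have ge: "0 \<le> fnorm (\<lambda>a. w m a - (u m a + conv G (w m) (u m) a))" for m
      by (intro fnorm_nonneg Cc_diff Cc_add Cc_conv wC uC)
    have "fnorm (\<lambda>a. w m a - (u m a + conv G (w m) (u m) a)) \<le> ?C * r ^ m" if "m \<ge> M" for m
    proof -
      have "fnorm (\<lambda>a. w m a - neumann (u m) (m + 1) a) = fnorm (\<lambda>a. neumann (u m) (m + 1) a - neumann (u m) m a)"
        unfolding w_def by (rule fnorm_minus_commute) (intro neumann_Cc uC)+
      then show ?thesis using neumann_step[OF r uC[of m] le[OF that], of m 1] by (simp add: w_def)
    qed
    then have "\<forall>\<^sub>F m in sequentially. fnorm (\<lambda>a. w m a - (u m a + conv G (w m) (u m) a)) \<le> ?C * r ^ m"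
      by (auto simp: eventually_sequentially)
    then show "(\<lambda>m. fnorm (\<lambda>a. w m a - (u m a + conv G (w m) (u m) a))) \<longlonglongrightarrow> 0"
      by (intro tendsto_sandwich[OF _ _ tendsto_const rp]) (auto simp: ge)
  qed
  then show ?thesis by (rule that[OF cs])
qed

end

locale etale_rep = etale_gpd G for G :: "'g::{t2_space, second_countable_topology} groupoid" +
  fixes N :: nat and \<pi> :: "'g cstar_elem \<Rightarrow> complex mat"
  assumes rep: "cstar_rep G N \<pi>"
begin

lemma pi_carrier: "u \<in> cauchy_seqs G \<Longrightarrow> \<pi> (cclass u) \<in> carrier_mat N N"
  and pi_add: "u \<in> cauchy_seqs G \<Longrightarrow> v \<in> cauchy_seqs G \<Longrightarrow> \<pi> (cclass (\<lambda>m a. u m a + v m a)) = \<pi> (cclass u) + \<pi> (cclass v)"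
  and pi_scale: "u \<in> cauchy_seqs G \<Longrightarrow> \<pi> (cclass (\<lambda>m a. c * u m a)) = c \<cdot>\<^sub>m \<pi> (cclass u)"
  and pi_mult: "u \<in> cauchy_seqs G \<Longrightarrow> v \<in> cauchy_seqs G \<Longrightarrow> \<pi> (cclass (\<lambda>m. conv G (u m) (v m))) = \<pi> (cclass u) * \<pi> (cclass v)"
  and pi_star: "u \<in> cauchy_seqs G \<Longrightarrow> \<pi> (cclass (\<lambda>m. star G (u m))) = mat_adjoint (\<pi> (cclass u))"
proof -
  have C: "\<And>A. A \<in> Cstar G \<Longrightarrow> \<pi> A \<in> carrier_mat N N"
    and A: "\<And>A B. A \<in> Cstar G \<Longrightarrow> B \<in> Cstar G \<Longrightarrow> \<pi> (cstar_add G A B) = \<pi> A + \<pi> B"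
    and S: "\<And>A c. A \<in> Cstar G \<Longrightarrow> \<pi> (cstar_scale G c A) = c \<cdot>\<^sub>m \<pi> A"
    and M: "\<And>A B. A \<in> Cstar G \<Longrightarrow> B \<in> Cstar G \<Longrightarrow> \<pi> (cstar_mult G A B) = \<pi> A * \<pi> B"
    and T: "\<And>A. A \<in> Cstar G \<Longrightarrow> \<pi> (cstar_star G A) = mat_adjoint (\<pi> A)"
    using rep unfolding cstar_rep_def by blast+
  show "\<pi> (cclass u) \<in> carrier_mat N N" if "u \<in> cauchy_seqs G" for u
    by (rule C[OF cclass_Cstar[OF that]])
  show "\<pi> (cclass (\<lambda>m a. u m a + v m a)) = \<pi> (cclass u) + \<pi> (cclass v)" if "u \<in> cauchy_seqs G" "v \<in> cauchy_seqs G" for u v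
    using A[OF that[THEN cclass_Cstar]] unfolding cstar_add_cclass[OF that] .
  show "\<pi> (cclass (\<lambda>m a. c * u m a)) = c \<cdot>\<^sub>m \<pi> (cclass u)" if "u \<in> cauchy_seqs G" for u
    using S[OF cclass_Cstar[OF that]] unfolding cstar_scale_cclass[OF that] .
  show "\<pi> (cclass (\<lambda>m. conv G (u m) (v m))) = \<pi> (cclass u) * \<pi> (cclass v)" if "u \<in> cauchy_seqs G" "v \<in> cauchy_seqs G" for u v
    using M[OF that[THEN cclass_Cstar]] unfolding cstar_mult_cclass[OF that] .
  show "\<pi> (cclass (\<lambda>m. star G (u m))) = mat_adjoint (\<pi> (cclass u))" if "u \<in> cauchy_seqs G" for u
    using T[OF cclass_Cstar[OF that]] unfolding cstar_star_cclass[OF that] .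
qed

text \<open>
  If \<open>|c| \<ge> 1\<close>, then \<open>b = u / c\<close> still has norm below one and
  \<open>\<pi> b\<close> fixes \<open>v\<close>. Applying \<open>\<pi>\<close> to the Neumann
  equation \<open>w = b + w b\<close> and evaluating at \<open>v\<close> gives \<open>\<pi> w v =
  v + \<pi> w v\<close>, hence \<open>v = 0\<close>.
\<close>

lemma eigenvalue_lt_one:
  assumes u: "u \<in> cauchy_seqs G" and r: "0 \<le> r" "r < 1" and le: "\<And>m. m \<ge> M \<Longrightarrow> fnorm (u m) \<le> r"
    and v: "v \<in> carrier_vec N" "v \<noteq> 0\<^sub>v N" "\<pi> (cclass u) *\<^sub>v v = c \<cdot>\<^sub>v v"
  shows "cmod c < 1"
proof (rule ccontr)
  assume "\<not> cmod c < 1"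
  then have c: "cmod c \<ge> 1" "c \<noteq> 0" by auto
  define b where "b m a = (1 / c) * u m a" for m a
  have b_eq: "b = (\<lambda>m a. (1 / c) * u m a)" by (simp add: b_def fun_eq_iff)
  have b: "b \<in> cauchy_seqs G" unfolding b_eq by (rule cauchy_scale[OF u])
  have ble: "fnorm (b m) \<le> r" if "m \<ge> M" for m
  proof -
    have "fnorm (b m) \<le> cmod (1 / c) * fnorm (u m)"
      unfolding b_eq by (rule fnorm_scale[OF cauchyD(1)[OF u]])
    also have "\<dots> \<le> 1 * fnorm (u m)"
      using c by (intro mult_right_mono fnorm_nonneg cauchyD(1)[OF u]) (simp add: norm_divide)
    finally show ?thesis using le[OF that] by simp
  qed
  obtain w where w: "w \<in> cauchy_seqs G" "cclass w = cclass (\<lambda>m a. b m a + conv G (w m) (b m) a)"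
    by (rule neumann_solution[OF b r ble]) blast+
  have Q: "\<pi> (cclass b) \<in> carrier_mat N N" and P: "\<pi> (cclass w) \<in> carrier_mat N N" by (rule pi_carrier[OF b], rule pi_carrier[OF w(1)])
  have Qv: "\<pi> (cclass b) *\<^sub>v v = v"
  proof -
    have "\<pi> (cclass b) = (1 / c) \<cdot>\<^sub>m \<pi> (cclass u)" unfolding b_eq by (rule pi_scale[OF u])
    then have "\<pi> (cclass b) *\<^sub>v v = (1 / c) \<cdot>\<^sub>v (\<pi> (cclass u) *\<^sub>v v)"
      using pi_carrier[OF u] v(1) by (intro eq_vecI) auto
    then show ?thesis unfolding v(3) using c by (simp add: smult_smult_assoc)
  qed
  have "\<pi> (cclass w) = \<pi> (cclass b) + \<pi> (cclass w) * \<pi> (cclass b)"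
    using arg_cong[OF w(2), of \<pi>] pi_add[OF b cauchy_mult[OF w(1) b]] pi_mult[OF w(1) b] by simp
  then have "\<pi> (cclass w) *\<^sub>v v = (\<pi> (cclass b) + \<pi> (cclass w) * \<pi> (cclass b)) *\<^sub>v v" by simp
  also have "\<dots> = \<pi> (cclass b) *\<^sub>v v + (\<pi> (cclass w) * \<pi> (cclass b)) *\<^sub>v v"
    by (rule add_mult_distrib_mat_vec[OF Q mult_carrier_mat[OF P Q] v(1)])
  also have "\<dots> = v + \<pi> (cclass w) *\<^sub>v v"
    unfolding mult_mat_vec_assoc[OF P Q v(1)] Qv ..
  finally have *: "\<pi> (cclass w) *\<^sub>v v = v + \<pi> (cclass w) *\<^sub>v v" .
  have "v = 0\<^sub>v N"
  proof (rule eq_vecI)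
    fix i assume i: "i < dim_vec (0\<^sub>v N :: complex vec)"
    have "vec_index (\<pi> (cclass w) *\<^sub>v v) i = vec_index v i + vec_index (\<pi> (cclass w) *\<^sub>v v) i"
      by (subst (1) *) (use i v(1) P in auto)
    then show "vec_index v i = vec_index (0\<^sub>v N) i" using i by simp
  qed (use v in auto)
  then show False using v(2) by simp
qed

text \<open>
  Automatic continuity: a *-homomorphism on the completion is only assumed to be algebraic, but
  the eigenvalues of \<open>\<pi> (b* b) = \<pi> b* \<pi> b\<close> are controlled by the norm,
  and they control the entries of \<open>\<pi> b\<close>. The factor one half leaves room for a
  strict inequality.
\<close>

lemma pi_entry_le:
  assumes u: "u \<in> cauchy_seqs G" and e: "0 < e" and le: "\<And>m. m \<ge> M \<Longrightarrow> fnorm (u m) \<le> e / 2"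
    and ij: "i < N" "j < N"
  shows "cmod (\<pi> (cclass u) $$ (i, j)) \<le> e"
proof -
  (* The rescaled sequence b has norms at most 1/2, so the norms of b* b are at most 1/4. *)
  define b where "b m a = of_real (1 / e) * u m a" for m a
  have b_eq: "b = (\<lambda>m a. of_real (1 / e) * u m a)" by (simp add: b_def fun_eq_iff)
  have b: "b \<in> cauchy_seqs G" unfolding b_eq by (rule cauchy_scale[OF u])
  note bC = cauchyD(1)[OF b]
  have ble: "fnorm (b m) \<le> 1 / 2" if "m \<ge> M" for m
  proof -
    have "fnorm (b m) \<le> cmod (of_real (1 / e)) * fnorm (u m)"
      unfolding b_eq by (rule fnorm_scale[OF cauchyD(1)[OF u]])
    also have "\<dots> \<le> cmod (of_real (1 / e)) * (e / 2)" by (intro mult_left_mono le that) simp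
    finally show ?thesis using e by (simp add: norm_divide)
  qed
  let ?s = "\<lambda>m. conv G (star G (b m)) (b m)"
  have s: "?s \<in> cauchy_seqs G" by (rule cauchy_mult[OF cauchy_star[OF b] b])
  have sle: "fnorm (?s m) \<le> 1 / 4" if "m \<ge> M" for m
  proof -
    have "fnorm (?s m) \<le> fnorm (star G (b m)) * fnorm (b m)" by (intro fnorm_mult Cc_star bC)
    also have "\<dots> \<le> (1 / 2) * (1 / 2)"
      using fnorm_star[OF bC[of m]] ble[OF that] by (intro mult_mono fnorm_nonneg bC) auto
    finally show ?thesis by simp
  qed
  have P: "\<pi> (cclass b) \<in> carrier_mat N N" by (rule pi_carrier[OF b])
  have Q: "mat_adjoint (\<pi> (cclass b)) * \<pi> (cclass b) = \<pi> (cclass ?s)"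
    using pi_mult[OF cauchy_star[OF b] b] pi_star[OF b] by simp
  have "cmod (\<pi> (cclass b) $$ (i, j)) \<le> 1"
  proof (rule entries_le_one[OF P _ ij])
    fix c v assume "v \<in> carrier_vec N" "v \<noteq> 0\<^sub>v N" "(mat_adjoint (\<pi> (cclass b)) * \<pi> (cclass b)) *\<^sub>v v = c \<cdot>\<^sub>v v"
    then show "cmod c < 1" unfolding Q by (intro eigenvalue_lt_one[OF s _ _ sle]) auto
  qed
  moreover have "\<pi> (cclass b) = of_real (1 / e) \<cdot>\<^sub>m \<pi> (cclass u)" unfolding b_eq by (rule pi_scale[OF u])
  ultimately show ?thesis using e ij pi_carrier[OF u] by (simp add: norm_mult norm_divide)
qed

definition rep_Cc :: "('g \<Rightarrow> complex) \<Rightarrow> complex mat" where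
  "rep_Cc f = \<pi> (cclass (\<lambda>m. f))"

lemma rep_Cc:
  shows rep_Cc_carrier: "f \<in> Cc G \<Longrightarrow> rep_Cc f \<in> carrier_mat N N"
    and rep_Cc_add: "f \<in> Cc G \<Longrightarrow> g \<in> Cc G \<Longrightarrow> rep_Cc (\<lambda>a. f a + g a) = rep_Cc f + rep_Cc g"
    and rep_Cc_scale: "f \<in> Cc G \<Longrightarrow> rep_Cc (\<lambda>a. c * f a) = c \<cdot>\<^sub>m rep_Cc f"
    and rep_Cc_mult: "f \<in> Cc G \<Longrightarrow> g \<in> Cc G \<Longrightarrow> rep_Cc (conv G f g) = rep_Cc f * rep_Cc g"
    and rep_Cc_star: "f \<in> Cc G \<Longrightarrow> rep_Cc (star G f) = mat_adjoint (rep_Cc f)"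
  unfolding rep_Cc_def by (intro pi_carrier pi_add pi_scale pi_mult pi_star cauchy_const; assumption)+

text \<open>
  Continuity of \<open>\<pi>\<close> determines it by its values on \<open>Cc G\<close>.
\<close>

lemma rep_Cc_tendsto:
  assumes u: "u \<in> cauchy_seqs G" and ij: "i < N" "j < N"
  shows "(\<lambda>m. rep_Cc (u m) $$ (i, j)) \<longlonglongrightarrow> \<pi> (cclass u) $$ (i, j)"
proof (rule LIMSEQ_I)
  fix e :: real assume e: "0 < e"
  obtain M where M: "\<forall>m\<ge>M. \<forall>k\<ge>M. fnorm (\<lambda>a. u m a - u k a) < e / 4"
    using cauchyD(2)[OF u, of "e / 4"] e by auto
  have "norm (rep_Cc (u m) $$ (i, j) - \<pi> (cclass u) $$ (i, j)) < e" if m: "m \<ge> M" for m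
  proof -
    have cm: "(\<lambda>k. u m) \<in> cauchy_seqs G" by (rule cauchy_const[OF cauchyD(1)[OF u]])
    have cm': "(\<lambda>k a. (-1) * u m a) \<in> cauchy_seqs G" by (rule cauchy_scale[OF cm])
    have cd: "(\<lambda>k a. u k a + (-1) * u m a) \<in> cauchy_seqs G" by (rule cauchy_add[OF u cm'])
    have "cmod (\<pi> (cclass (\<lambda>k a. u k a + (-1) * u m a)) $$ (i, j)) \<le> e / 2"
      by (rule pi_entry_le[OF cd _ _ ij, of _ M]) (use e M m in \<open>auto intro: less_imp_le\<close>)
    moreover have "\<pi> (cclass (\<lambda>k a. u k a + (-1) * u m a)) = \<pi> (cclass u) + (-1) \<cdot>\<^sub>m rep_Cc (u m)"
      unfolding rep_Cc_def pi_add[OF u cm'] pi_scale[OF cm] ..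
    moreover have "rep_Cc (u m) \<in> carrier_mat N N" by (rule rep_Cc_carrier[OF cauchyD(1)[OF u]])
    ultimately have "cmod (\<pi> (cclass u) $$ (i, j) - rep_Cc (u m) $$ (i, j)) \<le> e / 2"
      using ij pi_carrier[OF u] by simp
    then show ?thesis using e by (simp add: norm_minus_commute)
  qed
  then show "\<exists>M. \<forall>m\<ge>M. norm (rep_Cc (u m) $$ (i, j) - \<pi> (cclass u) $$ (i, j)) < e" by blast
qed

end

section \<open>Representations of the convolution algebra\<close>

text \<open>
  Polarized form of the isometry condition, read off on pairs of unit vectors.
\<close>

lemma isometryI:
  assumes M: "M \<in> carrier_mat n k"
    and ip: "\<And>x y. x \<in> carrier_vec k \<Longrightarrow> y \<in> carrier_vec k \<Longrightarrow> ip (M *\<^sub>v x) (M *\<^sub>v y) = ip x y"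
  shows "isometry n k M"
proof -
  have A: "mat_adjoint M \<in> carrier_mat k n" using M by simp
  have "mat_adjoint M * M = 1\<^sub>m k"
  proof (rule eq_matI)
    fix i j assume "i < dim_row (1\<^sub>m k :: complex mat)" "j < dim_col (1\<^sub>m k :: complex mat)"
    then have ij: "i < k" "j < k" by auto
    let ?e = "unit_vec k :: nat \<Rightarrow> complex vec"
    have "(mat_adjoint M * M) $$ (i, j) = vec_index ((mat_adjoint M * M) *\<^sub>v ?e j) i"
      by (rule mult_unit_vec_index[OF mult_carrier_mat[OF A M] ij, symmetric])
    also have "\<dots> = vec_index (mat_adjoint M *\<^sub>v (M *\<^sub>v ?e j)) i"
      by (subst mult_mat_vec_assoc[OF A M]) auto
    also have "\<dots> = cnj (ip (?e i) (mat_adjoint M *\<^sub>v (M *\<^sub>v ?e j)))"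
    proof -
      have c: "mat_adjoint M *\<^sub>v (M *\<^sub>v ?e j) \<in> carrier_vec k"
        by (intro mult_mat_vec_carrier[OF A] mult_mat_vec_carrier[OF M] unit_vec_carrier)
      have "ip (?e i) w = cnj (vec_index w i)" if "w \<in> carrier_vec k" for w
      proof -
        have "ip (?e i) w = (\<Sum>l<k. (if l = i then cnj (vec_index w l) else 0))"
          unfolding ip_eq[OF that] by (intro sum.cong refl) (use ij in auto)
        then show ?thesis using ij by simp
      qed
      from this[OF c] show ?thesis by simp
    qed
    also have "ip (?e i) (mat_adjoint M *\<^sub>v (M *\<^sub>v ?e j)) = ip (M *\<^sub>v ?e i) (M *\<^sub>v ?e j)"
      by (rule ip_adjoint[OF M, symmetric]) (use M in auto)
    also have "\<dots> = ip (?e i) (?e j)" by (rule ip) auto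
    also have "cnj \<dots> = 1\<^sub>m k $$ (i, j)"
    proof -
      have "ip (?e i) (?e j) = (\<Sum>l<k. if l = i then (if i = j then 1 else 0) else 0)"
        unfolding ip_eq[OF unit_vec_carrier] by (intro sum.cong refl) (use ij in auto)
      then show ?thesis using ij by simp
    qed
    finally show "(mat_adjoint M * M) $$ (i, j) = 1\<^sub>m k $$ (i, j)" .
  qed (use M in auto)
  then show ?thesis using M by (simp add: isometry_def)
qed

lemma isometry_ip:
  assumes M: "isometry n k M" and x: "x \<in> carrier_vec k" and y: "y \<in> carrier_vec k"
  shows "ip (M *\<^sub>v x) (M *\<^sub>v y) = ip x y"
proof -
  have Mc: "M \<in> carrier_mat n k" and MM: "mat_adjoint M * M = 1\<^sub>m k" using M by (auto simp: isometry_def)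
  have "ip (M *\<^sub>v x) (M *\<^sub>v y) = ip x (mat_adjoint M *\<^sub>v (M *\<^sub>v y))"
    by (rule ip_adjoint[OF Mc x mult_mat_vec_carrier[OF Mc y]])
  also have "mat_adjoint M *\<^sub>v (M *\<^sub>v y) = (mat_adjoint M * M) *\<^sub>v y"
    by (rule mult_mat_vec_assoc[OF mat_adjoint_carrier[OF Mc] Mc y, symmetric])
  finally show ?thesis using MM y by simp
qed

lemma zero_smult: "v \<in> carrier_vec n \<Longrightarrow> (0 :: complex) \<cdot>\<^sub>v v = 0\<^sub>v n"
  by (intro eq_vecI) auto

lemma smult_cancel:
  "v \<in> carrier_vec n \<Longrightarrow> c \<cdot>\<^sub>v v + (- c :: complex) \<cdot>\<^sub>v v = 0\<^sub>v n"
  by (intro eq_vecI) auto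

lemma vec_eqI_diff:
  fixes v w :: "complex vec"
  assumes v: "v \<in> carrier_vec n" and w: "w \<in> carrier_vec n" and z: "v + (-1) \<cdot>\<^sub>v w = 0\<^sub>v n"
  shows "v = w"
proof (rule eq_vecI)
  fix i assume "i < dim_vec w"
  then have i: "i < n" using w by simp
  have "vec_index (v + (-1) \<cdot>\<^sub>v w) i = 0" unfolding z using i by simp
  then show "vec_index v i = vec_index w i" using i v w by simp
qed (use v w in simp)

lemma mat_eqI_vec:
  fixes A B :: "complex mat"
  assumes A: "A \<in> carrier_mat m n" and B: "B \<in> carrier_mat m n"
    and eq: "\<And>x. x \<in> carrier_vec n \<Longrightarrow> A *\<^sub>v x = B *\<^sub>v x"
  shows "A = B"
proof (rule eq_matI)
  fix i j assume "i < dim_row B" "j < dim_col B"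
  then have ij: "i < m" "j < n" using B by auto
  show "A $$ (i, j) = B $$ (i, j)"
    using mult_unit_vec_index[OF A ij] mult_unit_vec_index[OF B ij] eq[of "unit_vec n j"] by simp
qed (use A B in auto)

lemma sum_blocks:
  fixes f :: "nat \<Rightarrow> complex"
  shows "(\<Sum>r<n * d. f r) = (\<Sum>i<n. \<Sum>k<d. f (i * d + k))"
proof -
  have "(\<Sum>r<n * d. f r) = (\<Sum>i<n. sum f {i * d..<i * d + d})" by (rule sum.nat_group[symmetric])
  also have "\<dots> = (\<Sum>i<n. \<Sum>k<d. f (i * d + k))"
  proof (rule sum.cong[OF refl])
    fix i
    show "sum f {i * d..<i * d + d} = (\<Sum>k<d. f (i * d + k))"
      using sum.atLeastLessThan_shift_0[of f "i * d" "i * d + d"] by (simp add: atLeast0LessThan comp_def add.commute)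
  qed
  finally show ?thesis .
qed

context etale_gpd
begin

lemma Cc_units_bump:
  assumes x: "x \<in> units G" and O: "open U" "x \<in> U"
  obtains h where "h \<in> Cc_units" "h x = 1" "\<And>a. a \<notin> U \<Longrightarrow> h a = 0" "star G h = h"
proof -
  have "open (U \<inter> units G)" "x \<in> U \<inter> units G" using x O open_units by auto
  then obtain \<phi> :: "'g \<Rightarrow> real" where \<phi>: "continuous_on UNIV \<phi>" "\<phi> x = 1"
    "compact (closure {a. \<phi> a \<noteq> 0})" "closure {a. \<phi> a \<noteq> 0} \<subseteq> U \<inter> units G"
    by (rule bump_function[OF loc_compact]) blast
  have z: "\<phi> a = 0" if "a \<notin> U \<inter> units G" for a
    using subsetD[OF closure_subset, of a "{a. \<phi> a \<noteq> 0}"] \<phi>(4) that by blast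
  let ?h = "\<lambda>a. complex_of_real (\<phi> a)"
  have h: "?h \<in> Cc_units"
  proof (rule Cc_unitsI)
    show "?h \<in> Cc G" using \<phi>(1,3) by (auto simp: Cc_def intro: continuous_on_of_real)
    show "?h a = 0" if "a \<notin> units G" for a using z[of a] that by simp
  qed
  show ?thesis
  proof (rule that[OF h])
    show "?h a = 0" if "a \<notin> U" for a using z[of a] that by simp
    show "star G ?h = ?h" unfolding star_Cc_units[OF h] by simp
  qed (simp add: \<phi>(2))
qed

text \<open>
  Near the source fibre of \<open>g\<close> such a function behaves like the point mass at
  \<open>g\<close>; only the values on that fibre matter for vectors living over \<open>src G
  g\<close>.
\<close>

definition delta_at :: "'g \<Rightarrow> ('g \<Rightarrow> complex) \<Rightarrow> bool" where
  "delta_at g f \<longleftrightarrow> f \<in> Cc G \<and> (\<forall>a. src G a = src G g \<longrightarrow> f a = (if a = g then 1 else 0))"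

text \<open>
  A bump function supported in a bisection around \<open>g\<close> isolates \<open>g\<close> in
  its source fibre and in its range fibre. The second fact makes the adjoint a point mass at the
  inverse arrow.
\<close>

lemma delta_exists:
  "\<exists>f. delta_at g f \<and> delta_at (ginv G g) (star G f)"
proof -
  obtain U where U: "bisection U" "g \<in> U" by (rule bisection_at)
  have oU: "open U" "inj_on (src G) U" "inj_on (tgt G) U" using U by (auto simp: bisection_def)
  obtain \<phi> :: "'g \<Rightarrow> real" where \<phi>: "continuous_on UNIV \<phi>" "\<phi> g = 1"
    "compact (closure {a. \<phi> a \<noteq> 0})" "closure {a. \<phi> a \<noteq> 0} \<subseteq> U"
    by (rule bump_function[OF loc_compact oU(1) U(2)]) blast
  have z: "a \<in> U" if "\<phi> a \<noteq> 0" for a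
    using subsetD[OF closure_subset, of a "{a. \<phi> a \<noteq> 0}"] \<phi>(4) that by blast
  let ?f = "\<lambda>a. complex_of_real (\<phi> a)"
  have f: "?f \<in> Cc G" using \<phi>(1,3) by (auto simp: Cc_def intro: continuous_on_of_real)
  have "?f a = (if a = g then 1 else 0)" if a: "src G a = src G g \<or> tgt G a = tgt G g" for a
  proof (cases "\<phi> a = 0")
    case True
    then show ?thesis using \<phi>(2) by auto
  next
    case False
    then have "a = g" using z[OF False] U(2) oU(2,3) a by (auto dest: inj_onD)
    then show ?thesis using \<phi>(2) by simp
  qed
  note v = this
  have "delta_at g ?f" unfolding delta_at_def using f v by blast
  moreover have "delta_at (ginv G g) (star G ?f)"
    unfolding delta_at_def
  proof (intro conjI allI impI)
    show "star G ?f \<in> Cc G" by (rule Cc_star[OF f])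
    fix a assume a: "src G a = src G (ginv G g)"
    have "star G ?f a = cnj (if ginv G a = g then 1 else 0)"
      unfolding star_def by (subst v) (use a in auto)
    moreover have "ginv G a = g \<longleftrightarrow> a = ginv G g" by (metis ginv_ginv)
    ultimately show "star G ?f a = (if a = ginv G g then 1 else 0)" by simp
  qed
  ultimately show ?thesis by blast
qed

definition arrow_bump :: "'g \<Rightarrow> 'g \<Rightarrow> complex" where
  "arrow_bump g = (SOME f. delta_at g f \<and> delta_at (ginv G g) (star G f))"

lemma arrow_bump: "delta_at g (arrow_bump g)" "delta_at (ginv G g) (star G (arrow_bump g))"
  using someI_ex[OF delta_exists[of g]] by (auto simp: arrow_bump_def)

lemma delta_Cc: "delta_at g f \<Longrightarrow> f \<in> Cc G"
  and delta_val: "delta_at g f \<Longrightarrow> src G a = src G g \<Longrightarrow> f a = (if a = g then 1 else 0)"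
  by (auto simp: delta_at_def)

text \<open>
  In the fibre over the source of \<open>b\<close> the only factorization of an arrow
  \<open>c\<close> with second factor \<open>b\<close> is \<open>c = (c b^-1) b\<close>.
\<close>

lemma delta_conv:
  assumes f: "delta_at a f" and g: "delta_at b g" and ab: "src G a = tgt G b"
  shows "delta_at (mul G a b) (conv G f g)"
  unfolding delta_at_def
proof (intro conjI allI impI)
  show "conv G f g \<in> Cc G" by (intro Cc_conv delta_Cc[OF f] delta_Cc[OF g])
  fix c assume "src G c = src G (mul G a b)"
  then have c: "src G c = src G b" using ab by simp
  let ?b = "mul G c (ginv G b)"
  have bb: "src G ?b = tgt G b" "tgt G ?b = tgt G c" using c by simp_all
  have "conv G f g c = (\<Sum>d\<in>{?b}. f d * g (mul G (ginv G d) c))"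
  proof (rule conv_eq_sum)
    fix d assume d: "tgt G d = tgt G c" "f d * g (mul G (ginv G d) c) \<noteq> 0"
    have "src G (mul G (ginv G d) c) = src G b" using d(1) c by simp
    from delta_val[OF g this] d(2) have e: "mul G (ginv G d) c = b" by (auto split: if_splits)
    have "mul G d b = c" unfolding e[symmetric] using d(1) by simp
    moreover have "src G d = tgt G b" unfolding e[symmetric] using d(1) by simp
    ultimately have "?b = d" by auto
    then show "d \<in> {?b}" by simp
  qed (use bb in auto)
  also have "\<dots> = f ?b * g (mul G (ginv G ?b) c)" by simp
  also have "mul G (ginv G ?b) c = b"
  proof -
    have "mul G ?b b = c" using c by simp
    then show ?thesis using mul_ginv_cancel(2)[OF bb(1)] by simp
  qed
  also have "g b = 1" using delta_val[OF g, of b] by simp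
  also have "f ?b = (if ?b = a then 1 else 0)" by (rule delta_val[OF f]) (simp add: bb ab)
  also have "?b = a \<longleftrightarrow> c = mul G a b" using c ab by auto
  finally show "conv G f g c = (if c = mul G a b then 1 else 0)" by simp
qed

end

text \<open>
  Nondegenerate representations of the convolution algebra on a nonzero finite-dimensional Hilbert
  space. Everything about orbits and isotropy is found at this algebraic level; the completion
  enters again only with irreducibility.
\<close>

locale Cc_rep = etale_gpd G for G :: "'g::{t2_space, second_countable_topology} groupoid" +
  fixes N :: nat and s :: "('g \<Rightarrow> complex) \<Rightarrow> complex mat"
  assumes s_carrier: "\<And>f. f \<in> Cc G \<Longrightarrow> s f \<in> carrier_mat N N"
    and s_add: "\<And>f g. f \<in> Cc G \<Longrightarrow> g \<in> Cc G \<Longrightarrow> s (\<lambda>a. f a + g a) = s f + s g"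
    and s_scale: "\<And>f c. f \<in> Cc G \<Longrightarrow> s (\<lambda>a. c * f a) = c \<cdot>\<^sub>m s f"
    and s_mult: "\<And>f g. f \<in> Cc G \<Longrightarrow> g \<in> Cc G \<Longrightarrow> s (conv G f g) = s f * s g"
    and s_star: "\<And>f. f \<in> Cc G \<Longrightarrow> s (star G f) = mat_adjoint (s f)"
    and nondeg: "\<And>v. v \<in> carrier_vec N \<Longrightarrow> (\<And>f. f \<in> Cc G \<Longrightarrow> s f *\<^sub>v v = 0\<^sub>v N) \<Longrightarrow> v = 0\<^sub>v N"
    and N_pos: "0 < N"
begin

lemma act_carrier: "f \<in> Cc G \<Longrightarrow> v \<in> carrier_vec N \<Longrightarrow> s f *\<^sub>v v \<in> carrier_vec N"
  by (rule mult_mat_vec_carrier[OF s_carrier])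

lemma act_mult:
  "f \<in> Cc G \<Longrightarrow> g \<in> Cc G \<Longrightarrow> v \<in> carrier_vec N \<Longrightarrow> s (conv G f g) *\<^sub>v v = s f *\<^sub>v (s g *\<^sub>v v)"
  using mult_mat_vec_assoc[OF s_carrier s_carrier] s_mult by simp

lemma act_add:
  "f \<in> Cc G \<Longrightarrow> g \<in> Cc G \<Longrightarrow> v \<in> carrier_vec N \<Longrightarrow> s (\<lambda>a. f a + g a) *\<^sub>v v = s f *\<^sub>v v + s g *\<^sub>v v"
  using add_mult_distrib_mat_vec[OF s_carrier s_carrier] s_add by simp

lemma act_scale:
  assumes "f \<in> Cc G" "v \<in> carrier_vec N"
  shows "s (\<lambda>a. c * f a) *\<^sub>v v = c \<cdot>\<^sub>v (s f *\<^sub>v v)"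
  unfolding s_scale[OF assms(1)] using s_carrier[OF assms(1)] assms(2) by (intro eq_vecI) auto

lemma act_zero: "v \<in> carrier_vec N \<Longrightarrow> s (\<lambda>a. 0) *\<^sub>v v = 0\<^sub>v N"
  using act_scale[OF Cc_zero, of v 0] zero_smult[OF act_carrier[OF Cc_zero, of v]] by simp

lemma act_adjoint:
  "f \<in> Cc G \<Longrightarrow> v \<in> carrier_vec N \<Longrightarrow> w \<in> carrier_vec N \<Longrightarrow> ip (s f *\<^sub>v v) w = ip v (s (star G f) *\<^sub>v w)"
  using ip_adjoint[OF s_carrier] s_star by simp

lemma act_sum_index:
  assumes "finite I" "\<And>i. i \<in> I \<Longrightarrow> F i \<in> Cc G" "v \<in> carrier_vec N" "k < N"
  shows "vec_index (s (\<lambda>a. \<Sum>i\<in>I. c i * F i a) *\<^sub>v v) k = (\<Sum>i\<in>I. c i * vec_index (s (F i) *\<^sub>v v) k)"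
  using assms(1,2)
proof (induction I rule: finite_induct)
  case empty
  show ?case using act_zero[OF assms(3)] assms(4) by simp
next
  case (insert i I)
  have F: "F i \<in> Cc G" "\<And>j. j \<in> I \<Longrightarrow> F j \<in> Cc G" using insert.prems by auto
  have c1: "(\<lambda>a. c i * F i a) \<in> Cc G" by (rule Cc_scale[OF F(1)])
  have c2: "(\<lambda>a. \<Sum>i\<in>I. c i * F i a) \<in> Cc G" by (rule Cc_sum) (rule Cc_scale[OF F(2)])
  have "s (\<lambda>a. \<Sum>i\<in>insert i I. c i * F i a) *\<^sub>v v =
      s (\<lambda>a. c i * F i a) *\<^sub>v v + s (\<lambda>a. \<Sum>i\<in>I. c i * F i a) *\<^sub>v v"
    using act_add[OF c1 c2 assms(3)] insert.hyps by simp
  then have "vec_index (s (\<lambda>a. \<Sum>i\<in>insert i I. c i * F i a) *\<^sub>v v) k =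
      c i * vec_index (s (F i) *\<^sub>v v) k + vec_index (s (\<lambda>a. \<Sum>i\<in>I. c i * F i a) *\<^sub>v v) k"
    using act_scale[OF F(1) assms(3)] carrier_vecD[OF act_carrier[OF F(1) assms(3)]]
      carrier_vecD[OF act_carrier[OF c2 assms(3)]] assms(4) by simp
  then show ?case using insert F by simp
qed

lemma act_sum_zero:
  assumes "finite I" "\<And>i. i \<in> I \<Longrightarrow> F i \<in> Cc G" "v \<in> carrier_vec N"
    and z: "\<And>i. i \<in> I \<Longrightarrow> s (F i) *\<^sub>v v = 0\<^sub>v N"
  shows "s (\<lambda>a. \<Sum>i\<in>I. F i a) *\<^sub>v v = 0\<^sub>v N"
proof (rule eq_vecI)
  have c: "s (\<lambda>a. \<Sum>i\<in>I. F i a) *\<^sub>v v \<in> carrier_vec N"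
    by (intro act_carrier Cc_sum assms)
  show "dim_vec (s (\<lambda>a. \<Sum>i\<in>I. F i a) *\<^sub>v v) = dim_vec (0\<^sub>v N)"
    unfolding carrier_vecD[OF c] by simp
  fix k assume "k < dim_vec (0\<^sub>v N :: complex vec)"
  then have k: "k < N" by simp
  show "vec_index (s (\<lambda>a. \<Sum>i\<in>I. F i a) *\<^sub>v v) k = vec_index (0\<^sub>v N) k"
    using act_sum_index[OF assms(1-3) k, where c="\<lambda>_. 1"] z k by simp
qed

text \<open>
  The squared norm of \<open>s f v\<close> is the inner product of \<open>v\<close> with \<open>s
  (f* f) v\<close>.
\<close>

lemma Cc_bisection_act_zero:
  assumes f: "f \<in> Cc_bisection" and v: "v \<in> carrier_vec N" and z: "s (conv G (star G f) f) *\<^sub>v v = 0\<^sub>v N"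
  shows "s f *\<^sub>v v = 0\<^sub>v N"
proof (rule ip_self_zero)
  note fC = Cc_bisection_Cc[OF f]
  show c: "s f *\<^sub>v v \<in> carrier_vec N" by (rule act_carrier[OF fC v])
  have "ip (s f *\<^sub>v v) (s f *\<^sub>v v) = ip v (s (star G f) *\<^sub>v (s f *\<^sub>v v))" by (rule act_adjoint[OF fC v c])
  also have "\<dots> = ip v (0\<^sub>v N)" using act_mult[OF Cc_star[OF fC] fC v] z by simp
  also have "\<dots> = 0" by (simp add: ip_def)
  finally show "ip (s f *\<^sub>v v) (s f *\<^sub>v v) = 0" .
qed

text \<open>
  Functions on the unit space detect everything, since \<open>star G f\<close> times
  \<open>f\<close> is such a function for each bisection-supported piece of an element.
\<close>

lemma Cc_units_nondeg:
  assumes v: "v \<in> carrier_vec N" and z: "\<And>h. h \<in> Cc_units \<Longrightarrow> s h *\<^sub>v v = 0\<^sub>v N"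
  shows "v = 0\<^sub>v N"
proof (rule nondeg[OF v])
  fix f assume f: "f \<in> Cc G"
  obtain I :: "'g set" and F where F: "finite I" "f = (\<lambda>a. \<Sum>i\<in>I. F i a)" "\<And>i. i \<in> I \<Longrightarrow> F i \<in> Cc_bisection"
    by (rule bisection_decompose[OF f]) blast
  show "s f *\<^sub>v v = 0\<^sub>v N"
    unfolding F(2) by (rule act_sum_zero[OF F(1) Cc_bisection_Cc[OF F(3)] v], assumption)
      (rule Cc_bisection_act_zero[OF F(3) v z[OF star_conv_Cc_bisection(1)[OF F(3)]]])
qed

text \<open>
  The joint eigenspace on which functions on the unit space act through evaluation at
  \<open>x\<close>; the Hilbert space of the representation turns out to be the orthogonal sum of
  these spaces over one orbit.
\<close>

definition fibre :: "'g \<Rightarrow> complex vec set" where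
  "fibre x = {v \<in> carrier_vec N. \<forall>h\<in>Cc_units. s h *\<^sub>v v = h x \<cdot>\<^sub>v v}"

lemma fibreD: "v \<in> fibre x \<Longrightarrow> v \<in> carrier_vec N" "v \<in> fibre x \<Longrightarrow> h \<in> Cc_units \<Longrightarrow> s h *\<^sub>v v = h x \<cdot>\<^sub>v v"
  by (auto simp: fibre_def)

lemma fibre_subspace: "is_subspace N (fibre x)"
  unfolding fibre_def by (rule joint_eigenspace) (rule s_carrier[OF Cc_units_Cc])

lemma Cc_units_mult: "h \<in> Cc_units \<Longrightarrow> k \<in> Cc_units \<Longrightarrow> (\<lambda>a. h a * k a) \<in> Cc_units"
  by (rule Cc_unitsI[OF Cc_cmult[OF Cc_units_Cc CcD(1)[OF Cc_units_Cc]]]) (auto simp: Cc_unitsD)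

text \<open>
  The commuting operators of the functions on the unit space have a common eigenvector, with a
  nonzero character \<open>ch\<close>. If \<open>ch\<close> were not evaluation at any unit, each
  unit would have a function in the kernel of \<open>ch\<close> that is nonzero there. By
  compactness finitely many sums of squares of these give a function \<open>q\<close> in the
  kernel that is positive on the support of a given \<open>h0\<close>; then \<open>h0\<close> is a
  multiple of \<open>q\<close>, so \<open>ch\<close> vanishes at \<open>h0\<close>.
\<close>

lemma point_exists:
  obtains x v where "x \<in> units G" "v \<in> fibre x" "v \<noteq> 0\<^sub>v N"
proof -
  have "s ` Cc_units \<subseteq> carrier_mat N N" using s_carrier Cc_units_Cc by auto
  moreover have "\<And>A B. A \<in> s ` Cc_units \<Longrightarrow> B \<in> s ` Cc_units \<Longrightarrow> A * B = B * A"
  proof -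
    fix A B assume AB: "A \<in> s ` Cc_units" "B \<in> s ` Cc_units"
    obtain h k where h: "h \<in> Cc_units" "A = s h" and k: "k \<in> Cc_units" "B = s k" using AB by blast
    have "A * B = s (conv G h k)" unfolding h(2) k(2) by (rule s_mult[OF Cc_units_Cc[OF h(1)] Cc_units_Cc[OF k(1)], symmetric])
    also have "conv G h k = conv G k h" unfolding conv_Cc_units_Cc_units[OF h(1) k(1)] conv_Cc_units_Cc_units[OF k(1) h(1)] by (simp add: mult.commute)
    also have "s (conv G k h) = B * A" unfolding h(2) k(2) by (rule s_mult[OF Cc_units_Cc[OF k(1)] Cc_units_Cc[OF h(1)]])
    finally show "A * B = B * A" .
  qed
  ultimately obtain v where v: "v \<in> carrier_vec N" "v \<noteq> 0\<^sub>v N" "\<forall>A\<in>s ` Cc_units. \<exists>c. A *\<^sub>v v = c \<cdot>\<^sub>v v"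
    by (rule common_eigenvector[OF N_pos])
  have "\<exists>c. s h *\<^sub>v v = c \<cdot>\<^sub>v v" if "h \<in> Cc_units" for h using v(3) that by blast
  then obtain ch where ch: "\<And>h. h \<in> Cc_units \<Longrightarrow> s h *\<^sub>v v = ch h \<cdot>\<^sub>v v" by metis
  obtain h0 where h0: "h0 \<in> Cc_units" "s h0 *\<^sub>v v \<noteq> 0\<^sub>v N" using Cc_units_nondeg[OF v(1)] v(2) by blast
  let ?K = "closure {a. h0 a \<noteq> 0}"
  have KU: "?K \<subseteq> units G" using Cc_unitsD[OF h0(1)] closed_units by (intro closure_minimal) auto
  have "\<exists>x\<in>units G. \<forall>h\<in>Cc_units. s h *\<^sub>v v = h x \<cdot>\<^sub>v v"
  proof (rule ccontr)
    assume contra: "\<not> ?thesis"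
    have ex: "\<exists>k\<in>Cc_units. k x \<noteq> 0 \<and> s k *\<^sub>v v = 0\<^sub>v N" if x: "x \<in> units G" for x
    proof -
      obtain h where h: "h \<in> Cc_units" "s h *\<^sub>v v \<noteq> h x \<cdot>\<^sub>v v" using contra x by blast
      then have ne: "ch h \<noteq> h x" using ch[OF h(1)] by auto
      obtain e where e: "e \<in> Cc_units" "e x = 1" by (rule Cc_units_bump[OF x open_UNIV UNIV_I]) blast
      (* Multiplication by the cutoff e replaces the missing unit in h - ch h. *)
      let ?k = "\<lambda>a. e a * h a + (- ch h) * e a"
      have eh: "(\<lambda>a. e a * h a) \<in> Cc G" by (rule Cc_units_Cc[OF Cc_units_mult[OF e(1) h(1)]])
      have ce: "(\<lambda>a. (- ch h) * e a) \<in> Cc G" by (rule Cc_scale[OF Cc_units_Cc[OF e(1)]])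
      have k: "?k \<in> Cc_units" by (rule Cc_unitsI[OF Cc_add[OF eh ce]]) (simp add: Cc_unitsD[OF e(1)])
      have sv: "s e *\<^sub>v v \<in> carrier_vec N" by (rule act_carrier[OF Cc_units_Cc[OF e(1)] v(1)])
      have "s (\<lambda>a. e a * h a) *\<^sub>v v = s e *\<^sub>v (s h *\<^sub>v v)"
        using act_mult[OF Cc_units_Cc[OF e(1)] Cc_units_Cc[OF h(1)] v(1)] conv_Cc_units_Cc_units[OF e(1) h(1)] by simp
      also have "\<dots> = ch h \<cdot>\<^sub>v (s e *\<^sub>v v)"
        unfolding ch[OF h(1)] by (rule mult_mat_vec[OF s_carrier[OF Cc_units_Cc[OF e(1)]] v(1)])
      finally have "s ?k *\<^sub>v v = ch h \<cdot>\<^sub>v (s e *\<^sub>v v) + (- ch h) \<cdot>\<^sub>v (s e *\<^sub>v v)"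
        using act_add[OF eh ce v(1)] act_scale[OF Cc_units_Cc[OF e(1)] v(1), of "- ch h"] by simp
      also have "\<dots> = 0\<^sub>v N" by (rule smult_cancel[OF sv])
      finally have "s ?k *\<^sub>v v = 0\<^sub>v N" .
      moreover have "?k x \<noteq> 0" using e(2) ne by simp
      ultimately show ?thesis by (intro bexI[OF _ k] conjI)
    qed
    then have "\<forall>x\<in>units G. \<exists>k. k \<in> Cc_units \<and> k x \<noteq> 0 \<and> s k *\<^sub>v v = 0\<^sub>v N" by blast
    from bchoice[OF this] obtain k where
      "\<forall>x\<in>units G. k x \<in> Cc_units \<and> k x x \<noteq> 0 \<and> s (k x) *\<^sub>v v = 0\<^sub>v N" by blast
    then have k: "\<And>x. x \<in> units G \<Longrightarrow> k x \<in> Cc_units" "\<And>x. x \<in> units G \<Longrightarrow> k x x \<noteq> 0"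
      "\<And>x. x \<in> units G \<Longrightarrow> s (k x) *\<^sub>v v = 0\<^sub>v N" by blast+
    have op: "open {a. k x a \<noteq> 0}" if "x \<in> ?K" for x
      using CcD(1)[OF Cc_units_Cc[OF k(1)]] KU that by (intro open_Collect_neq continuous_on_const) auto
    have "?K \<subseteq> (\<Union>x\<in>?K. {a. k x a \<noteq> 0})"
    proof
      fix x assume x: "x \<in> ?K"
      then have "x \<in> {a. k x a \<noteq> 0}" using k(2) KU by blast
      then show "x \<in> (\<Union>x\<in>?K. {a. k x a \<noteq> 0})" using x by blast
    qed
    then obtain I where I: "I \<subseteq> ?K" "finite I" "?K \<subseteq> (\<Union>x\<in>I. {a. k x a \<noteq> 0})"
      using compactE_image[OF CcD(2)[OF Cc_units_Cc[OF h0(1)]], of ?K "\<lambda>x. {a. k x a \<noteq> 0}"] op by metis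
    have kI: "k x \<in> Cc_units" "s (k x) *\<^sub>v v = 0\<^sub>v N" if "x \<in> I" for x using that I(1) KU k by blast+
    have skI: "star G (k x) \<in> Cc_units" if "x \<in> I" for x
      unfolding star_Cc_units[OF kI(1)[OF that]] using CcD(1)[OF Cc_units_Cc[OF kI(1)[OF that]]]
      by (intro Cc_units_compose[OF kI(1)[OF that]] continuous_on_cnj) auto
    define q where "q = (\<lambda>a. \<Sum>x\<in>I. conv G (star G (k x)) (k x) a)"
    have qC: "conv G (star G (k x)) (k x) \<in> Cc_units" if "x \<in> I" for x
      unfolding conv_Cc_units_Cc_units[OF skI[OF that] kI(1)[OF that]] by (rule Cc_units_mult[OF skI[OF that] kI(1)[OF that]])
    have q: "q \<in> Cc_units" unfolding q_def
      by (rule Cc_unitsI[OF Cc_sum[OF Cc_units_Cc[OF qC]]]) (auto intro: sum.neutral Cc_unitsD[OF qC])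
    have qv: "s q *\<^sub>v v = 0\<^sub>v N" unfolding q_def
    proof (rule act_sum_zero[OF I(2) Cc_units_Cc[OF qC] v(1)])
      fix x assume x: "x \<in> I"
      show "s (conv G (star G (k x)) (k x)) *\<^sub>v v = 0\<^sub>v N"
        unfolding act_mult[OF Cc_units_Cc[OF skI[OF x]] Cc_units_Cc[OF kI(1)[OF x]] v(1)] kI(2)[OF x]
        by (rule mult_zero_vec[OF s_carrier[OF Cc_units_Cc[OF skI[OF x]]]])
    qed
    have qK: "q a \<noteq> 0" if a: "a \<in> ?K" for a
    proof -
      have "q a = (\<Sum>x\<in>I. of_real ((cmod (k x a))\<^sup>2))" unfolding q_def
      proof (rule sum.cong[OF refl])
        fix x assume x: "x \<in> I"
        show "conv G (star G (k x)) (k x) a = of_real ((cmod (k x a))\<^sup>2)"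
        proof -
          have "conv G (star G (k x)) (k x) a = star G (k x) a * k x a"
            by (rule fun_cong[OF conv_Cc_units_Cc_units[OF skI[OF x] kI(1)[OF x]]])
          then show ?thesis unfolding star_Cc_units[OF kI(1)[OF x]]
            by (simp only: complex_norm_square mult.commute)
        qed
      qed
      then have e: "q a = of_real (\<Sum>x\<in>I. (cmod (k x a))\<^sup>2)" by simp
      obtain x where x: "x \<in> I" "k x a \<noteq> 0" using I(3) a by blast
      then have "(\<Sum>x\<in>I. (cmod (k x a))\<^sup>2) > 0" using I(2) by (intro sum_pos2[of _ x]) auto
      then show ?thesis unfolding e of_real_eq_0_iff by simp
    qed
    have h0z: "h0 a = 0" if "a \<notin> ?K" for a using CcD(3)[OF Cc_units_Cc[OF h0(1)]] that by blast
    define p where "p a = h0 a / q a" for a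
    have pc: "continuous_on UNIV p"
    proof -
      have "continuous_on {a. q a \<noteq> 0} p" unfolding p_def
        by (rule continuous_on_divide[OF continuous_on_subset[OF CcD(1)[OF Cc_units_Cc[OF h0(1)]] subset_UNIV]
            continuous_on_subset[OF CcD(1)[OF Cc_units_Cc[OF q]] subset_UNIV]]) simp
      moreover have "continuous_on (- ?K) p"
      proof (rule continuous_on_eq)
        show "continuous_on (- ?K) (\<lambda>a. 0 :: complex)" by (rule continuous_on_const)
        show "0 = p a" if "a \<in> - ?K" for a
        proof -
          have "h0 a = 0" by (rule h0z) (use that in blast)
          then show ?thesis by (simp add: p_def)
        qed
      qed
      moreover have "open {a. q a \<noteq> 0}"
        using CcD(1)[OF Cc_units_Cc[OF q]] by (intro open_Collect_neq continuous_on_const)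
      ultimately have "continuous_on ({a. q a \<noteq> 0} \<union> - ?K) p"
        by (intro continuous_on_open_Un) auto
      moreover have "{a. q a \<noteq> 0} \<union> - ?K = UNIV" using qK by blast
      ultimately show ?thesis by simp
    qed
    have p: "p \<in> Cc_units" by (rule Cc_units_compose[OF h0(1) pc]) (simp add: p_def)
    have "h0 a = p a * q a" for a using h0z[of a] qK[of a] by (cases "a \<in> ?K") (simp_all add: p_def)
    then have "h0 = conv G p q" unfolding conv_Cc_units_Cc_units[OF p q] by (rule ext)
    then have "s h0 *\<^sub>v v = s p *\<^sub>v (s q *\<^sub>v v)" using act_mult[OF Cc_units_Cc[OF p] Cc_units_Cc[OF q] v(1)] by simp
    also have "\<dots> = 0\<^sub>v N" unfolding qv by (rule mult_zero_vec[OF s_carrier[OF Cc_units_Cc[OF p]]])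
    finally show False using h0(2) by simp
  qed
  then obtain x where x: "x \<in> units G" "\<forall>h\<in>Cc_units. s h *\<^sub>v v = h x \<cdot>\<^sub>v v" by blast
  have "v \<in> fibre x" using x v(1) by (simp add: fibre_def)
  then show ?thesis by (rule that[OF x(1) _ v(2)])
qed

text \<open>
  The pieces \<open>F i\<close> vanish on the source fibre of \<open>x\<close> as well, so the
  function \<open>star G (F i)\<close> times \<open>F i\<close> on the unit space vanishes at
  \<open>x\<close> and therefore kills \<open>v\<close>.
\<close>

lemma act_vanish:
  assumes x: "x \<in> units G" and v: "v \<in> fibre x" and f: "f \<in> Cc G" and z: "\<And>a. src G a = x \<Longrightarrow> f a = 0"
  shows "s f *\<^sub>v v = 0\<^sub>v N"
proof -
  obtain I :: "'g set" and F where F: "finite I" "f = (\<lambda>a. \<Sum>i\<in>I. F i a)" "\<And>i. i \<in> I \<Longrightarrow> F i \<in> Cc_bisection"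
    "\<And>i a. i \<in> I \<Longrightarrow> f a = 0 \<Longrightarrow> F i a = 0"
    by (rule bisection_decompose[OF f]) blast
  have "s (\<lambda>a. \<Sum>i\<in>I. F i a) *\<^sub>v v = 0\<^sub>v N"
  proof (rule act_sum_zero[OF F(1) Cc_bisection_Cc[OF F(3)] fibreD(1)[OF v]])
    fix i assume i: "i \<in> I"
    have e: "{c. src G c = x \<and> F i c \<noteq> 0} = {}" using F(4)[OF i] z by blast
    have "conv G (star G (F i)) (F i) x = 0" unfolding star_conv_Cc_bisection(2)[OF F(3)[OF i] x] e by simp
    then have "s (conv G (star G (F i)) (F i)) *\<^sub>v v = 0 \<cdot>\<^sub>v v"
      using fibreD(2)[OF v star_conv_Cc_bisection(1)[OF F(3)[OF i]]] by simp
    also have "\<dots> = 0\<^sub>v N" using fibreD(1)[OF v] by auto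
    finally show "s (F i) *\<^sub>v v = 0\<^sub>v N" by (rule Cc_bisection_act_zero[OF F(3)[OF i] fibreD(1)[OF v]])
  qed
  then show ?thesis unfolding F(2)[symmetric] .
qed

lemma act_cong:
  assumes x: "x \<in> units G" and v: "v \<in> fibre x" and f: "f \<in> Cc G" and g: "g \<in> Cc G"
    and eq: "\<And>a. src G a = x \<Longrightarrow> f a = g a"
  shows "s f *\<^sub>v v = s g *\<^sub>v v"
proof -
  have m: "(\<lambda>a. (-1) * g a) \<in> Cc G" by (rule Cc_scale[OF g])
  have "s (\<lambda>a. f a + (-1) * g a) *\<^sub>v v = 0\<^sub>v N"
    by (rule act_vanish[OF x v Cc_add[OF f m]]) (simp add: eq)
  then have z: "s f *\<^sub>v v + (-1) \<cdot>\<^sub>v (s g *\<^sub>v v) = 0\<^sub>v N"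
    using act_add[OF f m fibreD(1)[OF v]] act_scale[OF g fibreD(1)[OF v], of "-1"] by simp
  have c: "s f *\<^sub>v v \<in> carrier_vec N" "s g *\<^sub>v v \<in> carrier_vec N"
    using act_carrier[OF f fibreD(1)[OF v]] act_carrier[OF g fibreD(1)[OF v]] by auto
  show ?thesis by (rule vec_eqI_diff[OF c z])
qed

text \<open>
  On \<open>fibre (src G g)\<close> this is the unitary by which the arrow \<open>g\<close> itself
  acts; off that space it depends on the chosen bump function and means nothing.
\<close>

definition arrow_op :: "'g \<Rightarrow> complex mat" where
  "arrow_op g = s (arrow_bump g)"

lemma arrow_op_carrier: "arrow_op g \<in> carrier_mat N N"
  unfolding arrow_op_def by (rule s_carrier[OF delta_Cc[OF arrow_bump(1)]])

lemma arrow_op_eq: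
  assumes f: "delta_at g f" and v: "v \<in> fibre (src G g)"
  shows "s f *\<^sub>v v = arrow_op g *\<^sub>v v"
  unfolding arrow_op_def
proof (rule act_cong[OF src_unit v delta_Cc[OF f] delta_Cc[OF arrow_bump(1)]])
  show "f a = arrow_bump g a" if "src G a = src G g" for a
    using delta_val[OF f that] delta_val[OF arrow_bump(1) that] by simp
qed

text \<open>
  Arrows transport fibres: multiplying by \<open>h\<close> on the left multiplies the bump
  function at \<open>g\<close> by the values of \<open>h\<close> at ranges, and on the source
  fibre only the range of \<open>g\<close> counts.
\<close>

lemma arrow_op_fibre:
  assumes v: "v \<in> fibre (src G g)"
  shows "arrow_op g *\<^sub>v v \<in> fibre (tgt G g)"
  unfolding fibre_def
proof (intro CollectI conjI ballI)
  note d = delta_Cc[OF arrow_bump(1)[of g]]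
  show "arrow_op g *\<^sub>v v \<in> carrier_vec N" by (rule mult_mat_vec_carrier[OF arrow_op_carrier fibreD(1)[OF v]])
  fix h assume h: "h \<in> Cc_units"
  have "s h *\<^sub>v (arrow_op g *\<^sub>v v) = s (conv G h (arrow_bump g)) *\<^sub>v v"
    unfolding arrow_op_def by (rule act_mult[OF Cc_units_Cc[OF h] d fibreD(1)[OF v], symmetric])
  also have "\<dots> = s (\<lambda>a. h (tgt G g) * arrow_bump g a) *\<^sub>v v"
  proof (rule act_cong[OF src_unit v Cc_conv[OF Cc_units_Cc[OF h] d] Cc_scale[OF d]])
    show "conv G h (arrow_bump g) a = h (tgt G g) * arrow_bump g a" if "src G a = src G g" for a
      unfolding conv_Cc_units_left[OF h] delta_val[OF arrow_bump(1) that] by simp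
  qed
  also have "\<dots> = h (tgt G g) \<cdot>\<^sub>v (arrow_op g *\<^sub>v v)" unfolding arrow_op_def by (rule act_scale[OF d fibreD(1)[OF v]])
  finally show "s h *\<^sub>v (arrow_op g *\<^sub>v v) = h (tgt G g) \<cdot>\<^sub>v (arrow_op g *\<^sub>v v)" .
qed

lemma arrow_op_mul:
  assumes ab: "src G a = tgt G b" and v: "v \<in> fibre (src G b)"
  shows "arrow_op (mul G a b) *\<^sub>v v = arrow_op a *\<^sub>v (arrow_op b *\<^sub>v v)"
proof -
  have "arrow_op (mul G a b) *\<^sub>v v = s (conv G (arrow_bump a) (arrow_bump b)) *\<^sub>v v"
    by (rule arrow_op_eq[OF delta_conv[OF arrow_bump(1) arrow_bump(1) ab], symmetric]) (use ab v in simp)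
  then show ?thesis
    unfolding arrow_op_def using act_mult[OF delta_Cc[OF arrow_bump(1)] delta_Cc[OF arrow_bump(1)] fibreD(1)[OF v]] by simp
qed

lemma arrow_op_unit:
  assumes x: "x \<in> units G" and v: "v \<in> fibre x"
  shows "arrow_op x *\<^sub>v v = v"
proof -
  obtain h where h: "h \<in> Cc_units" "h x = 1" by (rule Cc_units_bump[OF x open_UNIV UNIV_I]) blast
  have "delta_at x h" unfolding delta_at_def
  proof (intro conjI allI impI)
    show "h \<in> Cc G" by (rule Cc_units_Cc[OF h(1)])
    fix a assume a: "src G a = src G x"
    show "h a = (if a = x then 1 else 0)"
    proof (cases "a \<in> units G")
      case True
      then have "a = x" using a x by simp
      then show ?thesis using h by simp
    next
      case False
      then have "a \<noteq> x" using x by blast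
      then show ?thesis using Cc_unitsD[OF h(1) False] by simp
    qed
  qed
  then have "arrow_op x *\<^sub>v v = s h *\<^sub>v v" using arrow_op_eq[of x h v] v x by simp
  also have "\<dots> = v" using fibreD(2)[OF v h(1)] h(2) by simp
  finally show ?thesis .
qed

lemma arrow_op_adjoint:
  assumes v: "v \<in> fibre (src G g)" and w: "w \<in> fibre (tgt G g)"
  shows "ip (arrow_op g *\<^sub>v v) w = ip v (arrow_op (ginv G g) *\<^sub>v w)"
proof -
  have "ip (arrow_op g *\<^sub>v v) w = ip v (s (star G (arrow_bump g)) *\<^sub>v w)"
    unfolding arrow_op_def by (rule act_adjoint[OF delta_Cc[OF arrow_bump(1)] fibreD(1)[OF v] fibreD(1)[OF w]])
  also have "s (star G (arrow_bump g)) *\<^sub>v w = arrow_op (ginv G g) *\<^sub>v w" by (rule arrow_op_eq[OF arrow_bump(2)]) (use w in simp)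
  finally show ?thesis .
qed

lemma arrow_op_isometric:
  assumes v: "v \<in> fibre (src G g)" and w: "w \<in> fibre (src G g)"
  shows "ip (arrow_op g *\<^sub>v v) (arrow_op g *\<^sub>v w) = ip v w"
proof -
  have "ip (arrow_op g *\<^sub>v v) (arrow_op g *\<^sub>v w) = ip v (arrow_op (ginv G g) *\<^sub>v (arrow_op g *\<^sub>v w))"
    by (rule arrow_op_adjoint[OF v arrow_op_fibre[OF w]])
  also have "arrow_op (ginv G g) *\<^sub>v (arrow_op g *\<^sub>v w) = arrow_op (src G g) *\<^sub>v w"
    using arrow_op_mul[OF _ w, of "ginv G g"] by simp
  also have "\<dots> = w" by (rule arrow_op_unit[OF src_unit w])
  finally show ?thesis .
qed

text \<open>
  A real bump function equal to one at \<open>x\<close> and zero at \<open>y\<close> acts as the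
  identity on one fibre and as zero on the other.
\<close>

lemma fibre_orthogonal:
  assumes x: "x \<in> units G" and xy: "x \<noteq> y" and v: "v \<in> fibre x" and w: "w \<in> fibre y"
  shows "ip v w = 0"
proof -
  obtain h where h: "h \<in> Cc_units" "h x = 1" "\<And>a. a \<notin> - {y} \<Longrightarrow> h a = 0" "star G h = h"
    by (rule Cc_units_bump[OF x, of "- {y}"]) (use xy in auto)
  have "ip v w = ip (s h *\<^sub>v v) w" using fibreD(2)[OF v h(1)] h(2) by simp
  also have "\<dots> = ip v (s h *\<^sub>v w)" using act_adjoint[OF Cc_units_Cc[OF h(1)] fibreD(1)[OF v] fibreD(1)[OF w]] h(4) by simp
  also have "s h *\<^sub>v w = 0 \<cdot>\<^sub>v w" using fibreD(2)[OF w h(1)] h(3)[of y] by simp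
  also have "ip v (0 \<cdot>\<^sub>v w) = 0" using fibreD(1)[OF w] by (simp add: ip_def)
  finally show ?thesis .
qed

text \<open>
  The operator of \<open>f\<close> is determined over \<open>x\<close> by the action of the arrows
  with source \<open>x\<close>: both sides come from functions that agree on that source fibre.
\<close>

lemma act_formula:
  assumes x: "x \<in> units G" and v: "v \<in> fibre x" and f: "f \<in> Cc G" and k: "k < N"
  shows "vec_index (s f *\<^sub>v v) k = (\<Sum>g | src G g = x \<and> f g \<noteq> 0. f g * vec_index (arrow_op g *\<^sub>v v) k)"
proof -
  let ?S = "{g. src G g = x \<and> f g \<noteq> 0}"
  have fin: "finite ?S" by (rule finite_fibre(2)[OF f])
  have C: "(\<lambda>a. \<Sum>g\<in>?S. f g * arrow_bump g a) \<in> Cc G" by (rule Cc_sum) (rule Cc_scale[OF delta_Cc[OF arrow_bump(1)]])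
  have "s f *\<^sub>v v = s (\<lambda>a. \<Sum>g\<in>?S. f g * arrow_bump g a) *\<^sub>v v"
  proof (rule act_cong[OF x v f C])
    fix a assume a: "src G a = x"
    have "(\<Sum>g\<in>?S. f g * arrow_bump g a) = (\<Sum>g\<in>?S. if g = a then f a else 0)"
    proof (rule sum.cong[OF refl])
      fix g assume g: "g \<in> ?S"
      then have "src G a = src G g" using a by simp
      from delta_val[OF arrow_bump(1) this] show "f g * arrow_bump g a = (if g = a then f a else 0)" by simp
    qed
    also have "\<dots> = f a" using fin a by (cases "f a = 0") (simp_all add: sum.delta)
    finally show "f a = (\<Sum>g\<in>?S. f g * arrow_bump g a)" by simp
  qed
  then show ?thesis unfolding arrow_op_def using act_sum_index[OF fin delta_Cc[OF arrow_bump(1)] fibreD(1)[OF v] k, of f] by simp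
qed

end

section \<open>The representation attached to a finite orbit\<close>

lemma mat_adjoint_one: "mat_adjoint (1\<^sub>m d :: complex mat) = 1\<^sub>m d"
  by (rule eq_matI) auto

lemma vec_index_tendsto:
  fixes A :: "nat \<Rightarrow> complex mat"
  assumes A: "\<And>m. A m \<in> carrier_mat n k" and B: "B \<in> carrier_mat n k" and v: "v \<in> carrier_vec k"
    and lim: "\<And>j. j < k \<Longrightarrow> (\<lambda>m. A m $$ (i, j)) \<longlonglongrightarrow> B $$ (i, j)" and i: "i < n"
  shows "(\<lambda>m. vec_index (A m *\<^sub>v v) i) \<longlonglongrightarrow> vec_index (B *\<^sub>v v) i"
  unfolding mult_mat_vec_index[OF A v i] mult_mat_vec_index[OF B v i]
  by (intro tendsto_sum tendsto_mult tendsto_const lim) auto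

lemma mult_tendsto:
  fixes A :: "nat \<Rightarrow> complex mat"
  assumes A: "\<And>m. A m \<in> carrier_mat n n" and B: "B \<in> carrier_mat n n"
    and L: "L \<in> carrier_mat k n" and R: "R \<in> carrier_mat n l" and ij: "i < k" "j < l"
    and lim: "\<And>i j. i < n \<Longrightarrow> j < n \<Longrightarrow> (\<lambda>m. A m $$ (i, j)) \<longlonglongrightarrow> B $$ (i, j)"
  shows "(\<lambda>m. (L * (A m * R)) $$ (i, j)) \<longlonglongrightarrow> (L * (B * R)) $$ (i, j)"
proof -
  have e: "(L * (C * R)) $$ (i, j) = (\<Sum>p<n. L $$ (i, p) * (\<Sum>q<n. C $$ (p, q) * R $$ (q, j)))"
    if C: "C \<in> carrier_mat n n" for C
    unfolding mult_mat_index[OF L mult_carrier_mat[OF C R] ij]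
    by (intro sum.cong refl arg_cong2[where f="(*)"] mult_mat_index[OF C R]) (use ij in auto)
  show ?thesis unfolding e[OF A] e[OF B]
    by (intro tendsto_sum tendsto_mult tendsto_const lim) auto
qed

context Cc_rep
begin

text \<open>
  Column \<open>i * d + k\<close> is the \<open>k\<close>-th basis vector of the fibre over
  \<open>x0\<close> transported along \<open>g i\<close>. Columns over different points are
  orthogonal because the fibres are, and columns over the same point because transport is
  isometric. Applied to arbitrary finite sets of points of the orbit, this bounds the size of the
  orbit by \<open>N\<close>; applied to the whole orbit, it gives the intertwiner.
\<close>

lemma orbit_isometry:
  assumes x0: "x0 \<in> units G" and E: "isometry N d E" "\<And>y. y \<in> carrier_vec d \<Longrightarrow> E *\<^sub>v y \<in> fibre x0"
    and d: "0 < d" and inj: "inj_on x {..<n}" and g: "\<And>i. i < n \<Longrightarrow> g i \<in> arrows G x0 (x i)"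
  shows "isometry N (n * d)
    (Matrix.mat N (n * d) (\<lambda>(p, q). vec_index (arrow_op (g (q div d)) *\<^sub>v (E *\<^sub>v unit_vec d (q mod d))) p))"
    (is "isometry N (n * d) ?U")
proof -
  have U: "?U \<in> carrier_mat N (n * d)" by simp
  let ?e = "\<lambda>q. E *\<^sub>v unit_vec d (q mod d)"
  let ?u = "\<lambda>q. arrow_op (g (q div d)) *\<^sub>v ?e q"
  have Ec: "E \<in> carrier_mat N d" using E(1) by (simp add: isometry_def)
  have eV: "?e q \<in> fibre x0" for q by (rule E(2)) simp
  have qd: "q div d < n" if "q < n * d" for q using that by (simp add: less_mult_imp_div_less)
  have st: "src G (g i) = x0" "tgt G (g i) = x i" if "i < n" for i using g[OF that] by (auto simp: arrows_def)
  have uV: "?u q \<in> fibre (x (q div d))" if "q < n * d" for q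
    using arrow_op_fibre[of "?e q" "g (q div d)"] eV st[OF qd[OF that]] by simp
  have xu: "x i \<in> units G" if "i < n" for i using st(2)[OF that] tgt_unit[of "g i"] by simp
  have "mat_adjoint ?U * ?U = 1\<^sub>m (n * d)"
  proof (rule eq_matI)
    fix p q assume "p < dim_row (1\<^sub>m (n * d) :: complex mat)" "q < dim_col (1\<^sub>m (n * d) :: complex mat)"
    then have pq: "p < n * d" "q < n * d" by auto
    have "(mat_adjoint ?U * ?U) $$ (p, q) = (\<Sum>l<N. mat_adjoint ?U $$ (p, l) * ?U $$ (l, q))"
      by (rule mult_mat_index[OF mat_adjoint_carrier[OF U] U pq])
    also have "\<dots> = (\<Sum>l<N. vec_index (?u q) l * cnj (vec_index (?u p) l))"
      using pq by (intro sum.cong refl) (simp add: mult.commute del: index_mult_mat_vec)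
    also have "\<dots> = ip (?u q) (?u p)" by (rule ip_eq[OF fibreD(1)[OF uV[OF pq(1)]], symmetric])
    also have "\<dots> = (if p = q then 1 else 0)"
    proof (cases "p div d = q div d")
      case False
      have "x (q div d) \<noteq> x (p div d)" using False inj_onD[OF inj] qd pq by auto
      then have "ip (?u q) (?u p) = 0" by (rule fibre_orthogonal[OF xu[OF qd[OF pq(2)]] _ uV[OF pq(2)] uV[OF pq(1)]])
      then show ?thesis using False by auto
    next
      case True
      have "ip (?u q) (?u p) = ip (?e q) (?e p)"
        unfolding True by (rule arrow_op_isometric) (use eV st(1)[OF qd[OF pq(2)]] in auto)
      also have "\<dots> = ip (unit_vec d (q mod d)) (unit_vec d (p mod d))" by (rule isometry_ip[OF E(1)]) auto
      also have "\<dots> = (\<Sum>l<d. if l = q mod d then (if p mod d = q mod d then 1 else 0) else 0)"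
        unfolding ip_eq[OF unit_vec_carrier] by (intro sum.cong refl) (use d in auto)
      also have "\<dots> = (if p mod d = q mod d then 1 else 0)" using d by simp
      also have "p mod d = q mod d \<longleftrightarrow> p = q" using True by (metis div_mult_mod_eq)
      finally show ?thesis .
    qed
    finally show "(mat_adjoint ?U * ?U) $$ (p, q) = 1\<^sub>m (n * d) $$ (p, q)" using pq by simp
  qed simp_all
  then show ?thesis using U by (simp add: isometry_def)
qed

text \<open>
  Transporting the basis along the arrows \<open>g i\<close> identifies all fibres with the one
  over \<open>x0\<close>, so the unitaries \<open>z i\<close> can be taken to be identities. In
  these coordinates the action of an arrow \<open>a\<close> from \<open>x j\<close> to \<open>x
  i\<close> becomes that of the isotropy element \<open>(g i)^-1 a (g j)\<close>, which gives the
  block matrix of the orbit representation.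
\<close>

lemma intertwining_isometry:
  "\<exists>F n x d \<rho> z g U. orbit_data G F n x d \<rho> z g \<and> isometry N (n * d) U \<and> 0 < n * d \<and>
     (\<forall>f\<in>Cc G. s f * U = U * orbit_rep_Cc G n x d \<rho> z g f)"
proof -
  obtain x0 v0 where x0: "x0 \<in> units G" and v0: "v0 \<in> fibre x0" "v0 \<noteq> 0\<^sub>v N" by (rule point_exists)
  obtain d E where E: "isometry N d E" "\<And>y. y \<in> carrier_vec d \<Longrightarrow> E *\<^sub>v y \<in> fibre x0"
    "\<And>w. w \<in> fibre x0 \<Longrightarrow> E *\<^sub>v (mat_adjoint E *\<^sub>v w) = w" by (rule onb_exists[OF fibre_subspace]) blast
  have Ec: "E \<in> carrier_mat N d" using E(1) by (simp add: isometry_def)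
  have Ac: "mat_adjoint E \<in> carrier_mat d N" using Ec by simp
  have d: "0 < d"
  proof (rule ccontr)
    assume "\<not> 0 < d"
    then have "mat_adjoint E *\<^sub>v v0 = 0\<^sub>v d" using Ec by (intro eq_vecI) auto
    then show False using E(3)[OF v0(1)] v0(2) mult_zero_vec[OF Ec] by simp
  qed
  define F where "F = {y \<in> units G. arrows G x0 y \<noteq> {}}"
  have "x0 \<in> arrows G x0 x0" using x0 by (simp add: arrows_def)
  then have x0F: "x0 \<in> F" using x0 unfolding F_def by blast
  define k where "k y = (if y = x0 then x0 else SOME a. a \<in> arrows G x0 y)" for y
  have k: "k y \<in> arrows G x0 y" if "y \<in> F" for y
  proof (cases "y = x0")
    case True
    then show ?thesis using x0 by (simp add: k_def arrows_def)
  next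
    case False
    have "\<exists>a. a \<in> arrows G x0 y" using that by (auto simp: F_def)
    then show ?thesis using False someI_ex[of "\<lambda>a. a \<in> arrows G x0 y"] by (simp add: k_def)
  qed
  have bound: "n \<le> N" if bij: "bij_betw x {..<n} F'" and sub: "F' \<subseteq> F" for n x F'
  proof -
    have "x i \<in> F" if "i < n" for i using bij_betw_apply[OF bij, of i] sub that by auto
    then have "n * d \<le> N"
      by (intro isometry_le[OF orbit_isometry[OF x0 E(1,2) d bij_betw_imp_inj_on[OF bij], of "\<lambda>i. k (x i)"]] k)
    moreover have "n \<le> n * d" using d by simp
    ultimately show ?thesis by (rule order_trans[rotated])
  qed
  have fin: "finite F"
  proof (rule ccontr)
    assume "infinite F"
    then obtain F' where F': "finite F'" "card F' = Suc N" "F' \<subseteq> F" using infinite_arbitrarily_large by blast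
    obtain x where "bij_betw x {0..<card F'} F'" using ex_bij_betw_nat_finite[OF F'(1)] by blast
    then have "Suc N \<le> N" using bound[of x "Suc N" F'] F' by (simp add: atLeast0LessThan)
    then show False by simp
  qed
  define n where "n = card F"
  have n: "0 < n" unfolding n_def using fin x0F by (auto simp: card_gt_0_iff)
  obtain x where x: "bij_betw x {..<n} F" "x 0 = x0"
  proof -
    obtain y where y: "bij_betw y {0..<card F} F" using ex_bij_betw_nat_finite[OF fin] by blast
    then have y: "bij_betw y {..<n} F" by (simp add: atLeast0LessThan n_def)
    obtain i where i: "i < n" "y i = x0" using y x0F by (metis bij_betw_iff_bijections lessThan_iff)
    (* The transposition moves the base point to index 0. *)
    have "bij_betw (y \<circ> Transposition.transpose 0 i) {..<n} F"
      by (rule bij_betw_trans[OF bij_betw_transpose_iff y]) (simp add: i n)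
    moreover have "(y \<circ> Transposition.transpose 0 i) 0 = x0" using i by simp
    ultimately show ?thesis by (rule that)
  qed
  have xF: "x i \<in> F" if "i < n" for i using bij_betw_apply[OF x(1), of i] that by auto
  define g where "g i = k (x i)" for i
  have g: "g i \<in> arrows G x0 (x i)" if "i < n" for i unfolding g_def by (rule k[OF xF[OF that]])
  have st: "src G (g i) = x0" "tgt G (g i) = x i" if "i < n" for i using g[OF that] by (auto simp: arrows_def)
  have g0: "g 0 = x0" by (simp add: g_def x(2) k_def)
  define \<rho> where "\<rho> a = mat_adjoint E * (arrow_op a * E)" for a
  have \<rho>c: "\<rho> a \<in> carrier_mat d d" for a
    unfolding \<rho>_def by (rule mult_carrier_mat[OF Ac mult_carrier_mat[OF arrow_op_carrier Ec]])
  have \<rho>v: "\<rho> a *\<^sub>v y = mat_adjoint E *\<^sub>v (arrow_op a *\<^sub>v (E *\<^sub>v y))" if y: "y \<in> carrier_vec d" for a y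
    unfolding \<rho>_def mult_mat_vec_assoc[OF Ac mult_carrier_mat[OF arrow_op_carrier Ec] y]
      mult_mat_vec_assoc[OF arrow_op_carrier Ec y] ..
  have E\<rho>: "E *\<^sub>v (\<rho> a *\<^sub>v y) = arrow_op a *\<^sub>v (E *\<^sub>v y)" if a: "a \<in> arrows G x0 x0" and y: "y \<in> carrier_vec d" for a y
  proof -
    have "arrow_op a *\<^sub>v (E *\<^sub>v y) \<in> fibre (tgt G a)" by (rule arrow_op_fibre) (use a E(2)[OF y] in \<open>simp add: arrows_def\<close>)
    then have "arrow_op a *\<^sub>v (E *\<^sub>v y) \<in> fibre x0" using a by (simp add: arrows_def)
    then show ?thesis unfolding \<rho>v[OF y] by (rule E(3))
  qed
  have rep: "isotropy_rep G (x 0) d \<rho>"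
    unfolding isotropy_rep_def x(2)
  proof (intro conjI ballI)
    fix a assume a: "a \<in> arrows G x0 x0"
    have "isometry d d (\<rho> a)"
    proof (rule isometryI[OF \<rho>c])
      fix y y' :: "complex vec" assume y: "y \<in> carrier_vec d" "y' \<in> carrier_vec d"
      note c = mult_mat_vec_carrier[OF \<rho>c y(1)] mult_mat_vec_carrier[OF \<rho>c y(2)]
      have "ip (\<rho> a *\<^sub>v y) (\<rho> a *\<^sub>v y') = ip (E *\<^sub>v (\<rho> a *\<^sub>v y)) (E *\<^sub>v (\<rho> a *\<^sub>v y'))"
        by (rule isometry_ip[OF E(1) c, symmetric])
      also have "\<dots> = ip (arrow_op a *\<^sub>v (E *\<^sub>v y)) (arrow_op a *\<^sub>v (E *\<^sub>v y'))" unfolding E\<rho>[OF a y(1)] E\<rho>[OF a y(2)] ..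
      also have "\<dots> = ip (E *\<^sub>v y) (E *\<^sub>v y')"
        by (rule arrow_op_isometric) (use a E(2) y in \<open>auto simp: arrows_def\<close>)
      also have "\<dots> = ip y y'" by (rule isometry_ip[OF E(1) y])
      finally show "ip (\<rho> a *\<^sub>v y) (\<rho> a *\<^sub>v y') = ip y y'" .
    qed
    then have "mat_adjoint (\<rho> a) * \<rho> a = 1\<^sub>m d" by (simp add: isometry_def)
    moreover from this have "\<rho> a * mat_adjoint (\<rho> a) = 1\<^sub>m d"
      by (rule mat_mult_left_right_inverse[OF mat_adjoint_carrier[OF \<rho>c] \<rho>c])
    ultimately show "unitary_op d d (\<rho> a)" using \<rho>c by (simp add: unitary_op_def)
    fix b assume b: "b \<in> arrows G x0 x0"
    have ab: "src G a = tgt G b" "src G b = x0" using a b by (auto simp: arrows_def)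
    show "\<rho> (mul G a b) = \<rho> a * \<rho> b"
    proof (rule mat_eqI_vec[OF \<rho>c mult_carrier_mat[OF \<rho>c \<rho>c]])
      fix y :: "complex vec" assume y: "y \<in> carrier_vec d"
      have "(\<rho> a * \<rho> b) *\<^sub>v y = \<rho> a *\<^sub>v (\<rho> b *\<^sub>v y)" by (rule mult_mat_vec_assoc[OF \<rho>c \<rho>c y])
      also have "\<dots> = mat_adjoint E *\<^sub>v (arrow_op a *\<^sub>v (E *\<^sub>v (\<rho> b *\<^sub>v y)))" by (rule \<rho>v[OF mult_mat_vec_carrier[OF \<rho>c y]])
      also have "\<dots> = mat_adjoint E *\<^sub>v (arrow_op (mul G a b) *\<^sub>v (E *\<^sub>v y))"
        unfolding E\<rho>[OF b y] using arrow_op_mul[OF ab(1), of "E *\<^sub>v y"] ab(2) E(2)[OF y] by simp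
      also have "\<dots> = \<rho> (mul G a b) *\<^sub>v y" by (rule \<rho>v[OF y, symmetric])
      finally show "\<rho> (mul G a b) *\<^sub>v y = (\<rho> a * \<rho> b) *\<^sub>v y" by simp
    qed
  qed
  (* The basis of each fibre is transported from x0, so each unitary is the identity. *)
  define z where "z i = (1\<^sub>m d :: complex mat)" for i :: nat
  have "orbit_data G F n x d \<rho> z g"
    unfolding orbit_data_def
  proof (intro conjI allI impI)
    show "F \<in> orbits G" unfolding orbits_def F_def using x0 by blast
    show "card F = n" by (simp add: n_def)
    show "unitary_op d d (z i)" for i by (simp add: z_def unitary_op_def mat_adjoint_one)
    show "g i \<in> arrows G (x 0) (x i)" if "i < n" for i using g[OF that] by (simp add: x(2))
    show "g 0 = x 0" by (simp add: g0 x(2))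
  qed (use fin x rep in \<open>auto simp: z_def\<close>)
  moreover define U where
    "U = Matrix.mat N (n * d) (\<lambda>(p, q). vec_index (arrow_op (g (q div d)) *\<^sub>v (E *\<^sub>v unit_vec d (q mod d))) p)"
  have Uiso: "isometry N (n * d) U"
    unfolding U_def by (rule orbit_isometry[OF x0 E(1,2) d bij_betw_imp_inj_on[OF x(1)] g])
  moreover have "0 < n * d" using n d by simp
  moreover have "s f * U = U * orbit_rep_Cc G n x d \<rho> z g f" if f: "f \<in> Cc G" for f
  proof (rule eq_matI)
    let ?M = "orbit_rep_Cc G n x d \<rho> z g f"
    have M: "?M \<in> carrier_mat (n * d) (n * d)" by (simp add: orbit_rep_Cc_def)
    have U: "U \<in> carrier_mat N (n * d)" by (simp add: U_def)
    show dims: "dim_row (s f * U) = dim_row (U * ?M)" "dim_col (s f * U) = dim_col (U * ?M)"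
      using s_carrier[OF f] U M by auto
    fix p q assume "p < dim_row (U * ?M)" "q < dim_col (U * ?M)"
    then have p: "p < N" and q: "q < n * d" using U M by auto
    define j where "j = q div d"
    define l where "l = q mod d"
    have j: "j < n" and l: "l < d" using q d by (auto simp: j_def l_def less_mult_imp_div_less)
    let ?e = "E *\<^sub>v unit_vec d l"
    have eV: "?e \<in> fibre x0" by (rule E(2)) simp
    define u where "u = arrow_op (g j) *\<^sub>v ?e"
    have uV: "u \<in> fibre (x j)" unfolding u_def using arrow_op_fibre[of ?e "g j"] eV st[OF j] by simp
    have xj: "x j \<in> units G" using xF[OF j] by (simp add: F_def)
    let ?S = "{a. src G a = x j \<and> f a \<noteq> 0}"
    let ?S' = "\<lambda>i. {a \<in> ?S. tgt G a = x i}"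
    have finS: "finite ?S" by (rule finite_fibre(2)[OF f])
    have finS': "finite (?S' i)" for i by (rule finite_subset[OF _ finS]) blast
    have h: "mul G (mul G (ginv G (g i)) a) (g j) \<in> arrows G x0 x0"
      "mul G (g i) (mul G (mul G (ginv G (g i)) a) (g j)) = mul G a (g j)"
      if i: "i < n" and a: "a \<in> ?S' i" for i a
    proof -
      have a': "src G a = x j" "tgt G a = x i" using a by auto
      have c: "tgt G (g i) = tgt G a" "src G a = tgt G (g j)" using a' st[OF i] st[OF j] by auto
      show "mul G (mul G (ginv G (g i)) a) (g j) \<in> arrows G x0 x0"
        using c st(1)[OF i] st(1)[OF j] by (simp add: arrows_def)
      have "mul G (mul G (ginv G (g i)) a) (g j) = mul G (ginv G (g i)) (mul G a (g j))"
        by (rule mul_assoc) (use c in auto)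
      then show "mul G (g i) (mul G (mul G (ginv G (g i)) a) (g j)) = mul G a (g j)"
        using c by simp
    qed
    have Mentry: "?M $$ (i * d + k, q) =
        (\<Sum>a\<in>?S' i. f a * \<rho> (mul G (mul G (ginv G (g i)) a) (g j)) $$ (k, l))"
      if i: "i < n" and kd: "k < d" for i k
    proof -
      have lt: "i * d + k < n * d"
      proof -
        have "i * d + k < Suc i * d" using kd by simp
        also have "\<dots> \<le> n * d" using i by (intro mult_le_mono1) simp
        finally show ?thesis .
      qed
      have dm: "(i * d + k) div d = i" "(i * d + k) mod d = k" using kd by auto
      have zz: "z i * R * mat_adjoint (z j) = R" if "R \<in> carrier_mat d d" for R
        unfolding z_def mat_adjoint_one using that by simp
      have "?M $$ (i * d + k, q) = (\<Sum>\<^sub>\<infinity>a\<in>arrows G (x j) (x i).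
          f a * \<rho> (mul G (mul G (ginv G (g i)) a) (g j)) $$ (k, l))"
        using lt q dm by (simp add: orbit_rep_Cc_def Let_def zz[OF \<rho>c] j_def[symmetric] l_def[symmetric])
      also have "\<dots> = infsum (\<lambda>a. f a * \<rho> (mul G (mul G (ginv G (g i)) a) (g j)) $$ (k, l)) (?S' i)"
        by (rule infsum_cong_neutral) (auto simp: arrows_def)
      also have "\<dots> = (\<Sum>a\<in>?S' i. f a * \<rho> (mul G (mul G (ginv G (g i)) a) (g j)) $$ (k, l))"
        by (rule infsum_finite[OF finS'])
      finally show ?thesis .
    qed
    have col: "(\<Sum>k<d. U $$ (p, i * d + k) * \<rho> b $$ (k, l)) = vec_index (arrow_op (g i) *\<^sub>v (arrow_op b *\<^sub>v ?e)) p"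
      if i: "i < n" and b: "b \<in> arrows G x0 x0" for i b
    proof -
      have TE: "arrow_op (g i) * E \<in> carrier_mat N d" by (rule mult_carrier_mat[OF arrow_op_carrier Ec])
      have "(\<Sum>k<d. U $$ (p, i * d + k) * \<rho> b $$ (k, l)) = (\<Sum>k<d. (arrow_op (g i) * E) $$ (p, k) * \<rho> b $$ (k, l))"
      proof (rule sum.cong[OF refl])
        fix k assume "k \<in> {..<d}"
        then have kd: "k < d" by simp
        have "i * d + k < Suc i * d" using kd by simp
        also have "\<dots> \<le> n * d" using i by (intro mult_le_mono1) simp
        finally have "U $$ (p, i * d + k) = vec_index (arrow_op (g i) *\<^sub>v (E *\<^sub>v unit_vec d k)) p"
          using p kd by (simp add: U_def del: index_mult_mat_vec)
        also have "\<dots> = vec_index ((arrow_op (g i) * E) *\<^sub>v unit_vec d k) p"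
          by (subst mult_mat_vec_assoc[OF arrow_op_carrier Ec]) auto
        also have "\<dots> = (arrow_op (g i) * E) $$ (p, k)" by (rule mult_unit_vec_index[OF TE p kd])
        finally show "U $$ (p, i * d + k) * \<rho> b $$ (k, l) = (arrow_op (g i) * E) $$ (p, k) * \<rho> b $$ (k, l)" by simp
      qed
      also have "\<dots> = ((arrow_op (g i) * E) * \<rho> b) $$ (p, l)" by (rule mult_mat_index[OF TE \<rho>c p l, symmetric])
      also have "\<dots> = vec_index (((arrow_op (g i) * E) * \<rho> b) *\<^sub>v unit_vec d l) p"
        by (rule mult_unit_vec_index[OF mult_carrier_mat[OF TE \<rho>c] p l, symmetric])
      also have "((arrow_op (g i) * E) * \<rho> b) *\<^sub>v unit_vec d l = (arrow_op (g i) * E) *\<^sub>v (\<rho> b *\<^sub>v unit_vec d l)"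
        by (rule mult_mat_vec_assoc[OF TE \<rho>c]) simp
      also have "\<dots> = arrow_op (g i) *\<^sub>v (E *\<^sub>v (\<rho> b *\<^sub>v unit_vec d l))"
        by (rule mult_mat_vec_assoc[OF arrow_op_carrier Ec mult_mat_vec_carrier[OF \<rho>c]]) simp
      also have "E *\<^sub>v (\<rho> b *\<^sub>v unit_vec d l) = arrow_op b *\<^sub>v ?e" by (rule E\<rho>[OF b]) simp
      finally show ?thesis .
    qed
    have arrow_op_term: "arrow_op (g i) *\<^sub>v (arrow_op (mul G (mul G (ginv G (g i)) a) (g j)) *\<^sub>v ?e) = arrow_op a *\<^sub>v u"
      if i: "i < n" and a: "a \<in> ?S' i" for i a
    proof -
      let ?b = "mul G (mul G (ginv G (g i)) a) (g j)"
      have b: "src G ?b = x0" "tgt G ?b = x0" using h(1)[OF i a] by (auto simp: arrows_def)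
      have "arrow_op (g i) *\<^sub>v (arrow_op ?b *\<^sub>v ?e) = arrow_op (mul G (g i) ?b) *\<^sub>v ?e"
        by (rule arrow_op_mul[symmetric]) (use b st(1)[OF i] eV in auto)
      also have "mul G (g i) ?b = mul G a (g j)" by (rule h(2)[OF i a])
      also have "arrow_op (mul G a (g j)) *\<^sub>v ?e = arrow_op a *\<^sub>v (arrow_op (g j) *\<^sub>v ?e)"
        by (rule arrow_op_mul) (use a st[OF j] eV in auto)
      finally show ?thesis by (simp only: u_def)
    qed
    have "(U * ?M) $$ (p, q) = (\<Sum>r<n * d. U $$ (p, r) * ?M $$ (r, q))" by (rule mult_mat_index[OF U M p q])
    also have "\<dots> = (\<Sum>i<n. \<Sum>k<d. U $$ (p, i * d + k) * ?M $$ (i * d + k, q))" by (rule sum_blocks)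
    also have "\<dots> = (\<Sum>i<n. \<Sum>a\<in>?S' i. f a * vec_index (arrow_op a *\<^sub>v u) p)"
    proof (rule sum.cong[OF refl])
      fix i assume "i \<in> {..<n}"
      then have i: "i < n" by simp
      let ?R = "\<lambda>a. \<rho> (mul G (mul G (ginv G (g i)) a) (g j))"
      have "(\<Sum>k<d. U $$ (p, i * d + k) * ?M $$ (i * d + k, q)) =
          (\<Sum>k<d. \<Sum>a\<in>?S' i. f a * (U $$ (p, i * d + k) * ?R a $$ (k, l)))"
      proof (rule sum.cong[OF refl])
        fix k assume "k \<in> {..<d}"
        then have kd: "k < d" by simp
        show "U $$ (p, i * d + k) * ?M $$ (i * d + k, q) = (\<Sum>a\<in>?S' i. f a * (U $$ (p, i * d + k) * ?R a $$ (k, l)))"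
          unfolding Mentry[OF i kd] sum_distrib_left by (rule sum.cong[OF refl]) (simp only: mult_ac)
      qed
      also have "\<dots> = (\<Sum>a\<in>?S' i. \<Sum>k<d. f a * (U $$ (p, i * d + k) * ?R a $$ (k, l)))" by (rule sum.swap)
      also have "\<dots> = (\<Sum>a\<in>?S' i. f a * vec_index (arrow_op a *\<^sub>v u) p)"
      proof (rule sum.cong[OF refl])
        fix a assume a: "a \<in> ?S' i"
        show "(\<Sum>k<d. f a * (U $$ (p, i * d + k) * ?R a $$ (k, l))) = f a * vec_index (arrow_op a *\<^sub>v u) p"
          unfolding sum_distrib_left[symmetric] col[OF i h(1)[OF i a]] arrow_op_term[OF i a] ..
      qed
      finally show "(\<Sum>k<d. U $$ (p, i * d + k) * ?M $$ (i * d + k, q)) = (\<Sum>a\<in>?S' i. f a * vec_index (arrow_op a *\<^sub>v u) p)" .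
    qed
    also have "\<dots> = (\<Sum>y\<in>F. \<Sum>a | a \<in> ?S \<and> tgt G a = y. f a * vec_index (arrow_op a *\<^sub>v u) p)"
      by (rule sum.reindex_bij_betw[OF x(1)])
    also have "\<dots> = (\<Sum>a\<in>?S. f a * vec_index (arrow_op a *\<^sub>v u) p)"
    proof (rule sum.group[OF finS fin])
      show "tgt G ` ?S \<subseteq> F"
      proof
        fix y assume "y \<in> tgt G ` ?S"
        then obtain a where a: "src G a = x j" "y = tgt G a" by blast
        have "mul G a (g j) \<in> arrows G x0 y" using a st[OF j] by (simp add: arrows_def)
        then show "y \<in> F" unfolding F_def using a(2) by auto
      qed
    qed
    also have "\<dots> = vec_index (s f *\<^sub>v u) p" by (rule act_formula[OF xj uV f p, symmetric])
    also have "\<dots> = (s f * U) $$ (p, q)"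
    proof -
      have "vec_index (s f *\<^sub>v u) p = (\<Sum>r<N. s f $$ (p, r) * vec_index u r)"
        by (rule mult_mat_vec_index[OF s_carrier[OF f] fibreD(1)[OF uV] p])
      also have "\<dots> = (\<Sum>r<N. s f $$ (p, r) * U $$ (r, q))"
        using q by (intro sum.cong refl) (simp add: U_def u_def j_def l_def del: index_mult_mat_vec)
      also have "\<dots> = (s f * U) $$ (p, q)" by (rule mult_mat_index[OF s_carrier[OF f] U p q, symmetric])
      finally show ?thesis .
    qed
    finally show "(s f * U) $$ (p, q) = (U * ?M) $$ (p, q)" by simp
  qed
  ultimately show ?thesis by blast
qed

end

section \<open>Irreducible representations\<close>

lemma is_subspace_subspace:
  assumes "is_subspace n W"
  shows "VectorSpace.subspace class_ring W (module_vec TYPE(complex) n)"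
proof -
  interpret vec_space "TYPE(complex)" n .
  show ?thesis
    unfolding subspace_def submodule_def
    using vec_vs[of n] vec_module[of n] assms by (auto simp: is_subspace_def module_vec_simps)
qed

context etale_rep
begin

text \<open>
  The vectors killed by all of \<open>Cc G\<close> form a subspace that is killed by all of
  \<open>\<pi>\<close>, by continuity; irreducibility leaves only zero.
\<close>

lemma irreducible_rep_Cc:
  assumes irr: "irreducible_rep G N \<pi>"
  shows "Cc_rep G N rep_Cc"
proof -
  obtain A0 where A0: "A0 \<in> Cstar G" "\<pi> A0 \<noteq> 0\<^sub>m N N" using irr by (auto simp: irreducible_rep_def)
  have inv: "W = {0\<^sub>v N} \<or> W = carrier_vec N"
    if "is_subspace N W" "\<And>A w. A \<in> Cstar G \<Longrightarrow> w \<in> W \<Longrightarrow> \<pi> A *\<^sub>v w \<in> W" for W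
    using irr is_subspace_subspace[OF that(1)] that(2) unfolding irreducible_rep_def by blast
  have pi_zero: "\<pi> A *\<^sub>v w = 0\<^sub>v N"
    if A: "A \<in> Cstar G" and w: "w \<in> carrier_vec N" and z: "\<And>f. f \<in> Cc G \<Longrightarrow> rep_Cc f *\<^sub>v w = 0\<^sub>v N" for A w
  proof -
    obtain u where u: "u \<in> cauchy_seqs G" "A = cclass u" by (rule Cstar_cclass[OF A])
    note P = pi_carrier[OF u(1)]
    show ?thesis unfolding u(2)
    proof (rule eq_vecI)
      fix i assume "i < dim_vec (0\<^sub>v N :: complex vec)"
      then have i: "i < N" by simp
      have "(\<lambda>m. vec_index (rep_Cc (u m) *\<^sub>v w) i) \<longlonglongrightarrow> vec_index (\<pi> (cclass u) *\<^sub>v w) i"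
        by (rule vec_index_tendsto[OF rep_Cc_carrier[OF cauchyD(1)[OF u(1)]] P w rep_Cc_tendsto[OF u(1) i] i])
      then have "(\<lambda>m. 0) \<longlonglongrightarrow> vec_index (\<pi> (cclass u) *\<^sub>v w) i" using z[OF cauchyD(1)[OF u(1)]] i by simp
      then show "vec_index (\<pi> (cclass u) *\<^sub>v w) i = vec_index (0\<^sub>v N) i"
        using LIMSEQ_unique[OF _ tendsto_const] i by fastforce
    qed (use P in simp)
  qed
  have N: "0 < N"
  proof (rule ccontr)
    assume "\<not> 0 < N"
    obtain u where u: "u \<in> cauchy_seqs G" "A0 = cclass u" by (rule Cstar_cclass[OF A0(1)])
    have "\<pi> A0 = 0\<^sub>m N N" using pi_carrier[OF u(1)] \<open>\<not> 0 < N\<close> unfolding u(2) by (intro eq_matI) auto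
    then show False using A0(2) by simp
  qed
  define W where "W = {w \<in> carrier_vec N. \<forall>f\<in>Cc G. rep_Cc f *\<^sub>v w = 0 \<cdot>\<^sub>v w}"
  have sW: "is_subspace N W" unfolding W_def by (rule joint_eigenspace) (rule rep_Cc_carrier)
  have W_iff: "w \<in> W \<longleftrightarrow> w \<in> carrier_vec N \<and> (\<forall>f\<in>Cc G. rep_Cc f *\<^sub>v w = 0\<^sub>v N)" for w
    unfolding W_def using zero_smult[of w N] by auto
  have "W = {0\<^sub>v N} \<or> W = carrier_vec N"
  proof (rule inv[OF sW])
    fix A w assume A: "A \<in> Cstar G" and w: "w \<in> W"
    have "\<pi> A *\<^sub>v w = 0\<^sub>v N" by (rule pi_zero[OF A]) (use w W_iff in blast)+
    then show "\<pi> A *\<^sub>v w \<in> W" using is_subspaceD(2)[OF sW] by simp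
  qed
  moreover have "W \<noteq> carrier_vec N"
  proof
    assume W: "W = carrier_vec N"
    obtain u where u: "u \<in> cauchy_seqs G" "A0 = cclass u" by (rule Cstar_cclass[OF A0(1)])
    have "\<pi> A0 = 0\<^sub>m N N"
    proof (rule mat_eqI_vec)
      show "\<pi> A0 \<in> carrier_mat N N" unfolding u(2) by (rule pi_carrier[OF u(1)])
      fix w :: "complex vec" assume w: "w \<in> carrier_vec N"
      have "\<pi> A0 *\<^sub>v w = 0\<^sub>v N" by (rule pi_zero[OF A0(1) w]) (use w W W_iff in blast)
      also have "0\<^sub>v N = 0\<^sub>m N N *\<^sub>v w" using w by (intro eq_vecI) (auto simp: scalar_prod_def)
      finally show "\<pi> A0 *\<^sub>v w = 0\<^sub>m N N *\<^sub>v w" .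
    qed simp
    then show False using A0(2) by simp
  qed
  ultimately have W: "W = {0\<^sub>v N}" by blast
  show ?thesis
  proof unfold_locales
    show "v = 0\<^sub>v N" if "v \<in> carrier_vec N" "\<And>f. f \<in> Cc G \<Longrightarrow> rep_Cc f *\<^sub>v v = 0\<^sub>v N" for v
      using that W W_iff by blast
  qed (fact rep_Cc N)+
qed

text \<open>
  The range of the intertwining isometry \<open>U\<close> is invariant under \<open>Cc G\<close>,
  hence under \<open>\<pi>\<close> by continuity, and irreducibility makes \<open>U\<close>
  unitary. Both representations are limits of their values on \<open>Cc G\<close>, so the
  equivalence extends to the completion.
\<close>

lemma equivalent_orbit_rep:
  assumes irr: "irreducible_rep G N \<pi>"
  shows "\<exists>F n x d \<rho> z g. orbit_data G F n x d \<rho> z g \<and>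
    unitarily_equivalent G N \<pi> (n * d) (orbit_rep G n x d \<rho> z g)"
proof -
  interpret R: Cc_rep G N rep_Cc by (rule irreducible_rep_Cc[OF irr])
  obtain F n x d \<rho> z g U where dat: "orbit_data G F n x d \<rho> z g" and U: "isometry N (n * d) U"
    and nd: "0 < n * d" and tw: "\<And>f. f \<in> Cc G \<Longrightarrow> rep_Cc f * U = U * orbit_rep_Cc G n x d \<rho> z g f"
    using R.intertwining_isometry by blast
  let ?M = "orbit_rep_Cc G n x d \<rho> z g"
  let ?k = "n * d"
  have Uc: "U \<in> carrier_mat N ?k" and UU: "mat_adjoint U * U = 1\<^sub>m ?k" using U by (auto simp: isometry_def)
  have Ac: "mat_adjoint U \<in> carrier_mat ?k N" using Uc by simp
  have Mc: "?M f \<in> carrier_mat ?k ?k" for f by (simp add: orbit_rep_Cc_def)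
  have Mf: "?M f = mat_adjoint U * (rep_Cc f * U)" if f: "f \<in> Cc G" for f
  proof -
    have "mat_adjoint U * (rep_Cc f * U) = (mat_adjoint U * U) * ?M f"
      unfolding tw[OF f] by (rule assoc_mult_mat[OF Ac Uc Mc, symmetric])
    then show ?thesis unfolding UU using Mc[of f] by simp
  qed
  have lim: "(\<lambda>m. ?M (u m) $$ (i, j)) \<longlonglongrightarrow> (mat_adjoint U * (\<pi> (cclass u) * U)) $$ (i, j)"
    if u: "u \<in> cauchy_seqs G" and ij: "i < ?k" "j < ?k" for u i j
    unfolding Mf[OF cauchyD(1)[OF u]]
    by (rule mult_tendsto[OF rep_Cc_carrier[OF cauchyD(1)[OF u]] pi_carrier[OF u] Ac Uc ij rep_Cc_tendsto[OF u]])
  have ext: "orbit_rep G n x d \<rho> z g (cclass u) = mat_adjoint U * (\<pi> (cclass u) * U)" if u: "u \<in> cauchy_seqs G" for u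
  proof (rule eq_matI)
    have c: "mat_adjoint U * (\<pi> (cclass u) * U) \<in> carrier_mat ?k ?k"
      by (rule mult_carrier_mat[OF Ac mult_carrier_mat[OF pi_carrier[OF u] Uc]])
    show "dim_row (orbit_rep G n x d \<rho> z g (cclass u)) = dim_row (mat_adjoint U * (\<pi> (cclass u) * U))"
      "dim_col (orbit_rep G n x d \<rho> z g (cclass u)) = dim_col (mat_adjoint U * (\<pi> (cclass u) * U))"
      using c by (simp_all add: orbit_rep_def extend_rep_def carrier_matD[OF Uc])
    fix i j assume "i < dim_row (mat_adjoint U * (\<pi> (cclass u) * U))" "j < dim_col (mat_adjoint U * (\<pi> (cclass u) * U))"
    then have ij: "i < ?k" "j < ?k" using carrier_matD[OF c] by auto
    have "orbit_rep G n x d \<rho> z g (cclass u) $$ (i, j) =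
        (THE c. \<forall>w\<in>cclass u. (\<lambda>m. ?M (w m) $$ (i, j)) \<longlonglongrightarrow> c)"
      using ij by (simp add: orbit_rep_def extend_rep_def)
    also have "\<dots> = (mat_adjoint U * (\<pi> (cclass u) * U)) $$ (i, j)"
    proof (rule the_equality)
      show "\<forall>w\<in>cclass u. (\<lambda>m. ?M (w m) $$ (i, j)) \<longlonglongrightarrow> (mat_adjoint U * (\<pi> (cclass u) * U)) $$ (i, j)"
      proof
        fix w assume w: "w \<in> cclass u"
        show "(\<lambda>m. ?M (w m) $$ (i, j)) \<longlonglongrightarrow> (mat_adjoint U * (\<pi> (cclass u) * U)) $$ (i, j)"
          using lim[OF cclass_mem(1)[OF w] ij] unfolding cclass_mem(2)[OF w] .
      qed
      fix c assume "\<forall>w\<in>cclass u. (\<lambda>m. ?M (w m) $$ (i, j)) \<longlonglongrightarrow> c"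
      then have "(\<lambda>m. ?M (u m) $$ (i, j)) \<longlonglongrightarrow> c" using cclass_self[OF u] by blast
      then show "c = (mat_adjoint U * (\<pi> (cclass u) * U)) $$ (i, j)" by (rule LIMSEQ_unique[OF _ lim[OF u ij]])
    qed
    finally show "orbit_rep G n x d \<rho> z g (cclass u) $$ (i, j) = (mat_adjoint U * (\<pi> (cclass u) * U)) $$ (i, j)" .
  qed
  have proj: "U * (mat_adjoint U * (\<pi> (cclass u) * U)) = \<pi> (cclass u) * U" if u: "u \<in> cauchy_seqs G" for u
  proof (rule eq_matI)
    note P = pi_carrier[OF u]
    have c: "U * (mat_adjoint U * (\<pi> (cclass u) * U)) \<in> carrier_mat N ?k" "\<pi> (cclass u) * U \<in> carrier_mat N ?k"
      by (intro mult_carrier_mat[OF Uc] mult_carrier_mat[OF Ac] mult_carrier_mat[OF P Uc])+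
    show "dim_row (U * (mat_adjoint U * (\<pi> (cclass u) * U))) = dim_row (\<pi> (cclass u) * U)"
      "dim_col (U * (mat_adjoint U * (\<pi> (cclass u) * U))) = dim_col (\<pi> (cclass u) * U)"
      unfolding carrier_matD[OF c(1)] carrier_matD[OF c(2)] by auto
    fix i j assume "i < dim_row (\<pi> (cclass u) * U)" "j < dim_col (\<pi> (cclass u) * U)"
    then have ij: "i < N" "j < ?k" using carrier_matD[OF c(2)] by auto
    have PU: "U * mat_adjoint U \<in> carrier_mat N N" by (rule mult_carrier_mat[OF Uc Ac])
    have as: "U * (mat_adjoint U * (B * U)) = (U * mat_adjoint U) * (B * U)" if "B \<in> carrier_mat N N" for B
      by (rule assoc_mult_mat[OF Uc Ac mult_carrier_mat[OF that Uc], symmetric])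
    (* The invariance identity passes to the limit; the factor 1 puts both sides into the form L *
       (A * R) whose limit is known. *)
    have one: "1\<^sub>m N * (B * U) = B * U" if "B \<in> carrier_mat N N" for B
      by (rule left_mult_one_mat[OF mult_carrier_mat[OF that Uc]])
    have e: "(U * mat_adjoint U) * (rep_Cc (u m) * U) = 1\<^sub>m N * (rep_Cc (u m) * U)" for m
    proof -
      note S = rep_Cc_carrier[OF cauchyD(1)[OF u], of m]
      have "(U * mat_adjoint U) * (rep_Cc (u m) * U) = U * ?M (u m)"
        unfolding as[OF S, symmetric] Mf[OF cauchyD(1)[OF u], symmetric] ..
      also have "\<dots> = rep_Cc (u m) * U" by (rule tw[OF cauchyD(1)[OF u], symmetric])
      finally show ?thesis unfolding one[OF S] .
    qed
    have "(\<lambda>m. ((U * mat_adjoint U) * (rep_Cc (u m) * U)) $$ (i, j)) \<longlonglongrightarrow> ((U * mat_adjoint U) * (\<pi> (cclass u) * U)) $$ (i, j)"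
      by (rule mult_tendsto[OF rep_Cc_carrier[OF cauchyD(1)[OF u]] P PU Uc ij rep_Cc_tendsto[OF u]])
    moreover have "(\<lambda>m. (1\<^sub>m N * (rep_Cc (u m) * U)) $$ (i, j)) \<longlonglongrightarrow> (1\<^sub>m N * (\<pi> (cclass u) * U)) $$ (i, j)"
      by (rule mult_tendsto[OF rep_Cc_carrier[OF cauchyD(1)[OF u]] P one_carrier_mat Uc ij rep_Cc_tendsto[OF u]])
    ultimately have "((U * mat_adjoint U) * (\<pi> (cclass u) * U)) $$ (i, j) = (1\<^sub>m N * (\<pi> (cclass u) * U)) $$ (i, j)"
      unfolding e by (rule LIMSEQ_unique)
    then show "(U * (mat_adjoint U * (\<pi> (cclass u) * U))) $$ (i, j) = (\<pi> (cclass u) * U) $$ (i, j)"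
      unfolding as[OF P] one[OF P] .
  qed
  define W where "W = (*\<^sub>v) U ` carrier_vec ?k"
  have sW: "is_subspace N W" unfolding is_subspace_def
  proof (intro conjI ballI allI)
    show "W \<subseteq> carrier_vec N" unfolding W_def using mult_mat_vec_carrier[OF Uc] by blast
    show "0\<^sub>v N \<in> W" unfolding W_def
      by (rule image_eqI[where x="0\<^sub>v ?k"]) (simp_all only: mult_zero_vec[OF Uc] zero_carrier_vec)
    fix v assume "v \<in> W"
    then obtain y where y: "v = U *\<^sub>v y" "y \<in> carrier_vec ?k" unfolding W_def by (rule imageE)
    have "c \<cdot>\<^sub>v v = U *\<^sub>v (c \<cdot>\<^sub>v y)" for c
      unfolding y(1) by (rule mult_mat_vec[OF Uc y(2), symmetric])
    moreover have "c \<cdot>\<^sub>v y \<in> carrier_vec ?k" for c using y(2) by simp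
    ultimately show "c \<cdot>\<^sub>v v \<in> W" for c unfolding W_def by (rule image_eqI)
    fix w assume "w \<in> W"
    then obtain y' where y': "w = U *\<^sub>v y'" "y' \<in> carrier_vec ?k" unfolding W_def by (rule imageE)
    have "v + w = U *\<^sub>v (y + y')"
      unfolding y(1) y'(1) by (rule mult_add_distrib_mat_vec[OF Uc y(2) y'(2), symmetric])
    then show "v + w \<in> W" unfolding W_def by (rule image_eqI) (rule add_carrier_vec[OF y(2) y'(2)])
  qed
  have "W = {0\<^sub>v N} \<or> W = carrier_vec N"
  proof -
    have "\<pi> A *\<^sub>v w \<in> W" if A: "A \<in> Cstar G" and w: "w \<in> W" for A w
    proof -
      obtain u where u: "u \<in> cauchy_seqs G" "A = cclass u" by (rule Cstar_cclass[OF A])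
      obtain y where y: "y \<in> carrier_vec ?k" "w = U *\<^sub>v y" using w unfolding W_def by blast
      let ?B = "mat_adjoint U * (\<pi> (cclass u) * U)"
      have B: "?B \<in> carrier_mat ?k ?k"
        by (rule mult_carrier_mat[OF Ac mult_carrier_mat[OF pi_carrier[OF u(1)] Uc]])
      have "\<pi> A *\<^sub>v w = (\<pi> (cclass u) * U) *\<^sub>v y"
        unfolding u(2) y(2) by (rule mult_mat_vec_assoc[OF pi_carrier[OF u(1)] Uc y(1), symmetric])
      also have "\<dots> = (U * ?B) *\<^sub>v y" by (rule arg_cong[OF proj[OF u(1), symmetric]])
      also have "\<dots> = U *\<^sub>v (?B *\<^sub>v y)" by (rule mult_mat_vec_assoc[OF Uc B y(1)])
      finally show ?thesis unfolding W_def by (rule image_eqI[OF _ mult_mat_vec_carrier[OF B y(1)]])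
    qed
    then show ?thesis using irr is_subspace_subspace[OF sW] unfolding irreducible_rep_def by blast
  qed
  moreover have "W \<noteq> {0\<^sub>v N}"
  proof
    assume W0: "W = {0\<^sub>v N}"
    let ?e = "unit_vec ?k 0 :: complex vec"
    have "U *\<^sub>v ?e \<in> W" unfolding W_def by (rule imageI) (rule unit_vec_carrier)
    then have "U *\<^sub>v ?e = 0\<^sub>v N" using W0 by blast
    then have "ip ?e ?e = 0" using isometry_ip[OF U, of ?e ?e] by (simp add: ip_def)
    then have "?e = 0\<^sub>v ?k" by (rule ip_self_zero[rotated]) simp
    then have "vec_index ?e 0 = vec_index (0\<^sub>v ?k :: complex vec) 0" by simp
    then show False using nd by simp
  qed
  ultimately have W: "W = carrier_vec N" by blast
  have UU': "U * mat_adjoint U = 1\<^sub>m N"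
  proof (rule mat_eqI_vec[OF mult_carrier_mat[OF Uc Ac] one_carrier_mat])
    fix w :: "complex vec" assume w: "w \<in> carrier_vec N"
    then obtain y where y: "y \<in> carrier_vec ?k" "w = U *\<^sub>v y" using W unfolding W_def by blast
    have "(U * mat_adjoint U) *\<^sub>v w = U *\<^sub>v (mat_adjoint U *\<^sub>v w)"
      by (rule mult_mat_vec_assoc[OF Uc Ac w])
    also have "mat_adjoint U *\<^sub>v w = (mat_adjoint U * U) *\<^sub>v y"
      unfolding y(2) by (rule mult_mat_vec_assoc[OF Ac Uc y(1), symmetric])
    also have "\<dots> = y" unfolding UU using y(1) by simp
    finally show "(U * mat_adjoint U) *\<^sub>v w = 1\<^sub>m N *\<^sub>v w" using y(2) w by simp
  qed
  have "unitary_op ?k N U" using Uc UU UU' by (simp add: unitary_op_def)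
  moreover have "\<pi> A = U * orbit_rep G n x d \<rho> z g A * mat_adjoint U" if A: "A \<in> Cstar G" for A
  proof -
    obtain u where u: "u \<in> cauchy_seqs G" "A = cclass u" by (rule Cstar_cclass[OF A])
    note P = pi_carrier[OF u(1)]
    have "U * orbit_rep G n x d \<rho> z g A * mat_adjoint U = (\<pi> (cclass u) * U) * mat_adjoint U"
      unfolding u(2) ext[OF u(1)] proj[OF u(1)] ..
    also have "\<dots> = \<pi> (cclass u) * (U * mat_adjoint U)" by (rule assoc_mult_mat[OF P Uc Ac])
    also have "\<dots> = \<pi> A" unfolding UU' u(2) using P by simp
    finally show ?thesis by simp
  qed
  ultimately have "unitarily_equivalent G N \<pi> ?k (orbit_rep G n x d \<rho> z g)"
    unfolding unitarily_equivalent_def by blast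
  then show ?thesis using dat by blast
qed

end

theorem theorem2p5:
  fixes G :: "'g::{t2_space, second_countable_topology} groupoid"
    and N :: nat
    and \<pi> :: "'g cstar_elem \<Rightarrow> complex mat"
  assumes "etale_groupoid G"
    and "cstar_rep G N \<pi>"
    and "irreducible_rep G N \<pi>"
  shows "\<exists>F n x d \<rho> z \<gamma>.
    orbit_data G F n x d \<rho> z \<gamma> \<and>
    unitarily_equivalent G N \<pi> (n * d) (orbit_rep G n x d \<rho> z \<gamma>)"
proof -
  interpret etale_rep G N \<pi> by unfold_locales (fact assms)+
  show ?thesis by (rule equivalent_orbit_rep[OF assms(3)])
qed

end
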